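(* Fix $N\in\mathbb{N}$ and $t_0>0$. Then $X^N_j(\alpha,t_0)$, $(j,\alpha)\in\llbracket1,N\rrbracket\times\mathbb{N}_0$, satisfies the exponential Gibbs property.
   Context: $\mathbb{N}=\{1,2,\dots\}$, $\mathbb{N}_0=\mathbb{N}\cup\{0\}$; $\llbracket a,b\rrbracket$ is the set of integers from $a$ to $b$. Let $B_{ij}(t)$, $i,j\in\mathbb{N}$, be i.i.d. complex Brownian motions, $B_{ij}=\frac{1}{\sqrt2}b_{ij}+\frac{\mathrm i}{\sqrt2}\tilde b_{ij}$ with $b_{ij},\tilde b_{ij}$ independent standard real Brownian motions started at $0$. For $\alpha\in\mathbb{N}_0$, $t\ge0$ let $A^N(\alpha,t)=(B_{ij}(t))_{1\le i\le N+\alpha,1\le j\le N}$ and let $X_1^N(\alpha,t)\le\dots\le X_N^N(\alpha,t)$ be the ordered eigenvalues of $A^N(\alpha,t)^*A^N(\alpha,t)$. Let $\mathbb{W}^k=\{x\in\mathbb{R}^k:x_1<\dots<x_k\}$, $\mathbb{W}^k_+=\{x\in\mathbb{R}^k:0<x_1<\dots<x_k\}$, and write $\vec x\preceq\vec y$ if $x_1\le y_1\le x_2\le y_2\le\dots\le x_k\le y_k$. For $a<b$ in $\mathbb{N}_0$ and $\vec x,\vec y\in\mathbb{W}^k$, let $I_{a,b}(\vec x,\vec y)$ be the set of $(\vec w^\ell)_{\ell=a+1}^{b-1}$, $\vec w^\ell\in\mathbb{W}^k$, with $\vec x\preceq\vec w^{a+1}\preceq\dots\preceq\vec w^{b-1}\preceq\vec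 y$; for $\vec z=(z^a,\dots,z^b)\in\mathbb{R}^{b-a+1}$ let $I_{a,b}(\vec x,\vec y,\vec z)$ be the set of such tuples with $(\vec x,z^a)\preceq(\vec w^{a+1},z^{a+1})\preceq\dots\preceq(\vec w^{b-1},z^{b-1})\preceq(\vec y,z^b)$. $Z_{a,b}(\vec x,\vec y)$ and $Z_{a,b}(\vec x,\vec y,\vec z)$ denote their Lebesgue measures; when positive, $\mathbb{P}^{k,\llbracket a+1,b-1\rrbracket,\vec x,\vec y}$ and $\mathbb{P}^{k,\llbracket a+1,b-1\rrbracket,\vec x,\vec y,\vec z}$ denote the uniform probability measures (normalized Lebesgue) on these sets. Exponential Gibbs property for finite $N$: a sequence of random vectors $\vec X=(\vec X(a)\in\mathbb{W}_+^N,\ a\in\mathbb{N}_0)$, viewed as a random function on $\llbracket1,N\rrbracket\times\mathbb{N}_0$, satisfies it if both of the following hold. (1) For all $k\in\mathbb{N}$ with $k<N$ and $a<b$ in $\mathbb{N}_0$, with $\vec x=(X_1(a),\dots,X_k(a))$, $\vec y=(X_1(b),\dots,X_k(b))$, $\vec z=(X_{k+1}(a),\dots,X_{k+1}(b))$: with probability one $Z_{a,b}(\vec x,\vec y,\vec z)>0$, and the conditional law of $\vec X|_{\llbracket1,k\rrbracket\times\llbracket a+1,b-1\rrbracket}$ given $\vec X$ on the complement of $\llbracket1,k\rrbracket\times\llbracket a+1,b-1\rrbracket$ in $\llbracket1,N\rrbracket\times\mathbb{N}_0$ is $\mathbb{P}^{k,\llbracket a+1,b-1\rrbracket,\vec x,\vec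 y,\vec z}$. (2) For all $a<b$ in $\mathbb{N}_0$, with $\vec x=\vec X(a)$, $\vec y=\vec X(b)$: with probability one $Z_{a,b}(\vec x,\vec y)>0$, and the conditional law of $\vec X|_{\llbracket1,N\rrbracket\times\llbracket a+1,b-1\rrbracket}$ given $\vec X|_{\llbracket1,N\rrbracket\times(\mathbb{N}_0\setminus\llbracket a+1,b-1\rrbracket)}$ is $\mathbb{P}^{N,\llbracket a+1,b-1\rrbracket,\vec x,\vec y}$. *)

theory Defs
  imports
    "HOL-Probability.Probability"
    "Jordan_Normal_Form.Char_Poly"
    "Jordan_Normal_Form.Schur_Decomposition"
begin

section \<open>Complex Brownian motions\<close>

text \<open>Brownian motions have time set \<open>{0..}\<close>; values at negative times are irrelevant.\<close>

definition standard_brownian_motion :: "'w measure \<Rightarrow> (real \<Rightarrow> 'w \<Rightarrow> real) \<Rightarrow> bool" where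
  "standard_brownian_motion M b \<longleftrightarrow>
     (\<forall>t\<ge>0. b t \<in> borel_measurable M) \<and>
     (AE \<omega> in M. b 0 \<omega> = 0) \<and>
     (AE \<omega> in M. continuous_on {0..} (\<lambda>t. b t \<omega>)) \<and>
     (\<forall>s\<ge>0. \<forall>t>s. distributed M lborel (\<lambda>\<omega>. b t \<omega> - b s \<omega>) (normal_density 0 (sqrt (t - s)))) \<and>
     (\<forall>(n::nat) (t::nat \<Rightarrow> real). 0 \<le> t 0 \<and> (\<forall>i<n. t i \<le> t (Suc i)) \<longrightarrow>
        prob_space.indep_vars M (\<lambda>_. borel) (\<lambda>i \<omega>. b (t (Suc i)) \<omega> - b (t i) \<omega>) {..<n})"

definition path_of :: "(real \<Rightarrow> 'w \<Rightarrow> 'b) \<Rightarrow> 'w \<Rightarrow> real \<Rightarrow> 'b" where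
  "path_of b \<omega> = (\<lambda>t\<in>{0..}. b t \<omega>)"

abbreviation path_space :: "(real \<Rightarrow> 'b::topological_space) measure" where
  "path_space \<equiv> PiM {0..} (\<lambda>_. borel)"

definition complex_brownian_motion :: "'w measure \<Rightarrow> (real \<Rightarrow> 'w \<Rightarrow> complex) \<Rightarrow> bool" where
  "complex_brownian_motion M B \<longleftrightarrow>
     (\<exists>b b'. standard_brownian_motion M b \<and> standard_brownian_motion M b' \<and>
        prob_space.indep_var M path_space (path_of b) path_space (path_of b') \<and>
        (\<forall>t\<ge>0. \<forall>\<omega>\<in>space M.
           B t \<omega> = of_real (1 / sqrt 2 * b t \<omega>) + \<i> * of_real (1 / sqrt 2 * b' t \<omega>)))"

text \<open>Complex Brownian motions all have the same law, so in an i.i.d. family only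
  independence has to be required.\<close>

definition iid_complex_brownian_motions ::
    "'w measure \<Rightarrow> (nat \<Rightarrow> nat \<Rightarrow> real \<Rightarrow> 'w \<Rightarrow> complex) \<Rightarrow> bool" where
  "iid_complex_brownian_motions M B \<longleftrightarrow>
     (\<forall>i\<ge>1. \<forall>j\<ge>1. complex_brownian_motion M (B i j)) \<and>
     prob_space.indep_vars M (\<lambda>_. path_space) (\<lambda>(i, j). path_of (B i j)) ({1..} \<times> {1..})"

section \<open>Eigenvalues\<close>

text \<open>Only meant for matrices with real spectrum (here: Hermitian ones), where \<^const>\<open>Re\<close> is a
  mere change of type. Eigenvalues are repeated according to multiplicity.\<close>

definition ordered_eigenvalues :: "complex mat \<Rightarrow> real list" where
  "ordered_eigenvalues A = sorted_list_of_multiset (image_mset Re (proots (char_poly A)))"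

text \<open>Library matrices have indices starting from 0.\<close>

definition brownian_matrix ::
    "(nat \<Rightarrow> nat \<Rightarrow> real \<Rightarrow> 'w \<Rightarrow> complex) \<Rightarrow> nat \<Rightarrow> nat \<Rightarrow> real \<Rightarrow> 'w \<Rightarrow> complex mat" where
  "brownian_matrix B N \<alpha> t \<omega> = Matrix.mat (N + \<alpha>) N (\<lambda>(i, j). B (Suc i) (Suc j) t \<omega>)"

text \<open>\<open>laguerre_eigenvalue B N t (j, \<alpha>)\<close> is $X^N_j(\alpha,t)$, for $1 \le j \le N$.\<close>

definition laguerre_eigenvalue ::
    "(nat \<Rightarrow> nat \<Rightarrow> real \<Rightarrow> 'w \<Rightarrow> complex) \<Rightarrow> nat \<Rightarrow> real \<Rightarrow> nat \<times> nat \<Rightarrow> 'w \<Rightarrow> real" where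
  "laguerre_eigenvalue B N t = (\<lambda>(j, \<alpha>) \<omega>.
     ordered_eigenvalues (mat_adjoint (brownian_matrix B N \<alpha> t \<omega>) * brownian_matrix B N \<alpha> t \<omega>) ! (j - 1))"

section \<open>Interlacing tuples and uniform measures\<close>

text \<open>A vector in $\mathbb{R}^k$ is a function on \<open>nat\<close> of which only the values on \<open>{1..k}\<close> matter.
  A tuple $(\vec w^\ell)_{a<\ell<b}$ of such vectors is a function on index pairs \<open>(j, l)\<close>, extensional
  on \<open>{1..k} \<times> {a<..<b}\<close>.\<close>

definition weyl :: "nat \<Rightarrow> (nat \<Rightarrow> real) \<Rightarrow> bool" where
  "weyl k x \<longleftrightarrow> strict_mono_on {1..k} x"

definition weyl_pos :: "nat \<Rightarrow> (nat \<Rightarrow> real) \<Rightarrow> bool" where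
  "weyl_pos k x \<longleftrightarrow> weyl k x \<and> (\<forall>i\<in>{1..k}. 0 < x i)"

definition interlace :: "nat \<Rightarrow> (nat \<Rightarrow> real) \<Rightarrow> (nat \<Rightarrow> real) \<Rightarrow> bool" where
  "interlace k x y \<longleftrightarrow> (\<forall>i\<in>{1..k}. x i \<le> y i) \<and> (\<forall>i\<in>{1..<k}. y i \<le> x (Suc i))"

definition block :: "nat \<Rightarrow> nat \<Rightarrow> nat \<Rightarrow> (nat \<times> nat) set" where
  "block k a b = {1..k} \<times> {a<..<b}"

text \<open>If \<open>b = a + 1\<close>, the block is empty and \<open>tuple_lebesgue\<close> is the unit mass at the empty tuple.\<close>

definition tuple_lebesgue :: "nat \<Rightarrow> nat \<Rightarrow> nat \<Rightarrow> (nat \<times> nat \<Rightarrow> real) measure" where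
  "tuple_lebesgue k a b = PiM (block k a b) (\<lambda>_. lborel)"

definition level :: "nat \<Rightarrow> nat \<Rightarrow> (nat \<Rightarrow> real) \<Rightarrow> (nat \<Rightarrow> real) \<Rightarrow>
    (nat \<times> nat \<Rightarrow> real) \<Rightarrow> nat \<Rightarrow> nat \<Rightarrow> real" where
  "level a b x y w l = (if l = a then x else if l = b then y else (\<lambda>j. w (j, l)))"

definition I_free :: "nat \<Rightarrow> nat \<Rightarrow> nat \<Rightarrow> (nat \<Rightarrow> real) \<Rightarrow> (nat \<Rightarrow> real) \<Rightarrow>
    (nat \<times> nat \<Rightarrow> real) set" where
  "I_free k a b x y = {w \<in> space (tuple_lebesgue k a b).
     (\<forall>l\<in>{a<..<b}. weyl k (\<lambda>j. w (j, l))) \<and>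
     (\<forall>l\<in>{a..<b}. interlace k (level a b x y w l) (level a b x y w (Suc l)))}"

definition I_bdry :: "nat \<Rightarrow> nat \<Rightarrow> nat \<Rightarrow> (nat \<Rightarrow> real) \<Rightarrow> (nat \<Rightarrow> real) \<Rightarrow> (nat \<Rightarrow> real) \<Rightarrow>
    (nat \<times> nat \<Rightarrow> real) set" where
  "I_bdry k a b x y z = {w \<in> space (tuple_lebesgue k a b).
     (\<forall>l\<in>{a<..<b}. weyl k (\<lambda>j. w (j, l))) \<and>
     (\<forall>l\<in>{a..<b}. interlace (Suc k) ((level a b x y w l)(Suc k := z l))
                                   ((level a b x y w (Suc l))(Suc k := z (Suc l))))}"

definition Z_free :: "nat \<Rightarrow> nat \<Rightarrow> nat \<Rightarrow> (nat \<Rightarrow> real) \<Rightarrow> (nat \<Rightarrow> real) \<Rightarrow> ennreal" where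
  "Z_free k a b x y = emeasure (tuple_lebesgue k a b) (I_free k a b x y)"

definition Z_bdry :: "nat \<Rightarrow> nat \<Rightarrow> nat \<Rightarrow> (nat \<Rightarrow> real) \<Rightarrow> (nat \<Rightarrow> real) \<Rightarrow> (nat \<Rightarrow> real) \<Rightarrow> ennreal" where
  "Z_bdry k a b x y z = emeasure (tuple_lebesgue k a b) (I_bdry k a b x y z)"

definition P_free :: "nat \<Rightarrow> nat \<Rightarrow> nat \<Rightarrow> (nat \<Rightarrow> real) \<Rightarrow> (nat \<Rightarrow> real) \<Rightarrow>
    (nat \<times> nat \<Rightarrow> real) measure" where
  "P_free k a b x y = uniform_measure (tuple_lebesgue k a b) (I_free k a b x y)"

definition P_bdry :: "nat \<Rightarrow> nat \<Rightarrow> nat \<Rightarrow> (nat \<Rightarrow> real) \<Rightarrow> (nat \<Rightarrow> real) \<Rightarrow> (nat \<Rightarrow> real) \<Rightarrow>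
    (nat \<times> nat \<Rightarrow> real) measure" where
  "P_bdry k a b x y z = uniform_measure (tuple_lebesgue k a b) (I_bdry k a b x y z)"

section \<open>The exponential Gibbs property\<close>

text \<open>\<open>\<kappa>\<close> is (a.s. equal to) the conditional law of \<open>Y\<close>, with values in \<open>S\<close>, given \<open>F\<close>.\<close>

definition has_cond_law ::
    "'w measure \<Rightarrow> 'w measure \<Rightarrow> 'b measure \<Rightarrow> ('w \<Rightarrow> 'b) \<Rightarrow> ('w \<Rightarrow> 'b measure) \<Rightarrow> bool" where
  "has_cond_law M F S Y \<kappa> \<longleftrightarrow> Y \<in> M \<rightarrow>\<^sub>M S \<and>
     (\<forall>E\<in>sets S. AE \<omega> in M.
        real_cond_exp M F (indicator (Y -` E \<inter> space M)) \<omega> = measure (\<kappa> \<omega>) E)"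

definition restrict_field :: "(nat \<times> nat \<Rightarrow> 'w \<Rightarrow> real) \<Rightarrow> (nat \<times> nat) set \<Rightarrow>
    'w \<Rightarrow> nat \<times> nat \<Rightarrow> real" where
  "restrict_field X C \<omega> = (\<lambda>p\<in>C. X p \<omega>)"

definition sigma_field :: "'w measure \<Rightarrow> (nat \<times> nat \<Rightarrow> 'w \<Rightarrow> real) \<Rightarrow> (nat \<times> nat) set \<Rightarrow> 'w measure" where
  "sigma_field M X C = vimage_algebra (space M) (restrict_field X C) (PiM C (\<lambda>_. borel))"

text \<open>\<open>X (j, a)\<close> is the random variable $X_j(a)$; only \<open>j \<in> {1..N}\<close> matters. The first two conjuncts
  say that the $\vec X(a)$ are random vectors with values in $\mathbb{W}^N_+$.\<close>

definition exponential_gibbs :: "'w measure \<Rightarrow> nat \<Rightarrow> (nat \<times> nat \<Rightarrow> 'w \<Rightarrow> real) \<Rightarrow> bool" where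
  "exponential_gibbs M N X \<longleftrightarrow>
     (\<forall>j\<in>{1..N}. \<forall>a. X (j, a) \<in> borel_measurable M) \<and>
     (\<forall>a. AE \<omega> in M. weyl_pos N (\<lambda>j. X (j, a) \<omega>)) \<and>
     (\<forall>k a b. 1 \<le> k \<and> k < N \<and> a < b \<longrightarrow>
        (AE \<omega> in M. Z_bdry k a b (\<lambda>j. X (j, a) \<omega>) (\<lambda>j. X (j, b) \<omega>) (\<lambda>l. X (Suc k, l) \<omega>) > 0) \<and>
        has_cond_law M (sigma_field M X ({1..N} \<times> UNIV - block k a b))
          (tuple_lebesgue k a b) (restrict_field X (block k a b))
          (\<lambda>\<omega>. P_bdry k a b (\<lambda>j. X (j, a) \<omega>) (\<lambda>j. X (j, b) \<omega>) (\<lambda>l. X (Suc k, l) \<omega>))) \<and>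
     (\<forall>a b. a < b \<longrightarrow>
        (AE \<omega> in M. Z_free N a b (\<lambda>j. X (j, a) \<omega>) (\<lambda>j. X (j, b) \<omega>) > 0) \<and>
        has_cond_law M (sigma_field M X ({1..N} \<times> UNIV - block N a b))
          (tuple_lebesgue N a b) (restrict_field X (block N a b))
          (\<lambda>\<omega>. P_free N a b (\<lambda>j. X (j, a) \<omega>) (\<lambda>j. X (j, b) \<omega>)))"

end

theory Submission
  imports Defs "Subresultants.Subresultant_Gcd" "HOL-Computational_Algebra.Field_as_Ring"
begin

text \<open>Passing from \<open>\<alpha>\<close> to \<open>\<alpha> + 1\<close> adds an independent Gaussian row \<open>w\<close> to the matrix, i.e. the rank one
  matrix \<open>w\<^sup>* w\<close> to its Gram matrix. In an orthonormal eigenbasis the row is again Gaussian, so the squared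
  moduli of its coordinates are independent exponential variables. They are the residues of the secular
  equation, an explicit rational function of the old eigenvalues \<open>x\<close> and the new ones \<open>y\<close>, and a change of
  variables gives the transition density
  \<open>t\<^sup>-\<^sup>N \<Delta>(y) / \<Delta>(x) exp (- \<Sum> (y - x) / t)\<close> on interlacing pairs, where \<open>\<Delta>\<close> is the Vandermonde
  product. Since it has the form \<open>h(y) / h(x)\<close> on interlacing pairs, the product of these densities
  telescopes: given the values outside a block of levels and indices, those inside are uniformly
  distributed on the set allowed by interlacing.\<close>

section \<open>Changes of variables in finite products and unitary invariance\<close>

text \<open>The eigenbasis is chosen for one fixed matrix at a time while only the new row is
  integrated, so no measurable choice of eigenvectors is needed; measurability is required of the
  eigenvalues alone. The secular equation is used with distinct old eigenvalues, which is why
  simplicity of the spectrum is proved separately, through the zero set of a discriminant. The law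
  of level 0 is never computed: it suffices that its points are almost surely distinct, and all
  later levels are described by transition densities. Two mismatches are bridged at the end. The
  densities live on strict interlacing, whereas the Gibbs sets are given by weak inequalities; ties
  between adjacent levels are negligible for Lebesgue measure. And the Gibbs property conditions on
  infinitely many levels, whereas densities exist for finitely many; cylinder sets, each of which
  sees finitely many levels, determine the measures involved.\<close>

lemma nn_integral_PiM_transform:
  fixes \<mu> :: "'a measure" and \<nu> :: "'b measure"
    and h :: "'i \<Rightarrow> 'a \<Rightarrow> 'b" and k :: "'i \<Rightarrow> 'a \<Rightarrow> ennreal"
  assumes "sigma_finite_measure \<mu>" "sigma_finite_measure \<nu>" "finite J"
    and h: "\<And>i. i \<in> J \<Longrightarrow> h i \<in> \<mu> \<rightarrow>\<^sub>M \<nu>"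
    and k: "\<And>i. i \<in> J \<Longrightarrow> k i \<in> borel_measurable \<mu>"
    and eq: "\<And>i f. i \<in> J \<Longrightarrow> f \<in> borel_measurable \<nu> \<Longrightarrow>
      (\<integral>\<^sup>+x. f x \<partial>\<nu>) = (\<integral>\<^sup>+x. k i x * f (h i x) \<partial>\<mu>)"
    and F: "F \<in> borel_measurable (PiM J (\<lambda>_. \<nu>))"
  shows "(\<integral>\<^sup>+x. F x \<partial>PiM J (\<lambda>_. \<nu>)) =
    (\<integral>\<^sup>+x. (\<Prod>i\<in>J. k i (x i)) * F (\<lambda>i\<in>J. h i (x i)) \<partial>PiM J (\<lambda>_. \<mu>))"
  using assms(3) h k eq F
proof (induction J arbitrary: F rule: finite_induct)
  case empty
  interpret m: product_sigma_finite "\<lambda>_. \<mu>"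
    using assms(1) by (simp add: product_sigma_finite_def)
  interpret n: product_sigma_finite "\<lambda>_. \<nu>"
    using assms(2) by (simp add: product_sigma_finite_def)
  have "F (\<lambda>i\<in>{}. h i (x i)) = F (\<lambda>_. undefined)" for x by (simp add: restrict_def)
  then show ?case by (subst m.nn_integral_empty n.nn_integral_empty; simp)+
next
  case (insert i J)
  interpret m: product_sigma_finite "\<lambda>_. \<mu>"
    using assms(1) by (simp add: product_sigma_finite_def)
  interpret n: product_sigma_finite "\<lambda>_. \<nu>"
    using assms(2) by (simp add: product_sigma_finite_def)
  interpret \<mu>: sigma_finite_measure \<mu> by fact
  interpret \<nu>: sigma_finite_measure \<nu> by fact
  note [measurable] = insert.prems(4)
  have hm[measurable]: "h j \<in> \<mu> \<rightarrow>\<^sub>M \<nu>" "k j \<in> borel_measurable \<mu>" if "j \<in> insert i J" for j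
    using that insert.prems by auto
  have hi[measurable]: "h i \<in> \<mu> \<rightarrow>\<^sub>M \<nu>" "k i \<in> borel_measurable \<mu>" using hm by auto
  have upd[measurable]: "(\<lambda>(x,y). F (x(i := y))) \<in> borel_measurable (PiM J (\<lambda>_. \<nu>) \<Otimes>\<^sub>M \<nu>)"
    using measurable_comp[OF measurable_add_dim[of i J "\<lambda>_. \<nu>"] insert.prems(4)]
    by (simp add: comp_def case_prod_unfold)
  have m2[measurable]: "(\<lambda>x. F (x(i := y))) \<in> borel_measurable (PiM J (\<lambda>_. \<nu>))"
    if "y \<in> space \<nu>" for y
    using measurable_Pair2'[OF that, THEN measurable_compose, OF upd] by simp
  have m3: "(\<lambda>y. F (x(i := y))) \<in> borel_measurable \<nu>" if "x \<in> space (PiM J (\<lambda>_. \<nu>))" for x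
    using measurable_Pair1'[OF that, THEN measurable_compose, OF upd] by simp
  have upd2: "(\<lambda>(x, y). F (x(i := h i y))) \<in> borel_measurable (PiM J (\<lambda>_. \<nu>) \<Otimes>\<^sub>M \<mu>)"
    using measurable_compose[OF _ upd, of "\<lambda>(x,y). (x, h i y)"] by (simp add: case_prod_unfold)
  have "(\<integral>\<^sup>+x. F x \<partial>PiM (insert i J) (\<lambda>_. \<nu>)) =
      (\<integral>\<^sup>+x. (\<integral>\<^sup>+y. F (x(i := y)) \<partial>\<nu>) \<partial>PiM J (\<lambda>_. \<nu>))"
    by (rule n.product_nn_integral_insert) (use insert in auto)
  also have "\<dots> = (\<integral>\<^sup>+x. (\<integral>\<^sup>+y. k i y * F (x(i := h i y)) \<partial>\<mu>) \<partial>PiM J (\<lambda>_. \<nu>))"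
    by (intro nn_integral_cong insert.prems(3) m3) auto
  \<comment> \<open>Coordinate \<open>i\<close> has been transformed inside, with the others fixed.
    The induction hypothesis now transforms the others in the function that results, hence the
    generalisation over \<open>F\<close>.\<close>
  also have "\<dots> = (\<integral>\<^sup>+x. (\<Prod>j\<in>J. k j (x j)) *
      (\<integral>\<^sup>+y. k i y * F ((\<lambda>j\<in>J. h j (x j))(i := h i y)) \<partial>\<mu>) \<partial>PiM J (\<lambda>_. \<mu>))"
  proof (rule insert.IH)
    show "(\<lambda>x. \<integral>\<^sup>+ y. k i y * F (x(i := h i y)) \<partial>\<mu>) \<in> borel_measurable (Pi\<^sub>M J (\<lambda>_. \<nu>))"
      by (rule sigma_finite_measure.borel_measurable_nn_integral[OF assms(1)])
        (use upd2 in \<open>measurable\<close>)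
  qed (use insert.prems in auto)
  also have "\<dots> = (\<integral>\<^sup>+x. (\<integral>\<^sup>+y. (\<Prod>j\<in>insert i J. k j ((x(i := y)) j)) *
       F (\<lambda>j\<in>insert i J. h j ((x(i := y)) j)) \<partial>\<mu>) \<partial>PiM J (\<lambda>_. \<mu>))"
  proof (rule nn_integral_cong)
    fix x assume x: "x \<in> space (PiM J (\<lambda>_. \<mu>))"
    have xs: "(\<lambda>j\<in>J. h j (x j)) \<in> space (PiM J (\<lambda>_. \<nu>))"
      using x measurable_space[OF hm(1)] by (auto simp: space_PiM PiE_iff)
    have *: "(\<lambda>j\<in>insert i J. h j ((x(i := y)) j)) = (\<lambda>j\<in>J. h j (x j))(i := h i y)" for y
      using insert.hyps by (auto simp: fun_eq_iff restrict_def)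
    have **: "(\<Prod>j\<in>insert i J. k j ((x(i := y)) j)) = k i y * (\<Prod>j\<in>J. k j (x j))" for y
      using insert.hyps by (auto intro!: arg_cong2[where f=times] prod.cong)
    have "(\<lambda>y. k i y * F ((\<lambda>j\<in>J. h j (x j))(i := h i y))) \<in> borel_measurable \<mu>"
      using measurable_compose[OF hi(1) m3[OF xs]] by measurable
    then show "(\<Prod>j\<in>J. k j (x j)) * (\<integral>\<^sup>+y. k i y * F ((\<lambda>j\<in>J. h j (x j))(i := h i y)) \<partial>\<mu>) =
      (\<integral>\<^sup>+y. (\<Prod>j\<in>insert i J. k j ((x(i := y)) j)) * F (\<lambda>j\<in>insert i J. h j ((x(i := y)) j)) \<partial>\<mu>)"
      unfolding * ** by (subst nn_integral_cmult[symmetric]) (auto simp: mult_ac)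
  qed
  also have "\<dots> = (\<integral>\<^sup>+x. (\<Prod>j\<in>insert i J. k j (x j)) * F (\<lambda>j\<in>insert i J. h j (x j)) \<partial>PiM (insert i J) (\<lambda>_. \<mu>))"
  proof (rule m.product_nn_integral_insert[symmetric])
    have [measurable]: "(\<lambda>x. \<lambda>j\<in>insert i J. h j (x j)) \<in> PiM (insert i J) (\<lambda>_. \<mu>) \<rightarrow>\<^sub>M PiM (insert i J) (\<lambda>_. \<nu>)"
      by (rule measurable_restrict, rule measurable_compose[OF _ hm(1)],
        rule measurable_component_singleton)
    have [measurable]: "(\<lambda>x. \<Prod>j\<in>insert i J. k j (x j)) \<in> borel_measurable (PiM (insert i J) (\<lambda>_. \<mu>))"
      by (rule borel_measurable_prod_ennreal)
         (rule measurable_compose[OF _ hm(2)], rule measurable_component_singleton)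
    show "(\<lambda>x. (\<Prod>j\<in>insert i J. k j (x j)) * F (\<lambda>j\<in>insert i J. h j (x j)))
        \<in> borel_measurable (PiM (insert i J) (\<lambda>_. \<mu>))"
      by measurable
  qed (use insert in auto)
  finally show ?case .
qed

lemma nn_integral_lborel_reflect:
  fixes f :: "'a::euclidean_space \<Rightarrow> ennreal"
  assumes "f \<in> borel_measurable borel"
  shows "(\<integral>\<^sup>+x. f x \<partial>lborel) = (\<integral>\<^sup>+x. f (a - x) \<partial>lborel)"
proof -
  have "lborel = distr lborel borel (\<lambda>x::'a. a - x)"
    using lborel_affine[of "-1" a] by (simp add: density_1)
  then have "(\<integral>\<^sup>+x. f x \<partial>lborel) = (\<integral>\<^sup>+x. f x \<partial>distr lborel borel (\<lambda>x::'a. a - x))" by simp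
  also have "\<dots> = (\<integral>\<^sup>+x. f (a - x) \<partial>lborel)"
    by (rule nn_integral_distr) (use assms in auto)
  finally show ?thesis .
qed

lemma nn_integral_lborel_translate:
  fixes f :: "'a::euclidean_space \<Rightarrow> ennreal"
  assumes "f \<in> borel_measurable borel"
  shows "(\<integral>\<^sup>+x. f x \<partial>lborel) = (\<integral>\<^sup>+x. f (x + a) \<partial>lborel)"
proof -
  have "lborel = distr lborel borel (\<lambda>x::'a. x + a)"
    using lborel_affine[of 1 a] by (simp add: density_1 add.commute)
  then have "(\<integral>\<^sup>+x. f x \<partial>lborel) = (\<integral>\<^sup>+x. f x \<partial>distr lborel borel (\<lambda>x::'a. x + a))" by simp
  also have "\<dots> = (\<integral>\<^sup>+x. f (x + a) \<partial>lborel)"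
    by (rule nn_integral_distr) (use assms in auto)
  finally show ?thesis .
qed

lemma nn_integral_PiM_reflect:
  fixes F :: "('i \<Rightarrow> 'a::euclidean_space) \<Rightarrow> ennreal"
  assumes "finite J" "F \<in> borel_measurable (PiM J (\<lambda>_. lborel))"
  shows "(\<integral>\<^sup>+x. F (\<lambda>i\<in>J. a i - x i) \<partial>PiM J (\<lambda>_. lborel)) = (\<integral>\<^sup>+x. F x \<partial>PiM J (\<lambda>_. lborel))"
  using nn_integral_PiM_transform[OF sigma_finite_lborel sigma_finite_lborel assms(1),
    where h = "\<lambda>i x. a i - x" and k = "\<lambda>_ _. 1" and F = F] assms(2)
  by (simp add: nn_integral_lborel_reflect[symmetric])

lemma nn_integral_PiM_translate:
  fixes F :: "('i \<Rightarrow> 'a::euclidean_space) \<Rightarrow> ennreal"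
  assumes "finite J" "F \<in> borel_measurable (PiM J (\<lambda>_. lborel))"
  shows "(\<integral>\<^sup>+x. F (\<lambda>i\<in>J. x i + a i) \<partial>PiM J (\<lambda>_. lborel)) = (\<integral>\<^sup>+x. F x \<partial>PiM J (\<lambda>_. lborel))"
  using nn_integral_PiM_transform[OF sigma_finite_lborel sigma_finite_lborel assms(1),
    where h = "\<lambda>i x. x + a i" and k = "\<lambda>_ _. 1" and F = F] assms(2)
  by (simp add: nn_integral_lborel_translate[symmetric])

lemma nn_integral_PiM_scale:
  fixes F :: "('i \<Rightarrow> real) \<Rightarrow> ennreal"
  assumes "finite J" "F \<in> borel_measurable (PiM J (\<lambda>_. lborel))" "\<And>i. i \<in> J \<Longrightarrow> 0 < s i"
  shows "(\<integral>\<^sup>+x. F x \<partial>PiM J (\<lambda>_. lborel)) =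
    (\<Prod>i\<in>J. ennreal (s i)) * (\<integral>\<^sup>+x. F (\<lambda>i\<in>J. s i * x i) \<partial>PiM J (\<lambda>_. lborel))"
proof -
  have m: "(\<lambda>x. F (\<lambda>i\<in>J. s i * x i)) \<in> borel_measurable (PiM J (\<lambda>_. lborel))"
    by (rule measurable_compose[OF measurable_restrict assms(2)]) auto
  have "(\<integral>\<^sup>+x. F x \<partial>PiM J (\<lambda>_. lborel)) =
    (\<integral>\<^sup>+x. (\<Prod>i\<in>J. ennreal (s i)) * F (\<lambda>i\<in>J. s i * x i) \<partial>PiM J (\<lambda>_. lborel))"
  proof (rule nn_integral_PiM_transform[OF sigma_finite_lborel sigma_finite_lborel assms(1),
      where h = "\<lambda>i x. s i * x" and k = "\<lambda>i _. ennreal (s i)"])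
    fix i and f :: "real \<Rightarrow> ennreal"
    assume i: "i \<in> J" and f: "f \<in> borel_measurable lborel"
    have "(\<integral>\<^sup>+x. f x \<partial>lborel) = ennreal (s i) * (\<integral>\<^sup>+x. f (s i * x) \<partial>lborel)"
      using nn_integral_real_affine[of f "s i" 0] assms(3)[OF i] f by simp
    also have "\<dots> = (\<integral>\<^sup>+x. ennreal (s i) * f (s i * x) \<partial>lborel)"
      using f by (subst nn_integral_cmult) auto
    finally show "(\<integral>\<^sup>+x. f x \<partial>lborel) = (\<integral>\<^sup>+x. ennreal (s i) * f (s i * x) \<partial>lborel)" .
  qed (use assms in auto)
  with m show ?thesis by (simp add: nn_integral_cmult)
qed

text \<open>A disc of radius \<open>sqrt a\<close> has area \<open>pi * a\<close>, which is linear
  in \<open>a\<close>; hence the constant density \<open>pi\<close> on the positive half line. This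
  is why the squared modulus of a complex Gaussian is exponential.\<close>

lemma distr_cmod_square:
  "distr lborel borel (\<lambda>z::complex. (cmod z)\<^sup>2) = density lborel (\<lambda>u. ennreal pi * indicator {0<..} u)"
    (is "?L = ?R")
proof (rule measure_eqI_generator_eq[where E = "range atMost" and \<Omega> = UNIV and A = "\<lambda>n. {..real n}"])
  show "Int_stable (range atMost :: real set set)" by (auto simp: Int_stable_def)
  fix X :: "real set" assume "X \<in> range atMost"
  then obtain a where X: "X = {..a}" by auto
  have "(\<lambda>z::complex. (cmod z)\<^sup>2) -` {..a} = (if a \<ge> 0 then cball 0 (sqrt a) else {})"
    using real_sqrt_le_iff[of "(cmod _)\<^sup>2" a] order_trans[OF zero_le_power2, of "cmod _" a]
    by (auto simp: real_le_rsqrt simp del: real_sqrt_le_iff)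
  then have "emeasure ?L X = (if a \<ge> 0 then ennreal (pi * a) else 0)"
    using X by (simp add: emeasure_distr emeasure_cball unit_ball_vol_2)
  also have "\<dots> = emeasure ?R X"
  proof -
    have "emeasure ?R X = (\<integral>\<^sup>+u. ennreal pi * indicator {0<..a} u \<partial>lborel)"
      using X by (subst emeasure_density) (auto intro!: nn_integral_cong simp: indicator_def)
    also have "\<dots> = ennreal pi * emeasure lborel {0<..a}"
      by (subst nn_integral_cmult) auto
    finally show ?thesis by (auto simp: ennreal_mult)
  qed
  finally show "emeasure ?L X = emeasure ?R X" .
next
  show "sets ?L = sigma_sets UNIV (range atMost)" "sets ?R = sigma_sets UNIV (range atMost)"
    by (simp_all add: borel_eq_atMost)
next
  have "(\<lambda>z::complex. (cmod z)\<^sup>2) -` {..real i} = cball 0 (sqrt i)" for i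
    using real_sqrt_le_iff[of "(cmod _)\<^sup>2" "real i"]
    by (auto simp: real_le_rsqrt simp del: real_sqrt_le_iff)
  then show "emeasure ?L {..real i} \<noteq> \<infinity>" for i
    by (simp add: emeasure_distr emeasure_cball)
  show "(\<Union>i. {..real i}) = UNIV" by (auto simp: real_arch_simple)
qed auto

lemma nn_integral_cmod_square:
  assumes [measurable]: "f \<in> borel_measurable borel"
  shows "(\<integral>\<^sup>+z. f ((cmod z)\<^sup>2) \<partial>lborel) = (\<integral>\<^sup>+u. ennreal pi * indicator {0<..} u * f u \<partial>lborel)"
proof -
  have "(\<integral>\<^sup>+z. f ((cmod z)\<^sup>2) \<partial>lborel) = (\<integral>\<^sup>+u. f u \<partial>distr lborel borel (\<lambda>z::complex. (cmod z)\<^sup>2))"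
    by (subst nn_integral_distr) auto
  then show ?thesis unfolding distr_cmod_square by (simp add: nn_integral_density)
qed

section \<open>Complex Gaussian vectors: unitary invariance and squared moduli\<close>

definition cgauss_density :: "real \<Rightarrow> complex \<Rightarrow> real" where
  "cgauss_density t z = exp (- (cmod z)\<^sup>2 / t) / (pi * t)"

text \<open>The centred complex normal law with mean square modulus \<open>t\<close>: real and
  imaginary part are independent with variance \<open>t / 2\<close> each. It is the law of a complex
  Brownian motion at time \<open>t\<close>.\<close>

definition cgauss :: "real \<Rightarrow> complex measure" where
  "cgauss t = density lborel (\<lambda>z. ennreal (cgauss_density t z))"

lemma cgauss_density_measurable[measurable]: "cgauss_density t \<in> borel_measurable borel"
  unfolding cgauss_density_def by measurable

lemma sets_cgauss[simp, measurable_cong]: "sets (cgauss t) = sets borel"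
  and space_cgauss[simp]: "space (cgauss t) = UNIV"
  by (simp_all add: cgauss_def)

lemma nn_integral_cgauss_cmod_square:
  assumes [measurable]: "f \<in> borel_measurable borel" and t: "0 < t"
  shows "(\<integral>\<^sup>+z. f ((cmod z)\<^sup>2) \<partial>cgauss t) =
    (\<integral>\<^sup>+u. ennreal (exp (- u / t) / t) * indicator {0<..} u * f u \<partial>lborel)"
proof -
  have "(\<integral>\<^sup>+z. f ((cmod z)\<^sup>2) \<partial>cgauss t) =
      (\<integral>\<^sup>+z. (\<lambda>u. ennreal (exp (- u / t) / (pi * t)) * f u) ((cmod z)\<^sup>2) \<partial>lborel)"
    unfolding cgauss_def by (subst nn_integral_density) (auto simp: cgauss_density_def)
  also have "\<dots> = (\<integral>\<^sup>+u. ennreal pi * indicator {0<..} u * (ennreal (exp (- u / t) / (pi * t)) * f u) \<partial>lborel)"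
    by (rule nn_integral_cmod_square) measurable
  also have "\<dots> = (\<integral>\<^sup>+u. ennreal (exp (- u / t) / t) * indicator {0<..} u * f u \<partial>lborel)"
  proof (rule nn_integral_cong)
    fix u :: real
    have "ennreal pi * ennreal (exp (- u / t) / (pi * t)) = ennreal (exp (- u / t) / t)"
      using t by (subst ennreal_mult[symmetric]) auto
    then show "ennreal pi * indicator {0<..} u * (ennreal (exp (- u / t) / (pi * t)) * f u) =
      ennreal (exp (- u / t) / t) * indicator {0<..} u * f u"
      by (metis (no_types, lifting) mult.assoc mult.commute)
  qed
  finally show ?thesis .
qed

text \<open>The total mass is computed in the variable of the squared modulus, where it is that of
  the exponential law with rate \<open>1/t\<close>.\<close>

lemma prob_space_cgauss:
  assumes t: "0 < t" shows "prob_space (cgauss t)"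
proof
  have "emeasure (cgauss t) (space (cgauss t)) = (\<integral>\<^sup>+z. (\<lambda>_. 1) ((cmod z)\<^sup>2) \<partial>cgauss t)"
    by simp
  also have "\<dots> = (\<integral>\<^sup>+u. ennreal (exp (- u / t) / t) * indicator {0<..} u * 1 \<partial>lborel)"
    by (rule nn_integral_cgauss_cmod_square) (auto simp: t)
  also have "\<dots> = (\<integral>\<^sup>+u. ennreal (exponential_density (1/t) u) \<partial>lborel)"
    by (rule nn_integral_cong_AE, rule AE_mp[OF AE_lborel_singleton[of 0]])
       (auto simp: exponential_density_def indicator_def)
  also have "\<dots> = 1"
    using prob_space.emeasure_space_1[OF prob_space_exponential_density[of "1/t"]] t
    by (simp add: emeasure_density)
  finally show "emeasure (cgauss t) (space (cgauss t)) = 1" .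
qed

lemma nn_integral_PiM_cgauss:
  fixes F :: "('i \<Rightarrow> complex) \<Rightarrow> ennreal"
  assumes t: "0 < t" and J: "finite J" and F: "F \<in> borel_measurable (PiM J (\<lambda>_. lborel))"
  shows "(\<integral>\<^sup>+x. F x \<partial>PiM J (\<lambda>_. cgauss t)) =
    (\<integral>\<^sup>+x. ennreal (\<Prod>i\<in>J. cgauss_density t (x i)) * F x \<partial>PiM J (\<lambda>_. lborel))"
proof -
  interpret prob_space "cgauss t" by (rule prob_space_cgauss[OF t])
  have s: "sets (PiM J (\<lambda>_. cgauss t)) = sets (PiM J (\<lambda>_. lborel))"
    by (rule sets_PiM_cong) auto
  have "(\<integral>\<^sup>+x. F x \<partial>PiM J (\<lambda>_. cgauss t)) =
    (\<integral>\<^sup>+x. (\<Prod>i\<in>J. ennreal (cgauss_density t (x i))) * F (\<lambda>i\<in>J. x i) \<partial>PiM J (\<lambda>_. lborel))"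
    by (rule nn_integral_PiM_transform[OF sigma_finite_lborel sigma_finite_measure_axioms J,
      where h = "\<lambda>i x. x" and k = "\<lambda>i x. ennreal (cgauss_density t x)"])
      (use F in \<open>auto simp: measurable_cong_sets[OF s refl] cgauss_def nn_integral_density\<close>)
  also have "\<dots> = (\<integral>\<^sup>+x. ennreal (\<Prod>i\<in>J. cgauss_density t (x i)) * F x \<partial>PiM J (\<lambda>_. lborel))"
  proof (rule nn_integral_cong)
    fix x :: "'i \<Rightarrow> complex" assume "x \<in> space (PiM J (\<lambda>_. lborel))"
    then have "(\<lambda>i\<in>J. x i) = x" by (auto simp: space_PiM PiE_iff extensional_restrict)
    then show "(\<Prod>i\<in>J. ennreal (cgauss_density t (x i))) * F (\<lambda>i\<in>J. x i) =
        ennreal (\<Prod>i\<in>J. cgauss_density t (x i)) * F x"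
      using t by (simp add: prod_ennreal cgauss_density_def)
  qed
  finally show ?thesis .
qed

text \<open>No Jacobian determinant enters. A second Gaussian integral of mass 1 is inserted, and
  translations and a reflection of Lebesgue measure move the linear map onto that factor. There it
  disappears, because the Gaussian density depends on the norm only. Orthonormal columns preserve
  the norm; orthonormal rows make the adjoint a right inverse.\<close>

lemma nn_integral_PiM_cgauss_unitary:
  fixes F :: "('i \<Rightarrow> complex) \<Rightarrow> ennreal"
  assumes t: "0 < t" and J: "finite J"
    and F[measurable]: "F \<in> borel_measurable (PiM J (\<lambda>_. lborel))"
    and T1: "\<And>i k. i \<in> J \<Longrightarrow> k \<in> J \<Longrightarrow> (\<Sum>j\<in>J. T i j * cnj (T k j)) = of_bool (i = k)"
    and T2: "\<And>i k. i \<in> J \<Longrightarrow> k \<in> J \<Longrightarrow> (\<Sum>j\<in>J. cnj (T j i) * T j k) = of_bool (i = k)"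
  shows "(\<integral>\<^sup>+x. F (\<lambda>i\<in>J. \<Sum>j\<in>J. T i j * x j) \<partial>PiM J (\<lambda>_. cgauss t)) = (\<integral>\<^sup>+x. F x \<partial>PiM J (\<lambda>_. cgauss t))"
proof -
  define L :: "('i \<Rightarrow> complex) measure" where "L = PiM J (\<lambda>_. lborel)"
  define G :: "('i \<Rightarrow> complex) \<Rightarrow> ennreal" where "G x = ennreal (\<Prod>i\<in>J. cgauss_density t (x i))" for x
  define S where "S x = (\<lambda>i\<in>J. \<Sum>j\<in>J. T i j * x j)" for x
  define S' where "S' x = (\<lambda>i\<in>J. \<Sum>j\<in>J. cnj (T j i) * x j)" for x
  interpret product_sigma_finite "\<lambda>_. lborel :: complex measure" by standard
  interpret L: sigma_finite_measure L unfolding L_def by (rule sigma_finite[OF J])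
  interpret LL: pair_sigma_finite L L by standard
  have F'[measurable]: "F \<in> borel_measurable L" by (simp add: L_def)
  have cm[measurable]: "(\<lambda>x. x i) \<in> borel_measurable L" if "i \<in> J" for i
    unfolding L_def using that by measurable
  have G[measurable]: "G \<in> borel_measurable L"
    unfolding G_def by measurable
  have S[measurable]: "S \<in> L \<rightarrow>\<^sub>M L"
    unfolding S_def by (subst (2) L_def) (intro measurable_restrict, measurable)
  have Gn: "G x = ennreal (exp (- (\<Sum>i\<in>J. (cmod (x i))\<^sup>2) / t) / (pi * t) ^ card J)" for x
    by (simp add: G_def cgauss_density_def prod_dividef exp_sum[OF J, symmetric] sum_negf
        sum_divide_distrib)
  have GS: "G (S x) = G x" for x
  proof -
    have "complex_of_real (\<Sum>i\<in>J. (cmod (S x i))\<^sup>2) = (\<Sum>i\<in>J. S x i * cnj (S x i))"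
      by (simp add: complex_norm_square[symmetric])
    also have "\<dots> = (\<Sum>i\<in>J. \<Sum>j\<in>J. \<Sum>k\<in>J. (x j * cnj (x k)) * (cnj (T i k) * T i j))"
      by (simp add: S_def sum_product cnj_sum mult_ac)
    also have "\<dots> = (\<Sum>j\<in>J. \<Sum>k\<in>J. \<Sum>i\<in>J. (x j * cnj (x k)) * (cnj (T i k) * T i j))"
      by (rule trans[OF sum.swap], rule sum.cong[OF refl], rule sum.swap)
    also have "\<dots> = (\<Sum>j\<in>J. \<Sum>k\<in>J. (x j * cnj (x k)) * of_bool (k = j))"
      by (intro sum.cong refl, subst sum_distrib_left[symmetric], subst T2) auto
    also have "\<dots> = complex_of_real (\<Sum>i\<in>J. (cmod (x i))\<^sup>2)"
      using J by (simp add: complex_norm_square[symmetric] of_bool_def if_distrib cong: if_cong)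
    finally have "(\<Sum>i\<in>J. (cmod (S x i))\<^sup>2) = (\<Sum>i\<in>J. (cmod (x i))\<^sup>2)"
      using of_real_eq_iff by blast
    then show ?thesis by (simp add: Gn)
  qed
  \<comment> \<open>The adjoint \<open>S'\<close> is a right inverse of \<open>S\<close>, so
    shifting \<open>x\<close> by \<open>- S' y\<close> shifts \<open>S x\<close> by
    \<open>- y\<close>.\<close>
  have SS: "S (\<lambda>i\<in>J. x i + - S' y i) = (\<lambda>i\<in>J. S x i - y i)" for x y
  proof (rule ext)
    fix i show "S (\<lambda>i\<in>J. x i + - S' y i) i = (\<lambda>i\<in>J. S x i - y i) i"
    proof (cases "i \<in> J")
      case True
      have "(\<Sum>j\<in>J. T i j * S' y j) = (\<Sum>j\<in>J. \<Sum>k\<in>J. y k * (T i j * cnj (T k j)))"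
        by (simp add: S'_def sum_distrib_left mult_ac)
      also have "\<dots> = (\<Sum>k\<in>J. y k * (\<Sum>j\<in>J. T i j * cnj (T k j)))"
        by (subst sum.swap) (simp add: sum_distrib_left)
      also have "\<dots> = y i"
        using J True by (subst sum.cong[OF refl, of _ _ "\<lambda>k. y k * of_bool (i = k)"]) (auto simp: T1 of_bool_def if_distrib cong: if_cong)
      finally show ?thesis
        using True by (simp add: S_def algebra_simps sum_subtractf)
    qed (simp add: S_def)
  qed
  have sp: "S y \<in> extensional J" for y by (simp add: S_def)
  define \<psi> where "\<psi> x = G x * F x" for x
  have \<psi>[measurable]: "\<psi> \<in> borel_measurable L" unfolding \<psi>_def by measurable
  have add[measurable]: "(\<lambda>z. \<lambda>i\<in>J. f z i + g z i) \<in> K \<rightarrow>\<^sub>M L"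
    if "f \<in> K \<rightarrow>\<^sub>M L" "g \<in> K \<rightarrow>\<^sub>M L" for f g and K :: "'z measure"
    unfolding L_def
    by (intro measurable_restrict, simp, intro borel_measurable_add;
        rule measurable_compose[OF that(1) cm] measurable_compose[OF that(2) cm])
  have diff[measurable]: "(\<lambda>z. \<lambda>i\<in>J. f z i - g z i) \<in> K \<rightarrow>\<^sub>M L"
    if "f \<in> K \<rightarrow>\<^sub>M L" "g \<in> K \<rightarrow>\<^sub>M L" for f g and K :: "'z measure"
    unfolding L_def
    by (intro measurable_restrict, simp, intro borel_measurable_diff;
        rule measurable_compose[OF that(1) cm] measurable_compose[OF that(2) cm])
  interpret c: prob_space "cgauss t" by (rule prob_space_cgauss[OF t])
  interpret cP: product_prob_space "\<lambda>_. cgauss t" by standard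
  interpret P: prob_space "PiM J (\<lambda>_. cgauss t)"
    by (rule prob_space_PiM) (rule prob_space_cgauss[OF t])
  have trans: "(\<integral>\<^sup>+x. H (\<lambda>i\<in>J. x i + a i) \<partial>L) = (\<integral>\<^sup>+x. H x \<partial>L)"
    and refl: "(\<integral>\<^sup>+x. H (\<lambda>i\<in>J. a i - x i) \<partial>L) = (\<integral>\<^sup>+x. H x \<partial>L)"
    if "H \<in> borel_measurable L" for H a
    using that nn_integral_PiM_translate[OF J, of H a] nn_integral_PiM_reflect[OF J, of H a]
    by (simp_all add: L_def)
  have G1: "(\<integral>\<^sup>+x. G x \<partial>L) = 1"
    using nn_integral_PiM_cgauss[OF t J, of "\<lambda>_. 1"] P.emeasure_space_1 by (simp add: G_def L_def)
  have spL: "space L = extensional J" by (auto simp: L_def space_PiM PiE_def)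
  \<comment> \<open>With \<open>G\<close> of mass 1: shift \<open>y\<close> by \<open>S x\<close>,
    then \<open>x\<close> by \<open>- S' y\<close>, then reflect \<open>y\<close> at
    \<open>S x\<close>. This turns \<open>\<psi> (S x) * G y\<close> into
    \<open>\<psi> y * G (S x)\<close>, and \<open>G (S x) = G x\<close>.\<close>
  have "(\<integral>\<^sup>+x. \<psi> (S x) \<partial>L) = (\<integral>\<^sup>+x. (\<integral>\<^sup>+y. \<psi> (S x) * G y \<partial>L) \<partial>L)"
    by (simp add: nn_integral_cmult G1)
  also have "\<dots> = (\<integral>\<^sup>+x. (\<integral>\<^sup>+y. \<psi> (S x) * G (\<lambda>i\<in>J. y i + S x i) \<partial>L) \<partial>L)"
    by (subst trans[of "\<lambda>y. \<psi> _ * G y"]) (auto simp: S_def)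
  also have "\<dots> = (\<integral>\<^sup>+y. (\<integral>\<^sup>+x. \<psi> (S x) * G (\<lambda>i\<in>J. y i + S x i) \<partial>L) \<partial>L)"
    by (rule LL.Fubini') measurable
  also have "\<dots> = (\<integral>\<^sup>+y. (\<integral>\<^sup>+x. \<psi> (\<lambda>i\<in>J. S x i - y i) * G (S x) \<partial>L) \<partial>L)"
  proof (rule nn_integral_cong)
    fix y assume y[measurable]: "y \<in> space L"
    have "(\<integral>\<^sup>+x. \<psi> (S x) * G (\<lambda>i\<in>J. y i + S x i) \<partial>L) =
        (\<integral>\<^sup>+x. (\<lambda>x. \<psi> (S x) * G (\<lambda>i\<in>J. y i + S x i)) (\<lambda>i\<in>J. x i + - S' y i) \<partial>L)"
      by (rule trans[symmetric]) measurable
    also have "\<dots> = (\<integral>\<^sup>+x. \<psi> (\<lambda>i\<in>J. S x i - y i) * G (S x) \<partial>L)"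
    proof -
      have "(\<lambda>i\<in>J. y i + (\<lambda>i\<in>J. S x i - y i) i) = S x" for x
        by (auto simp: fun_eq_iff S_def restrict_def)
      then show ?thesis by (simp only: SS)
    qed
    finally show "(\<integral>\<^sup>+x. \<psi> (S x) * G (\<lambda>i\<in>J. y i + S x i) \<partial>L) =
       (\<integral>\<^sup>+x. \<psi> (\<lambda>i\<in>J. S x i - y i) * G (S x) \<partial>L)" .
  qed
  also have "\<dots> = (\<integral>\<^sup>+x. (\<integral>\<^sup>+y. \<psi> (\<lambda>i\<in>J. S x i - y i) * G (S x) \<partial>L) \<partial>L)"
    by (rule LL.Fubini') measurable
  also have "\<dots> = (\<integral>\<^sup>+x. (\<integral>\<^sup>+y. \<psi> y * G x \<partial>L) \<partial>L)"
    by (subst refl[of "\<lambda>y. \<psi> y * G (S _)"]) (auto simp: GS)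
  also have "\<dots> = (\<integral>\<^sup>+x. \<psi> x \<partial>L)"
    by (simp add: nn_integral_multc nn_integral_cmult G1)
  finally have main: "(\<integral>\<^sup>+x. \<psi> (S x) \<partial>L) = (\<integral>\<^sup>+x. \<psi> x \<partial>L)" .
  have "(\<integral>\<^sup>+x. F (S x) \<partial>PiM J (\<lambda>_. cgauss t)) = (\<integral>\<^sup>+x. \<psi> (S x) \<partial>L)"
    using measurable_comp[OF S F']
    by (subst nn_integral_PiM_cgauss[OF t J]) (auto simp: \<psi>_def GS comp_def L_def G_def[symmetric])
  also have "\<dots> = (\<integral>\<^sup>+x. F x \<partial>PiM J (\<lambda>_. cgauss t))"
    unfolding main by (subst nn_integral_PiM_cgauss[OF t J]) (auto simp: \<psi>_def[abs_def] L_def G_def[symmetric])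
  finally show ?thesis by (simp add: S_def)
qed

text \<open>The measure \<open>E\<close> is the law of one squared modulus. The transformation of
  products is applied to it twice, once as an image of \<open>cgauss t\<close> and once as an
  exponential density with mean \<open>t\<close>.\<close>

lemma nn_integral_PiM_cgauss_cmod_square:
  fixes F :: "('i \<Rightarrow> real) \<Rightarrow> ennreal"
  assumes t: "0 < t" and J: "finite J" and F: "F \<in> borel_measurable (PiM J (\<lambda>_. lborel))"
  shows "(\<integral>\<^sup>+x. F (\<lambda>i\<in>J. (cmod (x i))\<^sup>2) \<partial>PiM J (\<lambda>_. cgauss t)) =
    (\<integral>\<^sup>+u. (\<Prod>i\<in>J. ennreal (exp (- u i / t) / t) * indicator {0<..} (u i)) * F u \<partial>PiM J (\<lambda>_. lborel))"
proof -
  interpret prob_space "cgauss t" by (rule prob_space_cgauss[OF t])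
  define E :: "real measure" where "E = distr (cgauss t) borel (\<lambda>z. (cmod z)\<^sup>2)"
  have pE: "prob_space E" unfolding E_def by (rule prob_space_distr) measurable
  have sE: "sigma_finite_measure E"
    by (rule prob_space_imp_sigma_finite[OF pE])
  have [simp]: "sets E = sets borel" by (simp add: E_def)
  have s: "sets (PiM J (\<lambda>_. E)) = sets (PiM J (\<lambda>_. lborel))"
    by (rule sets_PiM_cong) auto
  have F': "F \<in> borel_measurable (PiM J (\<lambda>_. E))"
    using F by (simp add: measurable_cong_sets[OF s refl])
  have "(\<integral>\<^sup>+x. F x \<partial>PiM J (\<lambda>_. E)) =
    (\<integral>\<^sup>+x. (\<Prod>i\<in>J. (\<lambda>_. 1) (x i)) * F (\<lambda>i\<in>J. (cmod (x i))\<^sup>2) \<partial>PiM J (\<lambda>_. cgauss t))"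
    by (rule nn_integral_PiM_transform[OF sigma_finite_measure_axioms sE J,
      where h = "\<lambda>i z. (cmod z)\<^sup>2" and k = "\<lambda>_ _. 1"])
      (use F' in \<open>auto simp: E_def nn_integral_distr\<close>)
  moreover have "(\<integral>\<^sup>+x. F x \<partial>PiM J (\<lambda>_. E)) =
    (\<integral>\<^sup>+u. (\<Prod>i\<in>J. ennreal (exp (- u i / t) / t) * indicator {0<..} (u i)) * F (\<lambda>i\<in>J. u i) \<partial>PiM J (\<lambda>_. lborel))"
    by (rule nn_integral_PiM_transform[OF sigma_finite_lborel sE J,
      where h = "\<lambda>i u. u" and k = "\<lambda>_ u. ennreal (exp (- u / t) / t) * indicator {0<..} u"])
      (use F' t in \<open>auto simp: E_def nn_integral_distr nn_integral_cgauss_cmod_square\<close>)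
  moreover have "\<dots> = (\<integral>\<^sup>+u. (\<Prod>i\<in>J. ennreal (exp (- u i / t) / t) * indicator {0<..} (u i)) * F u \<partial>PiM J (\<lambda>_. lborel))"
    by (rule nn_integral_cong) (auto simp: space_PiM PiE_iff extensional_restrict)
  ultimately show ?thesis by simp
qed

section \<open>Residue weights and interlacing\<close>

text \<open>The numerators in the partial fraction expansion of the product of all
  \<open>(y j - z) / (x j - z)\<close> as a function of \<open>z\<close>, with denominators
  \<open>x i - z\<close>.\<close>

definition residue_weight :: "'i set \<Rightarrow> ('i \<Rightarrow> 'a::field) \<Rightarrow> ('i \<Rightarrow> 'a) \<Rightarrow> 'i \<Rightarrow> 'a" where
  "residue_weight J x y i = (y i - x i) * (\<Prod>j\<in>J - {i}. (y j - x i) / (x j - x i))"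

lemma residue_weight_insert:
  assumes "finite J" "a \<notin> J" "i \<in> J"
  shows "residue_weight (insert a J) x y i = residue_weight J x y i * ((y a - x i) / (x a - x i))"
proof -
  have "insert a J - {i} = insert a (J - {i})" using assms by auto
  then show ?thesis using assms by (simp add: residue_weight_def)
qed

lemma residue_weight_new:
  assumes "finite J" "a \<notin> J"
  shows "residue_weight (insert a J) x y a = (y a - x a) * (\<Prod>j\<in>J. (y j - x a) / (x j - x a))"
proof -
  have "insert a J - {a} = J" using assms by auto
  then show ?thesis by (simp add: residue_weight_def)
qed

lemma residue_weight_cong:
  "(\<And>j. j \<in> J \<Longrightarrow> y j = y' j) \<Longrightarrow> i \<in> J \<Longrightarrow> residue_weight J x y i = residue_weight J x y' i"
  unfolding residue_weight_def by (auto intro!: arg_cong2[where f=times] prod.cong)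

text \<open>Induction on \<open>J\<close>: a new index \<open>a\<close> multiplies each old weight
  by \<open>(y a - x i) / (x a - x i)\<close>. Splitting this factor over \<open>x i - z\<close>
  into partial fractions expresses the new sum by the old identity at two points, \<open>z\<close>
  and \<open>x a\<close>; this is why the induction runs over all \<open>z\<close>.\<close>

lemma residue_weight_partial_fractions:
  fixes x y :: "'i \<Rightarrow> 'a::field"
  assumes "finite J" "inj_on x J" "z \<notin> x ` J"
  shows "1 + (\<Sum>i\<in>J. residue_weight J x y i / (x i - z)) = (\<Prod>j\<in>J. (y j - z) / (x j - z))"
  using assms
proof (induction J arbitrary: z rule: finite_induct)
  case (insert a J)
  define A where "A = (y a - z) / (x a - z)"
  define C where "C = (y a - x a) / (x a - z)"
  define p where "p w = (\<Prod>j\<in>J. (y j - w) / (x j - w))" for w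
  have az: "x a \<noteq> z" and aJ: "x a \<notin> x ` J" using insert by auto
  have IH: "(\<Sum>i\<in>J. residue_weight J x y i / (x i - w)) = p w - 1" if "w \<notin> x ` J" for w
    using insert.IH[of w] insert.prems that by (simp add: p_def algebra_simps)
  have *: "residue_weight (insert a J) x y i / (x i - z) =
      A * (residue_weight J x y i / (x i - z)) - C * (residue_weight J x y i / (x i - x a))" if i: "i \<in> J" for i
  proof -
    have "x i \<noteq> x a" "x i \<noteq> z" using insert i by (auto simp: inj_on_def)
    then have nz: "x a - x i \<noteq> 0" "x i - z \<noteq> 0" "x i - x a \<noteq> 0" "x a - z \<noteq> 0"
      using az by auto
    have "(y a - x i) / (x a - x i) / (x i - z) =
        ((y a - x i) * (x a - z)) / ((x a - x i) * (x i - z) * (x a - z))"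
      using nz by simp
    also have "(y a - x i) * (x a - z) = (y a - z) * (x a - x i) + (y a - x a) * (x i - z)"
      by (simp add: algebra_simps)
    also have "\<dots> / ((x a - x i) * (x i - z) * (x a - z)) = A / (x i - z) + C / (x a - x i)"
      using nz by (simp add: A_def C_def add_divide_distrib mult.commute)
    also have "C / (x a - x i) = - (C / (x i - x a))"
      by (metis minus_diff_eq minus_divide_right)
    finally have "residue_weight J x y i * ((y a - x i) / (x a - x i) / (x i - z)) =
        residue_weight J x y i * (A / (x i - z) + - (C / (x i - x a)))" by simp
    then show ?thesis
      unfolding residue_weight_insert[OF insert.hyps i]
      by (simp add: algebra_simps)
  qed
  have "(\<Sum>i\<in>J. residue_weight (insert a J) x y i / (x i - z)) = A * (p z - 1) - C * (p (x a) - 1)"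
    using IH[of z] IH[OF aJ] insert.prems
    by (simp add: * sum_subtractf sum_distrib_left[symmetric] del: times_divide_eq_right)
  moreover have "residue_weight (insert a J) x y a / (x a - z) = C * p (x a)"
    unfolding residue_weight_new[OF insert.hyps] C_def p_def by simp
  moreover have "1 - A + C = 0"
  proof -
    have "(y a - z) / (x a - z) - (y a - x a) / (x a - z) = (x a - z) / (x a - z)"
      by (simp add: diff_divide_distrib[symmetric])
    then show ?thesis using az unfolding A_def C_def by (simp add: algebra_simps)
  qed
  moreover have "1 + (C * p (x a) + (A * (p z - 1) - C * (p (x a) - 1))) = A * p z + (1 - A + C)"
    by (simp add: algebra_simps)
  ultimately have "1 + (\<Sum>i\<in>insert a J. residue_weight (insert a J) x y i / (x i - z)) = A * p z"
    using insert.hyps by simp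
  then show ?case using insert.hyps by (simp add: A_def p_def)
qed simp

section \<open>Substituting a root of the secular equation for a weight\<close>

lemma nn_integral_substitution_incseq:
  fixes f :: "real \<Rightarrow> ennreal" and g g' :: "real \<Rightarrow> real"
  assumes f[measurable]: "f \<in> borel_measurable borel" and [measurable]: "g \<in> borel_measurable borel" "g' \<in> borel_measurable borel"
    and AB: "\<And>n. A n < B n" and inc: "incseq (\<lambda>n. {A n..B n::real})"
    and deriv: "\<And>n x. x \<in> {A n..B n} \<Longrightarrow> (g has_real_derivative g' x) (at x)"
    and cont: "\<And>n. continuous_on {A n..B n} g'"
    and nonneg: "\<And>n x. x \<in> {A n..B n} \<Longrightarrow> 0 \<le> g' x"
  shows "(\<integral>\<^sup>+u. f u * indicator (\<Union>n. {g (A n)..g (B n)}) u \<partial>lborel) =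
    (\<integral>\<^sup>+x. f (g x) * ennreal (g' x) * indicator (\<Union>n. {A n..B n}) x \<partial>lborel)"
proof -
  have mono: "g x \<le> g y" if "x \<in> {A n..B n}" "y \<in> {A n..B n}" "x \<le> y" for n x y
  proof (rule DERIV_nonneg_imp_nondecreasing[OF that(3)])
    fix z assume "x \<le> z" "z \<le> y"
    then have "z \<in> {A n..B n}" using that by auto
    then show "\<exists>D. DERIV g z :> D \<and> 0 \<le> D" using deriv nonneg by blast
  qed
  have inc': "incseq (\<lambda>n. {g (A n)..g (B n)})"
  proof (rule incseq_SucI)
    fix n
    have "{A n..B n} \<subseteq> {A (Suc n)..B (Suc n)}" using inc by (rule incseq_SucD)
    then have "A (Suc n) \<le> A n" "B n \<le> B (Suc n)" using AB[of n] by auto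
    then have "g (A (Suc n)) \<le> g (A n)" "g (B n) \<le> g (B (Suc n))"
      using AB[of n] by (intro mono[of _ "Suc n"]; simp)+
    then show "{g (A n)..g (B n)} \<subseteq> {g (A (Suc n))..g (B (Suc n))}" by auto
  qed
  \<comment> \<open>Substitution is carried out on each compact interval \<open>{A n..B n}\<close>;
    monotone convergence extends it to the unions, which may be open or unbounded.\<close>
  have sup: "(\<integral>\<^sup>+u. h u * indicator (\<Union>n. C n) u \<partial>lborel) = (SUP n. \<integral>\<^sup>+u. h u * indicator (C n) u \<partial>lborel)"
    if C: "incseq C" and [measurable]: "\<And>n. C n \<in> sets borel" "h \<in> borel_measurable borel"
    for C :: "nat \<Rightarrow> real set" and h :: "real \<Rightarrow> ennreal"
  proof -
    have "(\<integral>\<^sup>+u. h u * indicator (\<Union>n. C n) u \<partial>lborel) = (\<integral>\<^sup>+u. (SUP n. h u * indicator (C n) u) \<partial>lborel)"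
    proof (rule nn_integral_cong)
      fix u
      show "h u * indicator (\<Union>n. C n) u = (SUP n. h u * indicator (C n) u)"
      proof (cases "u \<in> (\<Union>n. C n)")
        case True
        then obtain n where "u \<in> C n" by auto
        then have "(SUP n. h u * indicator (C n) u) = h u"
          by (intro antisym SUP_least SUP_upper2[of n]; simp add: indicator_def)
        then show ?thesis using True by simp
      qed simp
    qed
    also have "\<dots> = (SUP n. \<integral>\<^sup>+u. h u * indicator (C n) u \<partial>lborel)"
    proof (rule nn_integral_monotone_convergence_SUP)
      have "h u * indicator (C n) u \<le> h u * indicator (C (Suc n)) u" for n u
        using incseq_SucD[OF C, of n] by (intro mult_left_mono) (auto simp: indicator_def)
      then show "incseq (\<lambda>n u. h u * indicator (C n) u)"
        by (intro incseq_SucI le_funI)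
    qed measurable
    finally show ?thesis .
  qed
  have eq: "(\<integral>\<^sup>+u. f u * indicator {g (A n)..g (B n)} u \<partial>lborel) =
    (\<integral>\<^sup>+x. f (g x) * ennreal (g' x) * indicator {A n..B n} x \<partial>lborel)" for n
    using deriv[of _ n] cont[of n] nonneg[of _ n] AB[of n] f
    by (intro nn_integral_substitution_aux) auto
  have m: "(\<lambda>x. f (g x) * ennreal (g' x)) \<in> borel_measurable borel" by measurable
  show ?thesis
    unfolding sup[OF inc' borel_closed[OF closed_atLeastAtMost] f] sup[OF inc borel_closed[OF closed_atLeastAtMost] m] eq ..
qed

text \<open>The weight \<open>v\<close> at the pole \<open>a\<close> for which \<open>y\<close>
  solves the secular equation
  \<open>1 + v / (a - y) + (\<Sum>i\<in>K. u i / (x i - y)) = 0\<close>.\<close>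

definition secular :: "'i set \<Rightarrow> ('i \<Rightarrow> real) \<Rightarrow> real \<Rightarrow> ('i \<Rightarrow> real) \<Rightarrow> real \<Rightarrow> real" where
  "secular K x a u y = (y - a) * (1 + (\<Sum>i\<in>K. u i / (x i - y)))"

text \<open>The derivative of \<open>secular\<close> in \<open>y\<close>, written so that its sign
  is visible: all terms are nonnegative when the weights are and the poles \<open>x i\<close> lie
  above \<open>a\<close>.\<close>

definition secular' :: "'i set \<Rightarrow> ('i \<Rightarrow> real) \<Rightarrow> real \<Rightarrow> ('i \<Rightarrow> real) \<Rightarrow> real \<Rightarrow> real" where
  "secular' K x a u y = 1 + (\<Sum>i\<in>K. u i * (x i - a) / (x i - y)\<^sup>2)"

lemma secular_deriv:
  assumes "finite K" "y \<notin> x ` K"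
  shows "(secular K x a u has_real_derivative secular' K x a u y) (at y)"
proof -
  have 1: "((\<lambda>y. \<Sum>i\<in>K. u i / (x i - y)) has_real_derivative (\<Sum>i\<in>K. u i / (x i - y)\<^sup>2)) (at y)"
  proof (rule DERIV_sum)
    fix i assume "i \<in> K"
    then have "x i - y \<noteq> 0" using assms by auto
    then show "((\<lambda>y. u i / (x i - y)) has_real_derivative u i / (x i - y)\<^sup>2) (at y)"
      by (auto intro!: derivative_eq_intros simp: power2_eq_square)
  qed
  have "(secular K x a u has_real_derivative
     1 * (1 + (\<Sum>i\<in>K. u i / (x i - y))) + (\<Sum>i\<in>K. u i / (x i - y)\<^sup>2) * (y - a)) (at y)"
  proof -
    have 2: "((\<lambda>y. 1 + (\<Sum>i\<in>K. u i / (x i - y))) has_real_derivative 0 + (\<Sum>i\<in>K. u i / (x i - y)\<^sup>2)) (at y)"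
      by (rule DERIV_add[OF DERIV_const 1])
    have 3: "((\<lambda>y. y - a) has_real_derivative 1) (at y)"
      by (auto intro!: derivative_eq_intros)
    show ?thesis
      using DERIV_mult[OF 3 2] by (simp add: secular_def[abs_def])
  qed
  moreover have "1 * (1 + (\<Sum>i\<in>K. u i / (x i - y))) + (\<Sum>i\<in>K. u i / (x i - y)\<^sup>2) * (y - a) = secular' K x a u y"
  proof -
    have "u i * (x i - a) / (x i - y)\<^sup>2 = u i / (x i - y) + u i / (x i - y)\<^sup>2 * (y - a)" if "i \<in> K" for i
    proof -
      have "x i - y \<noteq> 0" using assms that by auto
      moreover have "x i - a = (x i - y) + (y - a)" by simp
      ultimately show ?thesis
        by (simp only: distrib_left add_divide_distrib power2_eq_square) simp
    qed
    then show ?thesis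
      by (simp add: secular'_def sum.distrib sum_distrib_right)
  qed
  ultimately show ?thesis by simp
qed

text \<open>Between \<open>a\<close> and the lowest pole \<open>b\<close>, \<open>secular\<close>
  increases from 0 to infinity: it vanishes at \<open>a\<close>, and the term of \<open>i0\<close>
  blows up at \<open>b\<close>. So it exchanges that interval for the positive half line.\<close>

lemma nn_integral_secular:
  fixes f :: "real \<Rightarrow> ennreal"
  assumes f[measurable]: "f \<in> borel_measurable borel" and K: "finite K" and b: "i0 \<in> K" "b = x i0"
    and xb: "\<And>i. i \<in> K \<Longrightarrow> b \<le> x i" and ab: "a < b" and u: "\<And>i. i \<in> K \<Longrightarrow> 0 < u i"
  shows "(\<integral>\<^sup>+v. indicator {0<..} v * f v \<partial>lborel) =
    (\<integral>\<^sup>+y. indicator {a<..<b} y * (ennreal (secular' K x a u y) * f (secular K x a u y)) \<partial>lborel)"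
proof -
  let ?g = "secular K x a u" and ?g' = "secular' K x a u"
  define d where "d = b - a"
  have d: "0 < d" using ab by (simp add: d_def)
  \<comment> \<open>The summand 3 makes both margins at most \<open>d / 3\<close>, so the compact
    intervals are nondegenerate from \<open>n = 0\<close> on.\<close>
  define A where "A n = a + d / (real n + 3)" for n
  define B where "B n = b - d / (real n + 3)" for n
  have small: "d / (real n + 3) \<le> d / 3" "0 < d / (real n + 3)" for n
    using d by (intro divide_left_mono; simp) (rule divide_pos_pos[OF d], simp)
  have AB: "A n < B n" "a < A n" "B n < b" for n
  proof -
    have "b = a + d" by (simp add: d_def)
    with small[of n] d show "A n < B n" "a < A n" "B n < b" unfolding A_def B_def by linarith+
  qed
  have mono: "d / (real n + 3) \<le> d / (real m + 3)" if "m \<le> n" for m n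
    using d that by (intro divide_left_mono) auto
  have inc: "incseq (\<lambda>n. {A n..B n})"
  proof (rule incseq_SucI)
    fix n show "{A n..B n} \<subseteq> {A (Suc n)..B (Suc n)}"
      using mono[of n "Suc n"] by (auto simp: A_def B_def)
  qed
  have notin: "y \<notin> x ` K" if "y < b" for y using xb that by force
  have lim0: "(\<lambda>n. d / (real n + 3)) \<longlonglongrightarrow> 0"
  proof -
    have "filterlim (\<lambda>n. 3 + real n) at_top sequentially"
      by (rule filterlim_tendsto_add_at_top[OF tendsto_const filterlim_real_sequentially])
    then have "(\<lambda>n. d / (3 + real n)) \<longlonglongrightarrow> 0"
      by (rule real_tendsto_divide_at_top[OF tendsto_const])
    then show ?thesis by (simp only: add.commute[of 3])
  qed
  have un1: "(\<Union>n. {A n..B n}) = {a<..<b}"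
  proof (intro equalityI subsetI)
    fix y assume "y \<in> {a<..<b}"
    then have "0 < min (y - a) (b - y)" by auto
    with lim0 have "eventually (\<lambda>n. d / (real n + 3) < min (y - a) (b - y)) sequentially"
      by (rule order_tendstoD)
    then obtain n where "d / (real n + 3) < min (y - a) (b - y)" by (auto simp: eventually_sequentially)
    then have "y \<in> {A n..B n}" by (auto simp: A_def B_def)
    then show "y \<in> (\<Union>n. {A n..B n})" by auto
  next
    fix y assume "y \<in> (\<Union>n. {A n..B n})"
    then obtain n where "y \<in> {A n..B n}" by auto
    then show "y \<in> {a<..<b}" using AB(2,3)[of n] by auto
  qed
  have xi: "0 \<le> x i - y" "0 < x i - y" if "i \<in> K" "y < b" for i y
    using xb[OF that(1)] that(2) by auto
  have u0: "0 \<le> u i" if "i \<in> K" for i using u[OF that] by simp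
  have gpos: "0 < ?g y" if "a < y" "y < b" for y
    unfolding secular_def
    by (intro mult_pos_pos add_pos_nonneg sum_nonneg divide_nonneg_nonneg u0 xi) (use that in auto)
  have limA: "(\<lambda>n. ?g (A n)) \<longlonglongrightarrow> 0"
  proof -
    have "isCont ?g a"
      using DERIV_isCont[OF secular_deriv[OF K notin[OF ab]]] .
    moreover have "A \<longlonglongrightarrow> a"
      using tendsto_add[OF tendsto_const lim0, of a] by (simp add: A_def[abs_def])
    ultimately have "(\<lambda>n. ?g (A n)) \<longlonglongrightarrow> ?g a"
      by (rule isCont_tendsto_compose)
    then show ?thesis by (simp add: secular_def)
  qed
  \<comment> \<open>At \<open>B n\<close> the distance to \<open>a\<close> is \<open>n + 2\<close>
    times the distance to the pole \<open>b\<close>, so the \<open>i0\<close> term alone contributes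
    \<open>u i0 * (n + 2)\<close>.\<close>
  have limB: "u i0 * (real n + 2) \<le> ?g (B n)" for n
  proof -
    have "u i0 * (real n + 2) = (B n - a) * (u i0 / (x i0 - B n))"
    proof -
      define q where "q = d / (real n + 3)"
      have "d = q * (real n + 3)" by (simp add: q_def)
      moreover have "B n - a = d - q" "x i0 - B n = q" using b by (simp_all add: B_def d_def q_def)
      ultimately have "B n - a = q * (real n + 2)" "x i0 - B n = q" by (simp_all add: algebra_simps)
      moreover have "q \<noteq> 0" using small(2)[of n] d by (simp add: q_def)
      ultimately show ?thesis by simp
    qed
    also have "\<dots> \<le> ?g (B n)"
      unfolding secular_def
    proof (rule mult_left_mono)
      have "u i0 / (x i0 - B n) \<le> (\<Sum>i\<in>K. u i / (x i - B n))"
        using K b(1) by (intro member_le_sum divide_nonneg_nonneg u0 xi AB) auto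
      then show "u i0 / (x i0 - B n) \<le> 1 + (\<Sum>i\<in>K. u i / (x i - B n))" by simp
    qed (use AB[of n] in auto)
    finally show ?thesis .
  qed
  have un2: "(\<Union>n. {?g (A n)..?g (B n)}) = {0<..}"
  proof (intro equalityI subsetI)
    fix v :: real assume v: "v \<in> {0<..}"
    with limA have "eventually (\<lambda>n. ?g (A n) < v) sequentially" by (intro order_tendstoD(2)) auto
    moreover have "eventually (\<lambda>n. v \<le> ?g (B n)) sequentially"
    proof -
      obtain n0 :: nat where n0: "v / u i0 \<le> n0" using real_arch_simple by blast
      have "v \<le> ?g (B n)" if "n0 \<le> n" for n
      proof -
        have "v \<le> u i0 * (real n + 2)"
        proof -
          have "v = u i0 * (v / u i0)" using u[OF b(1)] by simp
          also have "\<dots> \<le> u i0 * (real n + 2)"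
            using n0 u[OF b(1)] that by (intro mult_left_mono) auto
          finally show ?thesis .
        qed
        then show ?thesis using limB[of n] by simp
      qed
      then show ?thesis by (auto simp: eventually_sequentially)
    qed
    ultimately have "eventually (\<lambda>n. ?g (A n) < v \<and> v \<le> ?g (B n)) sequentially"
      by (rule eventually_conj)
    then obtain n where "?g (A n) < v \<and> v \<le> ?g (B n)" by (auto simp: eventually_sequentially)
    then show "v \<in> (\<Union>n. {?g (A n)..?g (B n)})" by (auto intro!: exI[of _ n])
  next
    fix v assume "v \<in> (\<Union>n. {?g (A n)..?g (B n)})"
    then obtain n where "?g (A n) \<le> v" by auto
    then show "v \<in> {0<..}" using gpos[of "A n"] AB[of n] by auto
  qed
  have "(\<integral>\<^sup>+v. f v * indicator (\<Union>n. {?g (A n)..?g (B n)}) v \<partial>lborel) =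
    (\<integral>\<^sup>+y. f (?g y) * ennreal (?g' y) * indicator (\<Union>n. {A n..B n}) y \<partial>lborel)"
  proof (rule nn_integral_substitution_incseq[OF f _ _ AB(1) inc])
    fix n y assume "y \<in> {A n..B n}"
    then have y: "y < b" "a < y" using AB[of n] by auto
    then show "(?g has_real_derivative ?g' y) (at y)" by (intro secular_deriv K notin)
    show "0 \<le> ?g' y" unfolding secular'_def
      by (intro add_nonneg_nonneg sum_nonneg divide_nonneg_nonneg mult_nonneg_nonneg u0 xi(1)[OF _ ab]) auto
  next
    fix n show "continuous_on {A n..B n} ?g'"
      unfolding secular'_def[abs_def]
    proof (intro continuous_intros ballI)
      fix i y assume "i \<in> K" "y \<in> {A n..B n}"
      then show "(x i - y)\<^sup>2 \<noteq> 0" using xi(2)[of i y] AB(3)[of n] by auto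
    qed
  qed (unfold secular_def[abs_def] secular'_def[abs_def], measurable)
  then show ?thesis unfolding un1 un2 by (simp add: mult_ac)
qed

text \<open>Strict, in contrast to \<open>interlace\<close>, and with a variable lower index
  \<open>m\<close>, because the change of variables removes the lowest root at each step. The top
  entry \<open>y N\<close> has no upper bound.\<close>

definition interlaced :: "nat \<Rightarrow> nat \<Rightarrow> (nat \<Rightarrow> real) \<Rightarrow> (nat \<Rightarrow> real) \<Rightarrow> bool" where
  "interlaced m N x y \<longleftrightarrow> (\<forall>i\<in>{m..N}. x i < y i \<and> (i < N \<longrightarrow> y i < x (Suc i)))"

definition vdm :: "nat \<Rightarrow> nat \<Rightarrow> (nat \<Rightarrow> real) \<Rightarrow> real" where
  "vdm m N x = (\<Prod>i\<in>{m..N}. \<Prod>j\<in>{i<..N}. x j - x i)"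

lemma interlaced_Suc:
  "m \<le> N \<Longrightarrow> interlaced m N x y \<longleftrightarrow> x m < y m \<and> (m < N \<longrightarrow> y m < x (Suc m)) \<and> interlaced (Suc m) N x y"
proof -
  assume "m \<le> N"
  then have "{m..N} = insert m {Suc m..N}" by auto
  then show ?thesis by (simp add: interlaced_def)
qed

lemma vdm_Suc:
  "m \<le> N \<Longrightarrow> vdm m N x = (\<Prod>j\<in>{Suc m..N}. x j - x m) * vdm (Suc m) N x"
proof -
  assume "m \<le> N"
  then have "{m..N} = insert m {Suc m..N}" "{m<..N} = {Suc m..N}" by auto
  then show ?thesis by (simp add: vdm_def)
qed

lemma vdm_pos:
  assumes "strict_mono_on {m..N} x" shows "0 < vdm m N x"
  unfolding vdm_def
proof (intro prod_pos)
  fix i j assume "i \<in> {m..N}" "j \<in> {i<..N}"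
  then have "x i < x j" by (intro strict_mono_onD[OF assms]) auto
  then show "0 < x j - x i" by simp
qed

lemma interlaced_strict_mono:
  assumes "interlaced m N x y"
  shows "strict_mono_on {m..N} y" "strict_mono_on {m..N} x"
proof -
  have *: "x i < y i" "y i < x (i + 1)" if "m \<le> i" "i < N" for i
    using assms that by (auto simp: interlaced_def)
  have **: "x i < y i" if "m \<le> i" "i \<le> N" for i
    using assms that by (auto simp: interlaced_def)
  have y: "y i < y (i + Suc k)" and x: "x i < x (i + Suc k)" if "m \<le> i" "i + Suc k \<le> N" for i k
    using that
  proof (induction k)
    case 0
    { case 1 then show ?case using *(2)[of i] **[of "Suc i"] by simp }
    { case 2 then show ?case using *[of i] by simp }
  next
    case (Suc k)
    { case 1 then show ?case using Suc *(2)[of "i + Suc k"] **[of "i + Suc (Suc k)"] by simp }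
    { case 2 then show ?case using Suc *[of "i + Suc k"] by simp }
  qed
  have "\<exists>k. j = i + Suc k" if "i < j" for i j :: nat using less_imp_Suc_add[OF that] by auto
  then show "strict_mono_on {m..N} y" "strict_mono_on {m..N} x"
    using x y by (fastforce intro!: strict_mono_onI)+
qed

text \<open>Interlacing keeps \<open>y j\<close> on the same side of \<open>x i\<close> as
  \<open>x j\<close> for every \<open>j \<noteq> i\<close>, so each quotient in the product is
  positive.\<close>

lemma residue_weight_interlaced_pos:
  assumes "interlaced m N x y" "i \<in> {m..N}"
  shows "0 < residue_weight {m..N} x y i"
  unfolding residue_weight_def
proof (intro mult_pos_pos prod_pos)
  show "0 < y i - x i" using assms by (auto simp: interlaced_def)
  fix j assume j: "j \<in> {m..N} - {i}"
  note sm = interlaced_strict_mono[OF assms(1)]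
  show "0 < (y j - x i) / (x j - x i)"
  proof (cases "i < j")
    case True
    then have "x i < x j" using assms j by (intro strict_mono_onD[OF sm(2)]) auto
    moreover have "x j < y j" using assms j by (auto simp: interlaced_def)
    ultimately show ?thesis by simp
  next
    case False
    then have "j < i" using j by auto
    then have "x j < x i" using assms j by (intro strict_mono_onD[OF sm(2)]) auto
    moreover have "y j < x i"
    proof -
      have "y j < x (Suc j)" using assms j \<open>j < i\<close> by (auto simp: interlaced_def)
      also have "x (Suc j) \<le> x i"
      proof (cases "Suc j = i")
        case False
        then have "x (Suc j) < x i" using assms j \<open>j < i\<close> by (intro strict_mono_onD[OF sm(2)]) auto
        then show ?thesis by simp
      qed simp
      finally show ?thesis .
    qed
    ultimately show ?thesis by (intro divide_neg_neg) auto
  qed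
qed

text \<open>The Cauchy determinant that is the Jacobian of \<open>y \<mapsto> residue_weight {m..N} x y\<close> is never
  computed: substituting for one variable at a time, the first root \<open>y m\<close> solves a secular equation
  in which the other weights are parameters, and after rescaling these weights the remaining
  roots solve the same problem for \<open>{Suc m..N}\<close>.\<close>

theorem nn_integral_residue_weight:
  fixes F :: "(nat \<Rightarrow> real) \<Rightarrow> ennreal"
  assumes x: "strict_mono_on {m..N} x" and m: "m \<le> Suc N"
    and F: "F \<in> borel_measurable (PiM {m..N} (\<lambda>_. lborel))"
  shows "(\<integral>\<^sup>+u. indicator {u. \<forall>i\<in>{m..N}. 0 < u i} u * F u \<partial>PiM {m..N} (\<lambda>_. lborel)) =
    (\<integral>\<^sup>+y. indicator {y. interlaced m N x y} y * (ennreal (vdm m N y / vdm m N x) *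
       F (\<lambda>i\<in>{m..N}. residue_weight {m..N} x y i)) \<partial>PiM {m..N} (\<lambda>_. lborel))"
  using m x F
proof (induction m arbitrary: F rule: inc_induct)
  case base
  interpret product_sigma_finite "\<lambda>_. lborel :: real measure" by standard
  have e: "{Suc N..N} = {}" by simp
  show ?case
    unfolding e by (subst nn_integral_empty; simp add: interlaced_def vdm_def restrict_def)+
next
  case (step m)
  interpret product_sigma_finite "\<lambda>_. lborel :: real measure" by standard
  define K where "K = {Suc m..N}"
  define L where "L = PiM K (\<lambda>_. lborel :: real measure)"
  have K: "finite K" "m \<notin> K" and J: "{m..N} = insert m K" and mN: "m \<le> N"
    using step.hyps by (auto simp: K_def)
  interpret L: sigma_finite_measure L unfolding L_def by (rule sigma_finite[OF K(1)])
  interpret LL: pair_sigma_finite "lborel :: real measure" L by standard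
  note x = step.prems(1)
  have xK: "strict_mono_on K x" using x by (rule monotone_on_subset) (auto simp: K_def)
  have xm: "x m < x i" if "i \<in> K" for i
    using that mN by (intro strict_mono_onD[OF x]) (auto simp: K_def)
  \<comment> \<open>The range of the lowest root: between \<open>x m\<close> and the next pole, or a
    half line when \<open>m = N\<close>.\<close>
  define I where "I = (if m < N then {x m<..<x (Suc m)} else {x m<..})"
  have Ib[measurable]: "I \<in> sets borel" by (simp add: I_def)
  have Ix: "y < x i" if "y \<in> I" "i \<in> K" for y i
  proof -
    have "m < N" using that by (auto simp: K_def)
    moreover have "x (Suc m) \<le> x i"
      by (rule strict_mono_on_leD[OF xK]) (use that in \<open>auto simp: K_def\<close>)
    ultimately show ?thesis using that by (auto simp: I_def)
  qed
  have Im: "x m < y" if "y \<in> I" for y using that by (auto simp: I_def split: if_splits)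
  define pos where "pos = {u::nat \<Rightarrow> real. \<forall>i\<in>K. 0 < u i}"
  note [measurable] = step.prems(2)
  have cm[measurable]: "(\<lambda>x. x i) \<in> borel_measurable L" if "i \<in> K" for i
    unfolding L_def using that by measurable
  have upd: "(\<lambda>z. F ((f z)(m := g z))) \<in> borel_measurable A"
    if [measurable]: "f \<in> A \<rightarrow>\<^sub>M L" "g \<in> borel_measurable A" for f g and A :: "'z measure"
  proof -
    have "(\<lambda>z. (f z)(m := g z)) \<in> A \<rightarrow>\<^sub>M PiM (insert m K) (\<lambda>_. lborel)"
      using that by (intro measurable_fun_upd[where J=K]) (auto simp: L_def)
    from measurable_compose[OF this] step.prems(2) show ?thesis by (simp add: J)
  qed
  have posm[measurable]: "Measurable.pred L (\<lambda>u. u \<in> pos)"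
    unfolding pos_def using K(1) by measurable
  let ?g = "secular K x (x m)" and ?g' = "secular' K x (x m)"
  have gm[measurable]: "(\<lambda>z. ?g (f z) (h z)) \<in> borel_measurable A" "(\<lambda>z. ?g' (f z) (h z)) \<in> borel_measurable A"
    if f: "f \<in> A \<rightarrow>\<^sub>M L" and [measurable]: "h \<in> borel_measurable A" for f h and A :: "'z measure"
  proof -
    have [measurable]: "(\<lambda>z. f z i) \<in> borel_measurable A" if "i \<in> K" for i
      by (rule measurable_compose[OF f cm[OF that]])
    show "(\<lambda>z. ?g (f z) (h z)) \<in> borel_measurable A" "(\<lambda>z. ?g' (f z) (h z)) \<in> borel_measurable A"
      unfolding secular_def secular'_def by measurable
  qed
  have sub: "(\<integral>\<^sup>+v. indicator {0<..} v * f v \<partial>lborel) =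
      (\<integral>\<^sup>+y. indicator I y * (ennreal (?g' u y) * f (?g u y)) \<partial>lborel)"
    if u: "u \<in> pos" and f: "f \<in> borel_measurable borel" for u and f :: "real \<Rightarrow> ennreal"
  proof (cases "m < N")
    case True
    have "(\<integral>\<^sup>+v. indicator {0<..} v * f v \<partial>lborel) =
      (\<integral>\<^sup>+y. indicator {x m<..<x (Suc m)} y * (ennreal (?g' u y) * f (?g u y)) \<partial>lborel)"
    proof (rule nn_integral_secular[OF f K(1), of "Suc m"])
      show "Suc m \<in> K" using True by (auto simp: K_def)
      then show "x m < x (Suc m)" by (rule xm)
      show "x (Suc m) \<le> x i" if "i \<in> K" for i
        by (rule strict_mono_on_leD[OF xK]) (use that in \<open>auto simp: K_def\<close>)
    qed (use u in \<open>auto simp: pos_def\<close>)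
    then show ?thesis using True by (simp add: I_def)
  next
    case False
    \<comment> \<open>Without further poles \<open>secular\<close> is just \<open>y - x m\<close>,
      and the substitution is a translation.\<close>
    then have "K = {}" by (auto simp: K_def)
    have "(\<integral>\<^sup>+v. indicator {0<..} v * f v \<partial>lborel) =
        (\<integral>\<^sup>+y. indicator {0<..} (y + - x m) * f (y + - x m) \<partial>lborel)"
      using f by (intro nn_integral_lborel_translate) auto
    also have "\<dots> = (\<integral>\<^sup>+y. indicator I y * (ennreal (?g' u y) * f (?g u y)) \<partial>lborel)"
      using False \<open>K = {}\<close>
      by (intro nn_integral_cong) (auto simp: I_def secular_def secular'_def indicator_def)
    finally show ?thesis .
  qed
  have "(\<integral>\<^sup>+u. indicator {u. \<forall>i\<in>{m..N}. 0 < u i} u * F u \<partial>PiM {m..N} (\<lambda>_. lborel)) =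
      (\<integral>\<^sup>+u. (\<integral>\<^sup>+v. indicator {u. \<forall>i\<in>{m..N}. 0 < u i} (u(m := v)) * F (u(m := v)) \<partial>lborel) \<partial>L)"
    unfolding L_def J
  proof (rule product_nn_integral_insert[OF K])
    show "(\<lambda>u. indicator {u. \<forall>i\<in>insert m K. 0 < u i} u * F u) \<in> borel_measurable (PiM (insert m K) (\<lambda>_. lborel))"
      using K(1) unfolding J[symmetric] by measurable
  qed
  also have "\<dots> = (\<integral>\<^sup>+u. indicator pos u * (\<integral>\<^sup>+v. indicator {0<..} v * F (u(m := v)) \<partial>lborel) \<partial>L)"
  proof (rule nn_integral_cong)
    fix u assume u: "u \<in> space L"
    have fu: "(\<lambda>v. F (u(m := v))) \<in> borel_measurable borel" by (rule upd) (use u in auto)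
    have fm: "(\<lambda>v. indicator {0<..} v * F (u(m := v))) \<in> borel_measurable lborel"
      by (intro borel_measurable_times_ennreal) (use fu in auto)
    show "(\<integral>\<^sup>+v. indicator {u. \<forall>i\<in>{m..N}. 0 < u i} (u(m := v)) * F (u(m := v)) \<partial>lborel) =
       indicator pos u * (\<integral>\<^sup>+v. indicator {0<..} v * F (u(m := v)) \<partial>lborel)"
      using K(2) unfolding J nn_integral_cmult[OF fm, symmetric]
      by (intro nn_integral_cong) (auto simp: pos_def indicator_def)
  qed
  also have "\<dots> = (\<integral>\<^sup>+u. indicator pos u *
      (\<integral>\<^sup>+y. indicator I y * (ennreal (?g' u y) * F (u(m := ?g u y))) \<partial>lborel) \<partial>L)"
  proof (rule nn_integral_cong)
    fix u assume u: "u \<in> space L"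
    have "(\<lambda>v. F (u(m := v))) \<in> borel_measurable borel" by (rule upd) (use u in auto)
    from sub[OF _ this, of u]
    show "indicator pos u * (\<integral>\<^sup>+v. indicator {0<..} v * F (u(m := v)) \<partial>lborel) =
      indicator pos u * (\<integral>\<^sup>+y. indicator I y * (ennreal (?g' u y) * F (u(m := ?g u y))) \<partial>lborel)"
      by (cases "u \<in> pos") auto
  qed
  also have "\<dots> = (\<integral>\<^sup>+u. (\<integral>\<^sup>+y. indicator pos u *
      (indicator I y * (ennreal (?g' u y) * F (u(m := ?g u y)))) \<partial>lborel) \<partial>L)"
  proof (intro nn_integral_cong nn_integral_cmult[symmetric])
    fix u assume u: "u \<in> space L"
    have [measurable]: "(\<lambda>y. F (u(m := ?g u y))) \<in> borel_measurable lborel"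
      using u by (intro upd gm) auto
    have [measurable]: "(\<lambda>y. ?g' u y) \<in> borel_measurable lborel"
      using u by (intro gm) auto
    show "(\<lambda>y. indicator I y * (ennreal (?g' u y) * F (u(m := ?g u y)))) \<in> borel_measurable lborel"
      by measurable
  qed
  \<comment> \<open>The lowest root \<open>y\<close> becomes the outer variable, so that it is a
    constant while the induction hypothesis treats the remaining weights.\<close>
  also have "\<dots> = (\<integral>\<^sup>+y. (\<integral>\<^sup>+u. indicator pos u *
      (indicator I y * (ennreal (?g' u y) * F (u(m := ?g u y)))) \<partial>L) \<partial>lborel)"
  proof (rule LL.Fubini')
    have [measurable]: "(\<lambda>z. F ((snd z)(m := ?g (snd z) (fst z)))) \<in> borel_measurable (lborel \<Otimes>\<^sub>M L)"
      by (intro upd gm) auto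
    have [measurable]: "(\<lambda>z. ?g' (snd z) (fst z)) \<in> borel_measurable (lborel \<Otimes>\<^sub>M L)"
      by (intro gm) auto
    show "(\<lambda>(y, u). indicator pos u * (indicator I y * (ennreal (?g' u y) * F (u(m := ?g u y)))))
        \<in> borel_measurable (lborel \<Otimes>\<^sub>M L)"
      unfolding case_prod_beta by measurable
  qed
  also have "\<dots> = (\<integral>\<^sup>+y. (\<integral>\<^sup>+w. indicator {y. interlaced m N x y} (w(m := y)) *
      (ennreal (vdm m N (w(m := y)) / vdm m N x) *
       F (\<lambda>i\<in>{m..N}. residue_weight {m..N} x (w(m := y)) i)) \<partial>L) \<partial>lborel)"
  proof (rule nn_integral_cong)
    fix y :: real
    show "(\<integral>\<^sup>+u. indicator pos u * (indicator I y * (ennreal (?g' u y) * F (u(m := ?g u y)))) \<partial>L) =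
      (\<integral>\<^sup>+w. indicator {y. interlaced m N x y} (w(m := y)) *
      (ennreal (vdm m N (w(m := y)) / vdm m N x) *
       F (\<lambda>i\<in>{m..N}. residue_weight {m..N} x (w(m := y)) i)) \<partial>L)"
    proof (cases "y \<in> I")
      case False
      then have "\<not> interlaced m N x (w(m := y))" for w
        unfolding interlaced_Suc[OF mN] by (auto simp: I_def split: if_splits)
      with False show ?thesis by simp
    next
      case y: True
      \<comment> \<open>The factor by which the index \<open>m\<close>, with root \<open>y\<close>,
        multiplies the weight at \<open>x i\<close>. Scaling by it turns weights of the problem on
        \<open>{Suc m..N}\<close> into weights of the problem on \<open>{m..N}\<close>.\<close>
      define s where "s i = (x i - y) / (x i - x m)" for i
      have s: "0 < s i" if "i \<in> K" for i
        using Ix[OF y that] xm[OF that] by (simp add: s_def)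
      define S where "S u = (\<lambda>i\<in>K. s i * u i)" for u
      have Sm[measurable]: "S \<in> L \<rightarrow>\<^sub>M L"
        unfolding S_def by (subst (2) L_def) (intro measurable_restrict, measurable)
      define H where "H u = ennreal (?g' u y) * F (u(m := ?g u y))" for u
      have Hm[measurable]: "H \<in> borel_measurable L"
      proof -
        have [measurable]: "(\<lambda>u. F (u(m := ?g u y))) \<in> borel_measurable L"
          by (intro upd gm) auto
        have [measurable]: "(\<lambda>u. ?g' u y) \<in> borel_measurable L"
          by (intro gm) auto
        show ?thesis unfolding H_def by measurable
      qed
      have "(\<integral>\<^sup>+u. indicator pos u * (indicator I y * (ennreal (?g' u y) * F (u(m := ?g u y)))) \<partial>L)
          = (\<integral>\<^sup>+u. indicator pos u * H u \<partial>L)"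
        using y by (simp add: H_def)
      also have "\<dots> = (\<Prod>i\<in>K. ennreal (s i)) * (\<integral>\<^sup>+u. indicator pos (S u) * H (S u) \<partial>L)"
        unfolding S_def L_def
        by (rule nn_integral_PiM_scale[OF K(1) _ s]) (use Hm posm in \<open>simp_all add: L_def\<close>)
      also have "(\<integral>\<^sup>+u. indicator pos (S u) * H (S u) \<partial>L) = (\<integral>\<^sup>+u. indicator pos u * H (S u) \<partial>L)"
      proof -
        have "0 < s i * u i \<longleftrightarrow> 0 < u i" if "i \<in> K" for i and u :: "nat \<Rightarrow> real"
          using s[OF that] by (simp add: zero_less_mult_iff)
        then have "S u \<in> pos \<longleftrightarrow> u \<in> pos" for u by (simp add: pos_def S_def)
        then show ?thesis by (simp add: indicator_def)
      qed
      also have "\<dots> = (\<integral>\<^sup>+w. indicator {w. interlaced (Suc m) N x w} w * (ennreal (vdm (Suc m) N w / vdm (Suc m) N x) *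
          H (S (\<lambda>i\<in>K. residue_weight K x w i))) \<partial>L)"
        by (rule step.IH[of "\<lambda>u. H (S u)", folded K_def, folded L_def pos_def,
          OF xK measurable_compose[OF Sm Hm]])
      also have "(\<Prod>i\<in>K. ennreal (s i)) * \<dots> =
         (\<integral>\<^sup>+w. (\<Prod>i\<in>K. ennreal (s i)) * (indicator {w. interlaced (Suc m) N x w} w * (ennreal (vdm (Suc m) N w / vdm (Suc m) N x) *
          H (S (\<lambda>i\<in>K. residue_weight K x w i)))) \<partial>L)"
      proof (rule nn_integral_cmult[symmetric])
        have rm[measurable]: "(\<lambda>w. \<lambda>i\<in>K. residue_weight K x w i) \<in> L \<rightarrow>\<^sub>M L"
          unfolding residue_weight_def by (subst (2) L_def) (intro measurable_restrict, measurable)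
        have [measurable]: "(\<lambda>w. H (S (\<lambda>i\<in>K. residue_weight K x w i))) \<in> borel_measurable L"
          by measurable
        have [measurable]: "(\<lambda>w. vdm (Suc m) N w) \<in> borel_measurable L"
          unfolding vdm_def K_def[symmetric]
          by (intro borel_measurable_prod borel_measurable_diff cm) (auto simp: K_def)
        have "{i. i \<in> K \<and> i < N} \<subseteq> K" "\<And>i. i \<in> K \<Longrightarrow> finite K" using K(1) by auto
        have [measurable]: "Measurable.pred L (\<lambda>w. interlaced (Suc m) N x w)"
          unfolding interlaced_def K_def[symmetric] using K(1) by measurable
        show "(\<lambda>w. indicator {w. interlaced (Suc m) N x w} w * (ennreal (vdm (Suc m) N w / vdm (Suc m) N x) *
          H (S (\<lambda>i\<in>K. residue_weight K x w i)))) \<in> borel_measurable L"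
          by measurable
      qed
      also have "\<dots> = (\<integral>\<^sup>+w. indicator {y. interlaced m N x y} (w(m := y)) *
        (ennreal (vdm m N (w(m := y)) / vdm m N x) *
         F (\<lambda>i\<in>{m..N}. residue_weight {m..N} x (w(m := y)) i)) \<partial>L)"
      proof (rule nn_integral_cong)
        fix w assume "w \<in> space L"
        let ?w = "w(m := y)"
        have il: "interlaced m N x ?w \<longleftrightarrow> interlaced (Suc m) N x w"
          using y unfolding interlaced_Suc[OF mN] by (auto simp: I_def interlaced_def split: if_splits)
        show "(\<Prod>i\<in>K. ennreal (s i)) * (indicator {w. interlaced (Suc m) N x w} w * (ennreal (vdm (Suc m) N w / vdm (Suc m) N x) *
          H (S (\<lambda>i\<in>K. residue_weight K x w i)))) = indicator {y. interlaced m N x y} ?w *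
          (ennreal (vdm m N ?w / vdm m N x) * F (\<lambda>i\<in>{m..N}. residue_weight {m..N} x ?w i))"
        proof (cases "interlaced (Suc m) N x w")
          case int: True
          define U where "U = S (\<lambda>i\<in>K. residue_weight K x w i)"
          have inj: "inj_on x K" by (rule strict_mono_on_imp_inj_on[OF xK])
          have U: "U i = residue_weight {m..N} x ?w i" if "i \<in> K" for i
          proof -
            have "residue_weight {m..N} x ?w i = residue_weight K x ?w i * ((y - x i) / (x m - x i))"
              unfolding J residue_weight_insert[OF K that] by simp
            also have "residue_weight K x ?w i = residue_weight K x w i"
              using K(2) that by (intro residue_weight_cong) auto
            also have "(y - x i) / (x m - x i) = s i"
              unfolding s_def by (metis minus_diff_eq minus_divide_divide)
            finally show ?thesis using that by (simp only: U_def S_def restrict_apply') simp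
          qed
          have wK: "\<And>j. j \<in> K \<Longrightarrow> ?w j = w j" using K(2) by auto
          have Ut: "U i / (x i - y) = residue_weight K x w i / (x i - x m)" if "i \<in> K" for i
            using Ix[OF y that] that by (simp add: U_def S_def s_def)
          \<comment> \<open>The partial fraction identity at \<open>z = x m\<close> identifies the
            substituted value with the weight at \<open>m\<close>.\<close>
          have g: "?g U y = residue_weight {m..N} x ?w m"
          proof -
            have "?g U y = (y - x m) * (1 + (\<Sum>i\<in>K. residue_weight K x w i / (x i - x m)))"
              unfolding secular_def using Ut by (simp cong: sum.cong)
            also have "\<dots> = (y - x m) * (\<Prod>j\<in>K. (w j - x m) / (x j - x m))"
              using xm by (subst residue_weight_partial_fractions[OF K(1) inj]) force+
            also have "\<dots> = residue_weight {m..N} x ?w m"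
              unfolding J residue_weight_new[OF K] using wK by (simp cong: prod.cong)
            finally show ?thesis .
          qed
          \<comment> \<open>The same identity at \<open>z = y\<close> evaluates the derivative as a
            product.\<close>
          have g': "?g' U y = (\<Prod>j\<in>K. (w j - y) / (x j - y))"
          proof -
            have "U i * (x i - x m) / (x i - y)\<^sup>2 = residue_weight K x w i / (x i - y)" if "i \<in> K" for i
              using Ix[OF y that] xm[OF that] that by (simp add: U_def S_def s_def power2_eq_square)
            then have "?g' U y = 1 + (\<Sum>i\<in>K. residue_weight K x w i / (x i - y))"
              unfolding secular'_def by (simp cong: sum.cong)
            also have "\<dots> = (\<Prod>j\<in>K. (w j - y) / (x j - y))"
              using Ix[OF y] by (intro residue_weight_partial_fractions[OF K(1) inj]) force
            finally show ?thesis .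
          qed
          have Fe: "U(m := ?g U y) = (\<lambda>i\<in>{m..N}. residue_weight {m..N} x ?w i)"
          proof
            fix i show "(U(m := ?g U y)) i = (\<lambda>i\<in>{m..N}. residue_weight {m..N} x ?w i) i"
              using U[of i] g K(2) by (auto simp: J U_def S_def)
          qed
          \<comment> \<open>Scaling factors times derivative leave exactly the quotient of the
            factors that the index \<open>m\<close> contributes to the two Vandermonde products.
            This is the whole Jacobian of one step.\<close>
          have pr: "(\<Prod>i\<in>K. s i) * ?g' U y = (\<Prod>j\<in>K. w j - y) / (\<Prod>j\<in>K. x j - x m)"
          proof -
            have "(\<Prod>i\<in>K. s i) * ?g' U y = (\<Prod>j\<in>K. s j * ((w j - y) / (x j - y)))"
              unfolding g' prod.distrib ..
            also have "\<dots> = (\<Prod>j\<in>K. (w j - y) / (x j - x m))"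
              using Ix[OF y] by (intro prod.cong refl) (force simp: s_def)
            finally show ?thesis by (simp add: prod_dividef)
          qed
          have vw: "vdm m N ?w = (\<Prod>j\<in>K. w j - y) * vdm (Suc m) N w"
          proof -
            have "vdm (Suc m) N ?w = vdm (Suc m) N w"
              unfolding vdm_def by (intro prod.cong refl) auto
            moreover have "(\<Prod>j\<in>K. ?w j - ?w m) = (\<Prod>j\<in>K. w j - y)"
              using K(2) by (intro prod.cong refl) auto
            ultimately show ?thesis unfolding vdm_Suc[OF mN] K_def by simp
          qed
          have wy: "y < w j" if "j \<in> K" for j
          proof -
            have "x j < w j" using int that by (auto simp: interlaced_def K_def)
            then show ?thesis using Ix[OF y that] by simp
          qed
          have p1: "0 \<le> (\<Prod>i\<in>K. s i)" "0 \<le> ?g' U y"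
            using s wy Ix[OF y] unfolding g'
            by (intro prod_nonneg divide_nonneg_nonneg; force)+
          have p2: "0 < vdm (Suc m) N w" "0 < vdm (Suc m) N x"
            using vdm_pos[OF interlaced_strict_mono(1)[OF int]] vdm_pos[OF interlaced_strict_mono(2)[OF int]] by auto
          have "(\<Prod>i\<in>K. s i) * (vdm (Suc m) N w / vdm (Suc m) N x) * ?g' U y = vdm m N ?w / vdm m N x"
          proof -
            have "(\<Prod>i\<in>K. s i) * (vdm (Suc m) N w / vdm (Suc m) N x) * ?g' U y =
              ((\<Prod>i\<in>K. s i) * ?g' U y) * (vdm (Suc m) N w / vdm (Suc m) N x)" by simp
            also have "\<dots> = vdm m N ?w / vdm m N x"
              unfolding pr vw vdm_Suc[OF mN, of x] K_def[symmetric] by simp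
            finally show ?thesis .
          qed
          then have e: "ennreal (vdm m N ?w / vdm m N x) =
              (\<Prod>i\<in>K. ennreal (s i)) * ennreal (vdm (Suc m) N w / vdm (Suc m) N x) * ennreal (?g' U y)"
            using p1 p2 s by (simp add: prod_ennreal less_imp_le flip: ennreal_mult)
          show ?thesis
            unfolding e U_def[symmetric] H_def Fe using int il by (simp add: mult_ac)
        qed (simp add: il)
      qed
      finally show ?thesis .
    qed
  qed
  also have "\<dots> = (\<integral>\<^sup>+y. indicator {y. interlaced m N x y} y * (ennreal (vdm m N y / vdm m N x) *
       F (\<lambda>i\<in>{m..N}. residue_weight {m..N} x y i)) \<partial>PiM {m..N} (\<lambda>_. lborel))"
    unfolding L_def J
  proof (rule product_nn_integral_insert_rev[OF K, symmetric])
    let ?P = "PiM (insert m K) (\<lambda>_. lborel :: real measure)"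
    have cP[measurable]: "(\<lambda>x. x i) \<in> borel_measurable ?P" if "i \<in> insert m K" for i
      using measurable_component_singleton[OF that, of "\<lambda>_. lborel"] by simp
    have [measurable]: "F \<in> borel_measurable ?P" using step.prems(2) by (simp add: J)
    have [measurable]: "(\<lambda>w. \<lambda>i\<in>insert m K. residue_weight (insert m K) x w i) \<in> ?P \<rightarrow>\<^sub>M ?P"
      unfolding residue_weight_def by (intro measurable_restrict, measurable)
    have [measurable]: "(\<lambda>w. vdm m N w) \<in> borel_measurable ?P"
      unfolding vdm_def J
      by (intro borel_measurable_prod borel_measurable_diff cP) (auto simp: K_def)
    have [measurable]: "Measurable.pred ?P (\<lambda>w. interlaced m N x w)"
      unfolding interlaced_def J using K(1) by measurable
    show "(\<lambda>y. indicator {y. interlaced m N x y} y * (ennreal (vdm m N y / vdm m N x) *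
       F (\<lambda>i\<in>insert m K. residue_weight (insert m K) x y i))) \<in> borel_measurable ?P"
      by measurable
  qed
  finally show ?case .
qed

section \<open>Rank one updates of Gram matrices\<close>

no_notation Finite_Cartesian_Product.vec_nth (infixl "$" 90)
hide_const (open) Finite_Cartesian_Product.vec Finite_Cartesian_Product.mat Finite_Cartesian_Product.row
  Finite_Cartesian_Product.column Determinants.det

lemma proots_prod_linear_factors:
  fixes f :: "'i \<Rightarrow> 'a::idom"
  assumes "finite A"
  shows "proots (\<Prod>i\<in>A. [:- f i, 1:]) = image_mset f (mset_set A)"
proof -
  have "proots (\<Prod>i\<in>A. [:- f i, 1:]) = (\<Sum>i\<in>A. proots [:- f i, 1:])" by (rule proots_prod) auto
  also have "\<dots> = (\<Sum>i\<in>A. {#f i#})" by (simp only: proots_linear_factor minus_minus)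
  also have "\<dots> = image_mset f (mset_set A)" using assms by (simp add: sum_unfold_sum_mset)
  finally show ?thesis .
qed

lemma monic_eq_prod_linear_factors:
  fixes p :: "'a::{idom} poly"
  assumes "lead_coeff p = 1" "finite A" "degree p = card A" "inj_on f A" "\<And>i. i \<in> A \<Longrightarrow> poly p (f i) = 0"
  shows "p = (\<Prod>i\<in>A. [:- f i, 1:])"
proof (rule poly_eqI_degree_lead_coeff[where A = "f ` A" and n = "card A"])
  have "degree (\<Prod>i\<in>A. [:- f i, 1:]) = card A" by (subst degree_prod_eq_sum_degree) auto
  then show "degree (\<Prod>i\<in>A. [:- f i, 1:]) \<le> card A"
    "coeff p (card A) = coeff (\<Prod>i\<in>A. [:- f i, 1:]) (card A)"
    using assms lead_coeff_prod[of "\<lambda>i. [:- f i, 1:]" A] by auto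
  fix x assume "x \<in> f ` A"
  then show "poly p x = poly (\<Prod>i\<in>A. [:- f i, 1:]) x"
    using assms by (auto simp: poly_prod prod_zero_iff)
qed (use assms in \<open>auto simp: card_image\<close>)

lemma sorted_list_of_image_mset_strict_mono:
  fixes x :: "nat \<Rightarrow> 'a::linorder"
  assumes "strict_mono_on {1..N} x"
  shows "sorted_list_of_multiset (image_mset x (mset_set {1..N})) = map x [1..<Suc N]"
proof -
  have m: "mset_set {1..N} = mset [1..<Suc N]"
    by (metis atLeastLessThanSuc_atLeastAtMost mset_upt)
  have "sorted_wrt (<) (map x [1..<Suc N])"
    unfolding sorted_wrt_map
    by (rule sorted_wrt_mono_rel[OF _ sorted_wrt_upt]) (use assms in \<open>auto simp: strict_mono_on_def\<close>)
  then have s: "sorted (map x [1..<Suc N])" by (rule strict_sorted_imp_sorted)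
  have "image_mset x (mset_set {1..N}) = mset (map x [1..<Suc N])" by (simp only: m mset_map)
  then show ?thesis using s by (simp only: sorted_list_of_multiset_mset sorted_sort_id)
qed

text \<open>Matrix entries are a function of index pairs counted from 1, so that they can be
  integrated over product measures indexed by such pairs.\<close>

definition gram_entry :: "nat \<Rightarrow> (nat \<times> nat \<Rightarrow> complex) \<Rightarrow> nat \<Rightarrow> nat \<Rightarrow> complex" where
  "gram_entry n g j k = (\<Sum>i\<in>{1..n}. cnj (g (i, j)) * g (i, k))"

definition gram_mat :: "nat \<Rightarrow> nat \<Rightarrow> (nat \<times> nat \<Rightarrow> complex) \<Rightarrow> complex mat" where
  "gram_mat n N g = Matrix.mat N N (\<lambda>(j, k). gram_entry n g (Suc j) (Suc k))"

lemma gram_mat_carrier[simp]: "gram_mat n N g \<in> carrier_mat N N"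
  by (simp add: gram_mat_def)

lemma index_mat_adjoint:
  "i < dim_col A \<Longrightarrow> j < dim_row A \<Longrightarrow> mat_adjoint A $$ (i, j) = conjugate (A $$ (j, i))"
  by (simp add: mat_adjoint_def mat_of_rows_index)

lemma adjoint_mult_eq_gram_mat:
  "mat_adjoint (Matrix.mat n N (\<lambda>(i, j). g (Suc i, Suc j))) * Matrix.mat n N (\<lambda>(i, j). g (Suc i, Suc j)) = gram_mat n N g"
  (is "mat_adjoint ?A * ?A = _")
proof (rule eq_matI)
  have dim: "dim_row (mat_adjoint ?A) = N" "dim_col (mat_adjoint ?A) = n"
    by (simp_all add: mat_adjoint_def)
  then show "dim_row (mat_adjoint ?A * ?A) = dim_row (gram_mat n N g)"
    "dim_col (mat_adjoint ?A * ?A) = dim_col (gram_mat n N g)"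
    by (simp_all add: gram_mat_def)
  fix j k assume "j < dim_row (gram_mat n N g)" "k < dim_col (gram_mat n N g)"
  then have jk: "j < N" "k < N" by (simp_all add: gram_mat_def)
  then have "(mat_adjoint ?A * ?A) $$ (j, k) = (\<Sum>i = 0..<n. mat_adjoint ?A $$ (j, i) * ?A $$ (i, k))"
    using dim by (simp add: scalar_prod_def)
  also have "\<dots> = (\<Sum>i = 0..<n. cnj (g (Suc i, Suc j)) * g (Suc i, Suc k))"
    using jk by (intro sum.cong refl) (simp add: index_mat_adjoint conjugate_complex_def)
  also have "\<dots> = gram_mat n N g $$ (j, k)"
    using jk by (simp add: gram_mat_def gram_entry_def sum.atLeast1_atMost_eq lessThan_atLeast0)
  finally show "(mat_adjoint ?A * ?A) $$ (j, k) = gram_mat n N g $$ (j, k)" .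
qed

text \<open>Turns eigenvectors into plain functions on \<open>{1..N}\<close>, with sums over indices
  from 1; the shift \<open>j - 1\<close> to library vectors stays inside this proof.\<close>

lemma gram_mat_root_iff:
  "poly (char_poly (gram_mat n N g)) z = 0 \<longleftrightarrow>
    (\<exists>e. (\<exists>j\<in>{1..N}. e j \<noteq> 0) \<and> (\<forall>j\<in>{1..N}. (\<Sum>k\<in>{1..N}. gram_entry n g j k * e k) = z * e j))"
proof -
  have "poly (char_poly (gram_mat n N g)) z = 0 \<longleftrightarrow> (\<exists>v. eigenvector (gram_mat n N g) v z)"
    using eigenvalue_root_char_poly[OF gram_mat_carrier, of n N g z] by (simp add: eigenvalue_def)
  also have "\<dots> \<longleftrightarrow> (\<exists>e. (\<exists>j\<in>{1..N}. e j \<noteq> 0) \<and> (\<forall>j\<in>{1..N}. (\<Sum>k\<in>{1..N}. gram_entry n g j k * e k) = z * e j))"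
    (is "_ \<longleftrightarrow> (\<exists>e. ?Q e)")
  proof
    have key: "eigenvector (gram_mat n N g) v z \<longleftrightarrow> v \<in> carrier_vec N \<and> ?Q (\<lambda>j. v $ (j - 1))" for v
    proof (cases "v \<in> carrier_vec N")
      case v: True
      have n0: "v \<noteq> 0\<^sub>v N \<longleftrightarrow> (\<exists>j\<in>{1..N}. v $ (j - 1) \<noteq> 0)"
      proof -
        have "v = 0\<^sub>v N \<longleftrightarrow> (\<forall>i<N. v $ i = 0)" using v by (auto intro!: eq_vecI)
        also have "\<dots> \<longleftrightarrow> (\<forall>j\<in>{1..N}. v $ (j - 1) = 0)"
        proof safe
          fix i assume *: "\<forall>j\<in>{1..N}. v $ (j - 1) = 0" and "i < N"
          then show "v $ i = 0" using bspec[OF *, of "Suc i"] by simp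
        qed auto
        finally show ?thesis by blast
      qed
      have ix: "(gram_mat n N g *\<^sub>v v) $ i = (\<Sum>k\<in>{1..N}. gram_entry n g (Suc i) k * v $ (k - 1))" if "i < N" for i
        using that v by (simp add: gram_mat_def scalar_prod_def sum.atLeast1_atMost_eq lessThan_atLeast0)
      have "gram_mat n N g *\<^sub>v v = z \<cdot>\<^sub>v v \<longleftrightarrow> (\<forall>i<N. (gram_mat n N g *\<^sub>v v) $ i = (z \<cdot>\<^sub>v v) $ i)"
      proof
        assume "\<forall>i<N. (gram_mat n N g *\<^sub>v v) $ i = (z \<cdot>\<^sub>v v) $ i"
        then show "gram_mat n N g *\<^sub>v v = z \<cdot>\<^sub>v v"
          using v by (intro eq_vecI) (auto simp: gram_mat_def simp del: index_mult_mat_vec)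
      qed simp
      also have "\<dots> \<longleftrightarrow> (\<forall>i<N. (\<Sum>k\<in>{1..N}. gram_entry n g (Suc i) k * v $ (k - 1)) = z * v $ i)"
        using v by (auto simp: ix simp del: index_mult_mat_vec)
      also have "\<dots> \<longleftrightarrow> (\<forall>j\<in>{1..N}. (\<Sum>k\<in>{1..N}. gram_entry n g j k * v $ (k - 1)) = z * v $ (j - 1))"
        (is "?L \<longleftrightarrow> ?R")
      proof
        assume L: ?L
        show ?R
        proof
          fix j assume "j \<in> {1..N}"
          then obtain i where "j = Suc i" "i < N" by (cases j) auto
          then show "(\<Sum>k\<in>{1..N}. gram_entry n g j k * v $ (k - 1)) = z * v $ (j - 1)"
            using L by simp
        qed
      next
        assume R: ?R
        show ?L
        proof (intro allI impI)
          fix i assume "i < N"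
          then show "(\<Sum>k\<in>{1..N}. gram_entry n g (Suc i) k * v $ (k - 1)) = z * v $ i"
            using bspec[OF R, of "Suc i"] by simp
        qed
      qed
      finally show ?thesis using n0 v by (simp add: eigenvector_def gram_mat_def)
    qed (simp add: eigenvector_def gram_mat_def)
    {
      assume "\<exists>v. eigenvector (gram_mat n N g) v z"
      then obtain v where "eigenvector (gram_mat n N g) v z" ..
      then have "?Q (\<lambda>j. v $ (j - 1))" using key[of v] by simp
      then show "\<exists>e. ?Q e" by (rule exI[of _ "\<lambda>j. v $ (j - 1)"])
    next
      assume "\<exists>e. ?Q e"
      then obtain e where e: "?Q e" ..
      define v where "v = Matrix.vec N (\<lambda>i. e (Suc i))"
      have "v $ (j - 1) = e j" if "j \<in> {1..N}" for j
        using that by (cases j) (simp_all add: v_def)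
      then have "?Q (\<lambda>j. v $ (j - 1))" using e by simp
      moreover have "v \<in> carrier_vec N" by (simp add: v_def)
      ultimately have "eigenvector (gram_mat n N g) v z" using key[of v] by simp
      then show "\<exists>v. eigenvector (gram_mat n N g) v z" by (rule exI)
    }
  qed
  finally show ?thesis .
qed

lemma gram_mat_rootE:
  assumes "poly (char_poly (gram_mat n N g)) z = 0"
  obtains e j0 where "j0 \<in> {1..N}" "e j0 \<noteq> 0"
    "\<And>j. j \<in> {1..N} \<Longrightarrow> (\<Sum>k\<in>{1..N}. gram_entry n g j k * e k) = z * e j"
  using assms unfolding gram_mat_root_iff by blast

lemma gram_mat_rootI:
  assumes "j0 \<in> {1..N}" "e j0 \<noteq> 0"
    "\<And>j. j \<in> {1..N} \<Longrightarrow> (\<Sum>k\<in>{1..N}. gram_entry n g j k * e k) = z * e j"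
  shows "poly (char_poly (gram_mat n N g)) z = 0"
  using assms unfolding gram_mat_root_iff by blast

lemma gram_entry_cnj: "gram_entry n g k j = cnj (gram_entry n g j k)"
  by (simp add: gram_entry_def cnj_sum mult.commute)

lemma sum_cnj_mult_self: "(\<Sum>j\<in>J. cnj (e j) * e j) = of_real (\<Sum>j\<in>J. (cmod (e j))\<^sup>2)"
  by (simp only: of_real_sum complex_norm_square mult.commute)

declare One_nat_def [simp del]

text \<open>Pairing the eigenvector equation with \<open>e\<close> gives \<open>z * s = q\<close>,
  where \<open>s\<close> is the squared norm of \<open>e\<close> and \<open>q\<close> that of its
  image under the matrix \<open>g\<close>. So \<open>z\<close> is a quotient of nonnegative
  reals.\<close>

lemma gram_mat_root_real_nonneg:
  assumes "poly (char_poly (gram_mat n N g)) z = 0"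
  shows "z = of_real (Re z)" "0 \<le> Re z"
proof -
  obtain j0 e where j0: "j0 \<in> {1..N}" "e j0 \<noteq> 0"
    and e: "\<And>j. j \<in> {1..N} \<Longrightarrow> (\<Sum>k\<in>{1..N}. gram_entry n g j k * e k) = z * e j"
    by (rule gram_mat_rootE[OF assms], rule that) assumption+
  define s where "s = (\<Sum>j\<in>{1..N}. (cmod (e j))\<^sup>2)"
  define q where "q = (\<Sum>i\<in>{1..n}. (cmod (\<Sum>k\<in>{1..N}. g (i, k) * e k))\<^sup>2)"
  have "0 < s" unfolding s_def using j0 by (intro sum_pos2[of _ j0]) auto
  have "z * of_real s = (\<Sum>j\<in>{1..N}. z * (cnj (e j) * e j))"
    by (simp only: s_def sum_cnj_mult_self[symmetric] sum_distrib_left)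
  also have "\<dots> = (\<Sum>j\<in>{1..N}. cnj (e j) * (\<Sum>k\<in>{1..N}. gram_entry n g j k * e k))"
    by (intro sum.cong refl) (simp add: e)
  also have "\<dots> = (\<Sum>j\<in>{1..N}. \<Sum>k\<in>{1..N}. \<Sum>i\<in>{1..n}. cnj (g (i, j) * e j) * (g (i, k) * e k))"
    by (simp add: gram_entry_def sum_distrib_left sum_distrib_right mult_ac)
  also have "\<dots> = (\<Sum>j\<in>{1..N}. \<Sum>i\<in>{1..n}. \<Sum>k\<in>{1..N}. cnj (g (i, j) * e j) * (g (i, k) * e k))"
    by (intro sum.cong refl sum.swap)
  also have "\<dots> = (\<Sum>i\<in>{1..n}. \<Sum>j\<in>{1..N}. \<Sum>k\<in>{1..N}. cnj (g (i, j) * e j) * (g (i, k) * e k))"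
    by (rule sum.swap)
  also have "\<dots> = (\<Sum>i\<in>{1..n}. cnj (\<Sum>k\<in>{1..N}. g (i, k) * e k) * (\<Sum>k\<in>{1..N}. g (i, k) * e k))"
    by (simp only: cnj_sum sum_product)
  also have "\<dots> = of_real q" unfolding sum_cnj_mult_self q_def ..
  finally have "z = of_real (q / s)" using \<open>0 < s\<close> by (simp add: field_simps)
  moreover have "0 \<le> q" unfolding q_def by (intro sum_nonneg) auto
  ultimately show "z = of_real (Re z)" "0 \<le> Re z" using \<open>0 < s\<close> by simp_all
qed

section \<open>Ordered eigenvalues of a Gram matrix\<close>

definition gram_evals :: "nat \<Rightarrow> nat \<Rightarrow> (nat \<times> nat \<Rightarrow> complex) \<Rightarrow> real list" where
  "gram_evals n N g = ordered_eigenvalues (gram_mat n N g)"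

text \<open>The eigenvalues are indexed from 1, as in the definition of \<open>laguerre_eigenvalue\<close>.\<close>

definition gram_ev :: "nat \<Rightarrow> nat \<Rightarrow> (nat \<times> nat \<Rightarrow> complex) \<Rightarrow> nat \<Rightarrow> real" where
  "gram_ev n N g j = gram_evals n N g ! (j - 1)"

lemma gram_mat_monic: "lead_coeff (char_poly (gram_mat n N g)) = 1"
  and gram_mat_degree: "degree (char_poly (gram_mat n N g)) = N"
  using degree_monic_char_poly[OF gram_mat_carrier, of n N g] by auto

lemma mset_gram_evals: "mset (gram_evals n N g) = image_mset Re (proots (char_poly (gram_mat n N g)))"
  by (simp add: gram_evals_def ordered_eigenvalues_def)

lemma length_gram_evals[simp]: "length (gram_evals n N g) = N"
  using arg_cong[OF mset_gram_evals, of size n N g] size_proots_complex[of "char_poly (gram_mat n N g)"]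
    gram_mat_degree[of n N g] by simp

lemma sorted_gram_evals: "sorted (gram_evals n N g)"
  by (simp add: gram_evals_def ordered_eigenvalues_def)

text \<open>All roots are real, so the real parts taken in \<open>ordered_eigenvalues\<close> lose
  no information.\<close>

lemma proots_gram_mat:
  "proots (char_poly (gram_mat n N g)) = image_mset of_real (mset (gram_evals n N g))"
proof -
  have "char_poly (gram_mat n N g) \<noteq> 0" using gram_mat_monic[of n N g] by auto
  then have "of_real (Re z) = z" if "z \<in># proots (char_poly (gram_mat n N g))" for z
    using gram_mat_root_real_nonneg(1)[of n N g z] that by simp
  then have "image_mset (\<lambda>z. of_real (Re z)) (proots (char_poly (gram_mat n N g))) =
      image_mset (\<lambda>z. z) (proots (char_poly (gram_mat n N g)))"
    by (rule image_mset_cong)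
  then show ?thesis
    by (simp add: mset_gram_evals image_mset.compositionality comp_def)
qed

lemma char_poly_gram_mat:
  "char_poly (gram_mat n N g) = (\<Prod>l\<leftarrow>gram_evals n N g. [:- of_real l, 1:])"
proof -
  have "char_poly (gram_mat n N g) = (\<Prod>x\<in>#proots (char_poly (gram_mat n N g)). [:- x, 1:])"
    using complex_poly_decompose_multiset[of "char_poly (gram_mat n N g)"] gram_mat_monic[of n N g] by simp
  then show ?thesis
    unfolding proots_gram_mat by (simp add: image_mset.compositionality comp_def flip: prod_mset_prod_list mset_map)
qed

lemma gram_evals_root:
  assumes "l \<in> set (gram_evals n N g)"
  shows "poly (char_poly (gram_mat n N g)) (of_real l) = 0"
  using assms unfolding char_poly_gram_mat by (auto simp: poly_prod_list prod_list_zero_iff)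

lemma gram_evals_nonneg: "l \<in> set (gram_evals n N g) \<Longrightarrow> 0 \<le> l"
  using gram_mat_root_real_nonneg(2)[OF gram_evals_root] by simp

lemma gram_ev_in_set: "j \<in> {1..N} \<Longrightarrow> gram_ev n N g j \<in> set (gram_evals n N g)"
  by (auto simp: gram_ev_def)

text \<open>Distinct roots, \<open>N\<close> in number, exhaust a characteristic polynomial of
  degree \<open>N\<close>, and monotonicity fixes their order. Eigenvalues are computed below by
  exhibiting roots in this way.\<close>

lemma gram_ev_unique:
  assumes "strict_mono_on {1..N} y"
    and "\<And>j. j \<in> {1..N} \<Longrightarrow> poly (char_poly (gram_mat n N g)) (of_real (y j)) = 0"
    and "j \<in> {1..N}"
  shows "gram_ev n N g j = y j"
proof -
  have inj: "inj_on (\<lambda>j. complex_of_real (y j)) {1..N}"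
    by (rule inj_onI) (use strict_mono_on_imp_inj_on[OF assms(1)] in \<open>simp add: inj_on_eq_iff\<close>)
  have "char_poly (gram_mat n N g) = (\<Prod>j\<in>{1..N}. [:- complex_of_real (y j), 1:])"
    by (rule monic_eq_prod_linear_factors[OF gram_mat_monic _ _ inj assms(2)])
      (simp_all add: gram_mat_degree)
  then have "proots (char_poly (gram_mat n N g)) = image_mset (\<lambda>j. complex_of_real (y j)) (mset_set {1..N})"
    by (simp only: proots_prod_linear_factors finite_atLeastAtMost)
  then have "gram_evals n N g = sorted_list_of_multiset (image_mset y (mset_set {1..N}))"
    by (simp add: gram_evals_def ordered_eigenvalues_def image_mset.compositionality comp_def)
  also have "\<dots> = map y [1..<Suc N]" by (rule sorted_list_of_image_mset_strict_mono[OF assms(1)])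
  finally show ?thesis using assms(3) by (cases j) (simp_all add: gram_ev_def One_nat_def del: upt_Suc)
qed

text \<open>A right inverse of a square matrix is also a left inverse.\<close>

lemma orthonormal_rows_imp_columns:
  fixes T :: "nat \<Rightarrow> nat \<Rightarrow> complex"
  assumes "\<And>i k. i \<in> {1..N} \<Longrightarrow> k \<in> {1..N} \<Longrightarrow> (\<Sum>j\<in>{1..N}. T i j * cnj (T k j)) = of_bool (i = k)"
    and ik: "i \<in> {1..N}" "k \<in> {1..N}"
  shows "(\<Sum>j\<in>{1..N}. cnj (T j i) * T j k) = of_bool (i = k)"
proof -
  define A where "A = Matrix.mat N N (\<lambda>(i, j). T (Suc i) (Suc j))"
  define B where "B = Matrix.mat N N (\<lambda>(i, j). cnj (T (Suc j) (Suc i)))"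
  have AB: "A \<in> carrier_mat N N" "B \<in> carrier_mat N N" by (simp_all add: A_def B_def)
  have s: "(\<Sum>j\<in>{1..N}. f j) = (\<Sum>j = 0..<N. f (Suc j))" for f :: "nat \<Rightarrow> complex"
    by (simp add: sum.atLeast1_atMost_eq lessThan_atLeast0 One_nat_def)
  have "A * B = 1\<^sub>m N"
  proof (rule eq_matI)
    fix i j assume "i < dim_row (1\<^sub>m N :: complex mat)" "j < dim_col (1\<^sub>m N :: complex mat)"
    then show "(A * B) $$ (i, j) = 1\<^sub>m N $$ (i, j)"
      using assms(1)[of "Suc i" "Suc j"] by (simp add: A_def B_def scalar_prod_def s)
  qed (simp_all add: A_def B_def)
  then have BA: "B * A = 1\<^sub>m N" by (rule mat_mult_left_right_inverse[OF AB])
  obtain i' k' where ik': "i = Suc i'" "k = Suc k'" "i' < N" "k' < N"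
    using ik by (cases i; cases k) auto
  then have "(B * A) $$ (i', k') = (\<Sum>j\<in>{1..N}. cnj (T j i) * T j k)"
    by (simp add: A_def B_def scalar_prod_def s)
  then show ?thesis using BA ik' by (simp split: if_splits)
qed

text \<open>For \<open>\<bar>T w\<bar>\<^sup>2 = residue_weight x y\<close>, the numbers \<open>y l\<close> are the roots of the secular equation of the
  rank-one perturbation; the eigenvectors are explicit.\<close>

lemma gram_rank_one_update:
  assumes x: "strict_mono_on {1..N} (gram_ev n N g)"
  obtains T :: "nat \<Rightarrow> nat \<Rightarrow> complex" where
    "\<And>i k. i \<in> {1..N} \<Longrightarrow> k \<in> {1..N} \<Longrightarrow> (\<Sum>j\<in>{1..N}. T i j * cnj (T k j)) = of_bool (i = k)"
    "\<And>g' w y j. (\<And>i j. i \<in> {1..n} \<Longrightarrow> j \<in> {1..N} \<Longrightarrow> g' (i, j) = g (i, j)) \<Longrightarrow>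
       (\<And>j. j \<in> {1..N} \<Longrightarrow> g' (Suc n, j) = w j) \<Longrightarrow>
       interlaced 1 N (gram_ev n N g) y \<Longrightarrow>
       (\<And>i. i \<in> {1..N} \<Longrightarrow> (cmod (\<Sum>j\<in>{1..N}. T i j * w j))\<^sup>2 = residue_weight {1..N} (gram_ev n N g) y i) \<Longrightarrow>
       j \<in> {1..N} \<Longrightarrow> gram_ev (Suc n) N g' j = y j"
proof -
  let ?J = "{1..N}" and ?G = "gram_entry n g"
  define x where "x = gram_ev n N g"
  have xinj: "x i \<noteq> x k" if "i \<in> ?J" "k \<in> ?J" "i \<noteq> k" for i k
    using inj_onD[OF strict_mono_on_imp_inj_on[OF assms], of i k] that by (auto simp: x_def)
  have "\<exists>e. (\<Sum>j\<in>?J. (cmod (e j))\<^sup>2) = 1 \<and> (\<forall>j\<in>?J. (\<Sum>k\<in>?J. ?G j k * e k) = of_real (x i) * e j)"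
    if i: "i \<in> ?J" for i
  proof -
    have "poly (char_poly (gram_mat n N g)) (of_real (x i)) = 0"
      unfolding x_def by (rule gram_evals_root[OF gram_ev_in_set[OF i]])
    then obtain j0 e where j0: "j0 \<in> ?J" "e j0 \<noteq> 0"
      and e: "\<And>j. j \<in> ?J \<Longrightarrow> (\<Sum>k\<in>?J. ?G j k * e k) = of_real (x i) * e j"
      by (elim gram_mat_rootE) (rule that)
    define s where "s = (\<Sum>j\<in>?J. (cmod (e j))\<^sup>2)"
    have s: "0 < s" unfolding s_def using j0 by (intro sum_pos2[of _ j0]) auto
    define f where "f j = of_real (1 / sqrt s) * e j" for j
    have "(cmod (f j))\<^sup>2 = (cmod (e j))\<^sup>2 / s" for j
      using s by (simp add: f_def norm_mult power_divide norm_divide)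
    then have "(\<Sum>j\<in>?J. (cmod (f j))\<^sup>2) = 1"
      using s by (simp add: sum_divide_distrib[symmetric] s_def[symmetric])
    moreover have "(\<Sum>k\<in>?J. ?G j k * f k) = of_real (x i) * f j" if "j \<in> ?J" for j
    proof -
      have "(\<Sum>k\<in>?J. ?G j k * f k) = of_real (1 / sqrt s) * (\<Sum>k\<in>?J. ?G j k * e k)"
        by (simp add: f_def sum_distrib_left mult_ac)
      also have "\<dots> = of_real (x i) * f j" unfolding e[OF that] f_def by (simp add: mult_ac)
      finally show ?thesis .
    qed
    ultimately show ?thesis by blast
  qed
  then have "\<forall>i\<in>?J. \<exists>e. (\<Sum>j\<in>?J. (cmod (e j))\<^sup>2) = 1 \<and>
      (\<forall>j\<in>?J. (\<Sum>k\<in>?J. ?G j k * e k) = of_real (x i) * e j)" ..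
  \<comment> \<open>The eigenvectors depend on \<open>g\<close> only and not on the new row
    \<open>w\<close>; this allows a Gaussian row to be integrated in a fixed basis.\<close>
  from bchoice[OF this] obtain e where e: "\<forall>i\<in>?J. (\<Sum>j\<in>?J. (cmod (e i j))\<^sup>2) = 1 \<and>
      (\<forall>j\<in>?J. (\<Sum>k\<in>?J. ?G j k * e i k) = of_real (x i) * e i j)" ..
  have e1: "(\<Sum>j\<in>?J. (cmod (e i j))\<^sup>2) = 1" if "i \<in> ?J" for i
    using bspec[OF e that] by (rule conjunct1)
  have e2: "(\<Sum>k\<in>?J. ?G j k * e i k) = of_real (x i) * e i j" if "i \<in> ?J" "j \<in> ?J" for i j
    using bspec[OF conjunct2[OF bspec[OF e that(1)]] that(2)] .
  have orth: "(\<Sum>j\<in>?J. e i j * cnj (e k j)) = of_bool (i = k)" if i: "i \<in> ?J" and k: "k \<in> ?J" for i k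
  proof (cases "i = k")
    case True
    have "(\<Sum>j\<in>?J. e k j * cnj (e k j)) = (\<Sum>j\<in>?J. cnj (e k j) * e k j)"
      by (simp add: mult.commute)
    then show ?thesis using True k by (simp only: sum_cnj_mult_self e1) simp
  next
    case False
    \<comment> \<open>Moving the Hermitian matrix from one factor of the scalar product to the other
      gives \<open>x i * S = x k * S\<close>, and the eigenvalues differ.\<close>
    define S where "S = (\<Sum>j\<in>?J. e i j * cnj (e k j))"
    have "of_real (x i) * S = (\<Sum>j\<in>?J. (of_real (x i) * e i j) * cnj (e k j))"
      by (simp add: S_def sum_distrib_left mult_ac)
    also have "\<dots> = (\<Sum>j\<in>?J. (\<Sum>l\<in>?J. ?G j l * e i l) * cnj (e k j))"
      using i by (simp add: e2)
    also have "\<dots> = (\<Sum>j\<in>?J. \<Sum>l\<in>?J. e i l * cnj (?G l j * e k j))"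
      by (simp add: sum_distrib_right sum_distrib_left gram_entry_cnj[symmetric] mult_ac)
    also have "\<dots> = (\<Sum>l\<in>?J. e i l * cnj (\<Sum>j\<in>?J. ?G l j * e k j))"
      by (subst sum.swap) (simp add: sum_distrib_left)
    also have "\<dots> = (\<Sum>l\<in>?J. e i l * cnj (of_real (x k) * e k l))"
      by (intro sum.cong refl) (simp only: e2[OF k])
    also have "\<dots> = of_real (x k) * S"
      by (simp add: S_def sum_distrib_left mult_ac)
    finally show ?thesis using xinj[OF i k False] False by (simp add: S_def)
  qed
  show ?thesis
  proof (rule that)
    show "\<And>i k. i \<in> ?J \<Longrightarrow> k \<in> ?J \<Longrightarrow> (\<Sum>j\<in>?J. e i j * cnj (e k j)) = of_bool (i = k)"
      by (rule orth)
    fix g' w y j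
    assume g': "\<And>i j. i \<in> {1..n} \<Longrightarrow> j \<in> ?J \<Longrightarrow> g' (i, j) = g (i, j)"
      "\<And>j. j \<in> ?J \<Longrightarrow> g' (Suc n, j) = w j"
      and y: "interlaced 1 N (gram_ev n N g) y"
      and c: "\<And>i. i \<in> ?J \<Longrightarrow> (cmod (\<Sum>j\<in>?J. e i j * w j))\<^sup>2 = residue_weight ?J (gram_ev n N g) y i"
      and j: "j \<in> ?J"
    note sm = interlaced_strict_mono[OF y]
    define d where "d i = (\<Sum>j\<in>?J. e i j * w j)" for i
    \<comment> \<open>The coordinates \<open>d i\<close> pair \<open>w\<close> with the eigenvectors
      without conjugation, so it is the conjugate of \<open>w\<close> that expands in the
      eigenbasis, with coefficients \<open>cnj (d i)\<close>.\<close>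
    have wexp: "cnj (w k) = (\<Sum>i\<in>?J. cnj (d i) * e i k)" if k: "k \<in> ?J" for k
    proof -
      have "(\<Sum>i\<in>?J. cnj (d i) * e i k) = (\<Sum>i\<in>?J. \<Sum>j\<in>?J. cnj (w j) * (cnj (e i j) * e i k))"
        by (simp add: d_def sum_distrib_right sum_distrib_left mult_ac)
      also have "\<dots> = (\<Sum>j\<in>?J. cnj (w j) * (\<Sum>i\<in>?J. cnj (e i j) * e i k))"
        by (subst sum.swap) (simp add: sum_distrib_left)
      also have "\<dots> = (\<Sum>j\<in>?J. cnj (w j) * of_bool (j = k))"
        by (intro sum.cong refl) (simp only: orthonormal_rows_imp_columns[of N e, OF orth _ k])
      also have "\<dots> = cnj (w k)" using k by (simp add: of_bool_def if_distrib cong: if_cong)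
      finally show ?thesis by simp
    qed
    have G': "gram_entry (Suc n) g' j k = ?G j k + cnj (w j) * w k" if "j \<in> ?J" "k \<in> ?J" for j k
      using that by (simp add: gram_entry_def g')
    show "gram_ev (Suc n) N g' j = y j"
    proof (rule gram_ev_unique[OF sm(1) _ j])
      fix l assume l: "l \<in> ?J"
      \<comment> \<open>Coordinates of the resolvent of the old matrix at \<open>y l\<close>,
        applied to the conjugate of \<open>w\<close>; the resulting \<open>\<xi>\<close> is the
        eigenvector of the perturbed matrix.\<close>
      define a where "a i = cnj (d i) / of_real (y l - x i)" for i
      have yx: "y l \<noteq> x i" if i: "i \<in> ?J" for i
      proof (cases "l < i")
        case True
        then have "y l < x (Suc l)" using y i l by (auto simp: interlaced_def x_def)
        also have "x (Suc l) \<le> x i"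
          unfolding x_def by (rule strict_mono_on_leD[OF assms]) (use True i in auto)
        finally show ?thesis by simp
      next
        case False
        have "x i \<le> x l" unfolding x_def by (rule strict_mono_on_leD[OF assms]) (use False i l in auto)
        also have "x l < y l" using y l by (auto simp: interlaced_def x_def)
        finally show ?thesis by simp
      qed
      define \<xi> where "\<xi> k = (\<Sum>i\<in>?J. a i * e i k)" for k
      \<comment> \<open>This is the secular equation at the root \<open>y l\<close>: in the product
        form of the partial fraction identity the factor with index \<open>l\<close>
        vanishes.\<close>
      have w\<xi>: "(\<Sum>k\<in>?J. w k * \<xi> k) = 1"
      proof -
        have "(\<Sum>k\<in>?J. w k * \<xi> k) = (\<Sum>k\<in>?J. \<Sum>i\<in>?J. a i * (e i k * w k))"
          by (simp add: \<xi>_def sum_distrib_left mult_ac)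
        also have "\<dots> = (\<Sum>i\<in>?J. a i * d i)"
          by (subst sum.swap) (simp add: d_def sum_distrib_left)
        also have "\<dots> = (\<Sum>i\<in>?J. of_real (residue_weight ?J x y i / (y l - x i)))"
        proof (rule sum.cong[OF refl])
          fix i assume i: "i \<in> ?J"
          have "cnj (d i) * d i = of_real (residue_weight ?J x y i)"
            unfolding x_def c[OF i, symmetric] d_def[symmetric]
            by (simp only: complex_norm_square mult.commute)
          then show "a i * d i = of_real (residue_weight ?J x y i / (y l - x i))"
            by (simp add: a_def)
        qed
        also have "\<dots> = - of_real (\<Sum>i\<in>?J. residue_weight ?J x y i / (x i - y l))"
        proof -
          have "p / (y l - x i) = - (p / (x i - y l))" for i p
            by (metis minus_diff_eq minus_divide_right)
          then show ?thesis by (simp add: sum_negf)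
        qed
        also have "(\<Sum>i\<in>?J. residue_weight ?J x y i / (x i - y l)) = -1"
        proof -
          have "1 + (\<Sum>i\<in>?J. residue_weight ?J x y i / (x i - y l)) = (\<Prod>j\<in>?J. (y j - y l) / (x j - y l))"
          proof (rule residue_weight_partial_fractions)
            show "inj_on x ?J" unfolding x_def by (rule strict_mono_on_imp_inj_on[OF assms])
            show "y l \<notin> x ` ?J" using yx by (metis imageE)
          qed simp
          also have "\<dots> = 0" using l by (intro prod_zero) auto
          finally show ?thesis by simp
        qed
        finally show ?thesis by simp
      qed
      have "\<exists>k\<in>?J. \<xi> k \<noteq> 0"
      proof (rule ccontr)
        assume "\<not> (\<exists>k\<in>?J. \<xi> k \<noteq> 0)"
        then have "(\<Sum>k\<in>?J. w k * \<xi> k) = 0" by (intro sum.neutral) auto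
        with w\<xi> show False by simp
      qed
      then obtain j0 where j0: "j0 \<in> ?J" "\<xi> j0 \<noteq> 0" ..
      have "(\<Sum>k\<in>?J. gram_entry (Suc n) g' j k * \<xi> k) = of_real (y l) * \<xi> j" if j: "j \<in> ?J" for j
      proof -
        have "(\<Sum>k\<in>?J. gram_entry (Suc n) g' j k * \<xi> k) =
            (\<Sum>k\<in>?J. ?G j k * \<xi> k) + cnj (w j) * (\<Sum>k\<in>?J. w k * \<xi> k)"
          using j by (simp add: G' distrib_right distrib_left sum.distrib sum_distrib_left mult_ac)
        also have "(\<Sum>k\<in>?J. ?G j k * \<xi> k) = (\<Sum>k\<in>?J. \<Sum>i\<in>?J. a i * (?G j k * e i k))"
          by (simp add: \<xi>_def sum_distrib_left mult_ac)
        also have "\<dots> = (\<Sum>i\<in>?J. a i * (\<Sum>k\<in>?J. ?G j k * e i k))"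
          by (subst sum.swap) (simp add: sum_distrib_left)
        also have "\<dots> = (\<Sum>i\<in>?J. a i * (of_real (x i) * e i j))"
          by (intro sum.cong refl) (simp only: e2[OF _ j])
        also have "cnj (w j) * (\<Sum>k\<in>?J. w k * \<xi> k) = (\<Sum>i\<in>?J. cnj (d i) * e i j)"
          using w\<xi> wexp[OF j] by simp
        also have "(\<Sum>i\<in>?J. a i * (of_real (x i) * e i j)) + (\<Sum>i\<in>?J. cnj (d i) * e i j) =
            (\<Sum>i\<in>?J. of_real (y l) * (a i * e i j))"
        proof (subst sum.distrib[symmetric], rule sum.cong[OF refl])
          fix i assume i: "i \<in> ?J"
          have "cnj (d i) = a i * of_real (y l - x i)" using yx[OF i] by (simp add: a_def)
          then show "a i * (of_real (x i) * e i j) + cnj (d i) * e i j = of_real (y l) * (a i * e i j)"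
            by (simp only: of_real_diff ring_distribs mult_ac) simp
        qed
        also have "\<dots> = of_real (y l) * \<xi> j" by (simp add: \<xi>_def sum_distrib_left)
        finally show ?thesis .
      qed
      then show "poly (char_poly (gram_mat (Suc n) N g')) (of_real (y l)) = 0"
        by (rule gram_mat_rootI[where e = \<xi>, OF j0])
    qed
  qed
qed

section \<open>The transition density\<close>

text \<open>The trace of the rank one update: it turns the exponential weight in the squared moduli
  into one in \<open>y - x\<close>. The induction step needs the partial fraction identity at the
  new pole \<open>x a\<close>.\<close>

lemma sum_residue_weight:
  fixes x y :: "'i \<Rightarrow> 'a::field"
  assumes "finite J" "inj_on x J"
  shows "(\<Sum>i\<in>J. residue_weight J x y i) = (\<Sum>i\<in>J. y i - x i)"
  using assms
proof (induction J rule: finite_induct)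
  case (insert a J)
  have aJ: "x a \<notin> x ` J" and inj: "inj_on x J" using insert by auto
  have "residue_weight (insert a J) x y i =
      residue_weight J x y i - (y a - x a) * (residue_weight J x y i / (x i - x a))" if i: "i \<in> J" for i
  proof -
    have nz: "x a - x i \<noteq> 0" using aJ i by auto
    have "(y a - x i) / (x a - x i) = 1 + (y a - x a) / (x a - x i)"
      using nz by (simp add: field_simps)
    also have "(y a - x a) / (x a - x i) = - ((y a - x a) / (x i - x a))"
      by (metis minus_diff_eq minus_divide_right)
    finally show ?thesis
      unfolding residue_weight_insert[OF insert.hyps i]
      by (simp only: distrib_left mult_1_right) (simp add: mult.commute)
  qed
  then have "(\<Sum>i\<in>J. residue_weight (insert a J) x y i) =
      (\<Sum>i\<in>J. y i - x i) - (y a - x a) * (\<Sum>i\<in>J. residue_weight J x y i / (x i - x a))"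
    using insert.IH[OF inj] by (simp only: sum_subtractf sum_distrib_left[symmetric] cong: sum.cong)
  also have "(\<Sum>i\<in>J. residue_weight J x y i / (x i - x a)) = (\<Prod>j\<in>J. (y j - x a) / (x j - x a)) - 1"
    using residue_weight_partial_fractions[OF insert.hyps(1) inj aJ, of y] by (simp add: algebra_simps)
  finally show ?case
    using insert.hyps by (simp add: residue_weight_new algebra_simps)
qed simp

text \<open>The roots are found by the intermediate value theorem, one between each two neighbouring
  poles and one above the last. Needed so that almost every Gaussian row corresponds to some
  interlacing \<open>y\<close>.\<close>

lemma residue_weight_surj:
  fixes x u :: "nat \<Rightarrow> real"
  assumes x: "strict_mono_on {1..N} x" and u: "\<And>i. i \<in> {1..N} \<Longrightarrow> 0 < u i"
  obtains y where "interlaced 1 N x y" "\<And>i. i \<in> {1..N} \<Longrightarrow> residue_weight {1..N} x y i = u i"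
proof -
  let ?J = "{1..N}"
  have inj: "inj_on x ?J" by (rule strict_mono_on_imp_inj_on[OF x])
  define P where "P = (\<Prod>i\<in>?J. [:- x i, 1:])"
  define R where "R i = (\<Prod>k\<in>?J - {i}. [:- x k, 1:])" for i
  \<comment> \<open>The numerator of the secular function: \<open>P\<close> times 1 plus the sum of
    all \<open>u i / (x i - z)\<close>.\<close>
  define q where "q = P - (\<Sum>i\<in>?J. Polynomial.smult (u i) (R i))"
  have degP: "degree P = N"
    unfolding P_def by (subst degree_prod_eq_sum_degree) auto
  have lcP: "lead_coeff P = 1"
    unfolding P_def by (simp only: lead_coeff_prod) simp
  have degR: "degree (R i) = N - 1" if "i \<in> ?J" for i
    unfolding R_def using that by (subst degree_prod_eq_sum_degree) auto
  have cs: "coeff (\<Sum>i\<in>?J. Polynomial.smult (u i) (R i)) k = 0" if "N \<le> k" for k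
    unfolding coeff_sum
  proof (intro sum.neutral ballI)
    fix i assume i: "i \<in> ?J"
    then have "degree (R i) < k" using degR[OF i] that by auto
    then show "coeff (Polynomial.smult (u i) (R i)) k = 0" by (simp add: coeff_eq_0)
  qed
  have cq: "coeff q N = 1" using cs[of N] lcP by (simp add: q_def degP)
  have "degree q \<le> N"
  proof (rule degree_le, intro allI impI)
    fix k assume "N < k"
    then show "coeff q k = 0" using cs[of k] degP by (simp add: q_def coeff_eq_0)
  qed
  moreover have "N \<le> degree q" by (rule le_degree) (simp add: cq)
  ultimately have degq: "degree q = N" by simp
  have lcq: "lead_coeff q = 1" by (simp only: degq cq)
  have qx: "poly q (x i) = - (u i * (\<Prod>k\<in>?J - {i}. x i - x k))" if i: "i \<in> ?J" for i
  proof -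
    have P0: "poly P (x i) = 0" unfolding P_def poly_prod by (rule prod_zero) (auto intro!: bexI[OF _ i])
    have R0: "poly (R k) (x i) = 0" if "k \<in> ?J" "k \<noteq> i" for k
      unfolding R_def poly_prod by (rule prod_zero) (use i that in \<open>auto intro!: bexI[of _ i]\<close>)
    have "(\<Sum>k\<in>?J. u k * poly (R k) (x i)) = u i * poly (R i) (x i)"
      by (subst sum.remove[OF _ i]) (auto simp: R0 intro!: sum.neutral)
    then show ?thesis using P0 by (simp add: q_def poly_sum R_def poly_prod)
  qed
  have ex: "\<exists>z. x i < z \<and> (i < N \<longrightarrow> z < x (Suc i)) \<and> poly q z = 0" if i: "i \<in> ?J" for i
  proof (cases "i < N")
    case True
    then have S: "Suc i \<in> ?J" and lt: "x i < x (Suc i)"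
      using i by (auto intro!: strict_mono_onD[OF x])
    define K where "K = ?J - {i, Suc i}"
    have K: "?J - {i} = insert (Suc i) K" "?J - {Suc i} = insert i K" "finite K" "i \<notin> K" "Suc i \<notin> K"
      using i S by (auto simp: K_def)
    have pos: "0 < (\<Prod>k\<in>K. (x i - x k) * (x (Suc i) - x k))"
    proof (rule prod_pos)
      fix k assume k: "k \<in> K"
      show "0 < (x i - x k) * (x (Suc i) - x k)"
      proof (cases "k < i")
        case True
        then have "x k < x i" using k i by (intro strict_mono_onD[OF x]) (auto simp: K_def)
        then show ?thesis using lt by (intro mult_pos_pos) auto
      next
        case False
        then have "x (Suc i) < x k" using k S by (intro strict_mono_onD[OF x]) (auto simp: K_def)
        then show ?thesis using lt by (intro mult_neg_neg) auto
      qed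
    qed
    \<comment> \<open>Factors with poles outside \<open>{i, Suc i}\<close> have equal signs at the
      two neighbours; the remaining two differences are opposite, whence the minus sign.\<close>
    have e: "poly q (x i) * poly q (x (Suc i)) =
      - (u i * u (Suc i) * (x (Suc i) - x i)\<^sup>2 * (\<Prod>k\<in>K. (x i - x k) * (x (Suc i) - x k)))"
      unfolding qx[OF i] qx[OF S] K(1,2) prod.insert[OF K(3,4)] prod.insert[OF K(3,5)] prod.distrib
      by (simp add: power2_eq_square algebra_simps)
    have "0 < u i * u (Suc i) * (x (Suc i) - x i)\<^sup>2 * (\<Prod>k\<in>K. (x i - x k) * (x (Suc i) - x k))"
      using u[OF i] u[OF S] lt pos by (intro mult_pos_pos) auto
    then have "poly q (x i) * poly q (x (Suc i)) < 0" unfolding e by linarith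
    from poly_IVT[OF lt this] show ?thesis by blast
  next
    case False
    \<comment> \<open>At the largest pole \<open>q\<close> is negative, and it is eventually
      positive because it is monic.\<close>
    have "0 < (\<Prod>k\<in>?J - {i}. x i - x k)"
    proof (rule prod_pos)
      fix k assume "k \<in> ?J - {i}"
      then have "x k < x i" using False i by (intro strict_mono_onD[OF x]) auto
      then show "0 < x i - x k" by simp
    qed
    then have neg: "poly q (x i) < 0" unfolding qx[OF i] using u[OF i] by simp
    obtain n where n: "\<And>z. n \<le> z \<Longrightarrow> lead_coeff q \<le> poly q z"
      using poly_pinfty_gt_lc[of q] lcq by auto
    define b where "b = max n (x i + 1)"
    have "0 < poly q b" using n[of b] lcq by (simp add: b_def)
    moreover have "x i < b" by (simp add: b_def)
    ultimately show ?thesis using poly_IVT_pos[of "x i" b q] neg False by blast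
  qed
  from bchoice[OF ballI[OF ex]] obtain y where y: "\<forall>i\<in>?J. x i < y i \<and> (i < N \<longrightarrow> y i < x (Suc i)) \<and> poly q (y i) = 0" ..
  have il: "interlaced 1 N x y" using y by (auto simp: interlaced_def)
  have yroot: "poly q (y i) = 0" if "i \<in> ?J" for i using bspec[OF y that] by simp
  have injy: "inj_on y ?J" by (rule strict_mono_on_imp_inj_on[OF interlaced_strict_mono(1)[OF il]])
  have qy: "q = (\<Prod>i\<in>?J. [:- y i, 1:])"
    by (rule monic_eq_prod_linear_factors[OF lcq _ _ injy yroot]) (simp_all add: degq)
  show ?thesis
  proof (rule that[OF il])
    fix i assume i: "i \<in> ?J"
    have nz: "x i - x k \<noteq> 0" if "k \<in> ?J - {i}" for k
      using inj_onD[OF inj, of i k] i that by auto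
    \<comment> \<open>The two forms of \<open>q\<close>, by weights and by roots, are compared at
      the pole \<open>x i\<close>.\<close>
    have "u i * (\<Prod>k\<in>?J - {i}. x i - x k) = - poly q (x i)" by (simp add: qx[OF i])
    also have "poly q (x i) = (\<Prod>j\<in>?J. x i - y j)" unfolding qy poly_prod by (simp add: algebra_simps)
    also have "\<dots> = (x i - y i) * (\<Prod>j\<in>?J - {i}. x i - y j)" using i by (simp add: prod.remove)
    finally have 1: "u i * (\<Prod>k\<in>?J - {i}. x i - x k) = (y i - x i) * (\<Prod>j\<in>?J - {i}. x i - y j)"
      by (simp add: algebra_simps)
    have "(\<Prod>j\<in>?J - {i}. (y j - x i) / (x j - x i)) = (\<Prod>j\<in>?J - {i}. (x i - y j) / (x i - x j))"
      by (intro prod.cong refl) (metis minus_diff_eq minus_divide_divide)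
    then have "residue_weight ?J x y i = (y i - x i) * (\<Prod>j\<in>?J - {i}. x i - y j) / (\<Prod>j\<in>?J - {i}. x i - x j)"
      by (simp add: residue_weight_def prod_dividef)
    also have "\<dots> = u i"
      unfolding 1[symmetric] using nz by (simp add: prod_zero_iff)
    finally show "residue_weight ?J x y i = u i" .
  qed
qed

section \<open>Power sums of the eigenvalues as traces, and measurability\<close>

definition mat_trace :: "'a::comm_ring_1 mat \<Rightarrow> 'a" where
  "mat_trace A = (\<Sum>i<dim_row A. A $$ (i, i))"

lemma mat_trace_mult_commute:
  assumes "A \<in> carrier_mat n n" "B \<in> carrier_mat n n"
  shows "mat_trace (A * B) = mat_trace (B * A)"
proof -
  have "mat_trace (A * B) = (\<Sum>i<n. \<Sum>j<n. A $$ (i, j) * B $$ (j, i))"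
    using assms by (simp add: mat_trace_def scalar_prod_def lessThan_atLeast0)
  also have "\<dots> = (\<Sum>j<n. \<Sum>i<n. A $$ (i, j) * B $$ (j, i))" by (rule sum.swap)
  also have "\<dots> = mat_trace (B * A)"
    using assms by (simp add: mat_trace_def scalar_prod_def lessThan_atLeast0 mult.commute)
  finally show ?thesis .
qed

lemma upper_triangular_pow:
  fixes A :: "'a::comm_ring_1 mat"
  assumes A: "A \<in> carrier_mat n n" "upper_triangular A"
  shows "upper_triangular (A ^\<^sub>m k) \<and> (\<forall>i<n. (A ^\<^sub>m k) $$ (i, i) = (A $$ (i, i)) ^ k)"
proof (induction k)
  case 0
  then show ?case using A by auto
next
  case (Suc k)
  let ?B = "A ^\<^sub>m k"
  have B: "?B \<in> carrier_mat n n" using A by (rule_tac pow_carrier_mat)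
  have B0: "?B $$ (i, l) = 0" if "l < i" "i < n" for i l using Suc B that by auto
  have A0: "A $$ (i, l) = 0" if "l < i" "i < n" for i l using A that by auto
  have e: "(?B * A) $$ (i, j) = (\<Sum>l<n. ?B $$ (i, l) * A $$ (l, j))" if "i < n" "j < n" for i j
    using that A(1) B by (simp add: scalar_prod_def lessThan_atLeast0)
  have "(?B * A) $$ (i, j) = 0" if "j < i" "i < n" for i j
  proof -
    have "j < n" using that by simp
    show ?thesis unfolding e[OF that(2) \<open>j < n\<close>]
    proof (rule sum.neutral, rule ballI)
      fix l assume "l \<in> {..<n}"
      then show "?B $$ (i, l) * A $$ (l, j) = 0"
        using B0[of l i] A0[of j l] that by (cases "l < i") auto
    qed
  qed
  then have "upper_triangular (?B * A)" using B by (intro upper_triangularI) auto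
  moreover have "(?B * A) $$ (i, i) = (A $$ (i, i)) ^ Suc k" if i: "i < n" for i
  proof -
    have "(\<Sum>l<n. ?B $$ (i, l) * A $$ (l, i)) = (\<Sum>l\<in>{i}. ?B $$ (i, l) * A $$ (l, i))"
    proof (rule sum.mono_neutral_right)
      show "\<forall>l\<in>{..<n} - {i}. ?B $$ (i, l) * A $$ (l, i) = 0"
      proof
        fix l assume l: "l \<in> {..<n} - {i}"
        then show "?B $$ (i, l) * A $$ (l, i) = 0"
          using B0[of l i] A0[of i l] i by (cases "l < i") auto
      qed
    qed (use i in auto)
    then show ?thesis using Suc i by (simp add: e mult.commute)
  qed
  ultimately show ?case by simp
qed

text \<open>Schur triangularisation: the trace is invariant under conjugation, and a power of a
  triangular matrix has the powers of the eigenvalues on its diagonal.\<close>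

lemma mat_trace_pow:
  fixes A :: "complex mat"
  assumes A: "A \<in> carrier_mat n n" and es: "char_poly A = (\<Prod>e\<leftarrow>es. [:- e, 1:])" "length es = n"
  shows "mat_trace (A ^\<^sub>m k) = (\<Sum>e\<leftarrow>es. e ^ k)"
proof -
  obtain B P Q where BPQ: "schur_decomposition A es = (B, P, Q)" by (metis prod_cases3)
  from schur_decomposition[OF A es(1) BPQ] have w: "similar_mat_wit A B P Q"
    and B: "upper_triangular B" and d: "diag_mat B = es" by auto
  from w A have c: "B \<in> carrier_mat n n" "P \<in> carrier_mat n n" "Q \<in> carrier_mat n n" and QP: "Q * P = 1\<^sub>m n"
    unfolding similar_mat_wit_def Let_def by auto
  have Bk: "B ^\<^sub>m k \<in> carrier_mat n n" using c by (rule_tac pow_carrier_mat)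
  have "mat_trace (A ^\<^sub>m k) = mat_trace ((P * B ^\<^sub>m k) * Q)" using similar_mat_wit_pow_id[OF w] by simp
  also have "\<dots> = mat_trace (Q * (P * B ^\<^sub>m k))"
    by (rule mat_trace_mult_commute[of _ n]) (use c Bk in auto)
  also have "Q * (P * B ^\<^sub>m k) = (Q * P) * B ^\<^sub>m k"
    by (rule assoc_mult_mat[OF c(3) c(2) Bk, symmetric])
  also have "\<dots> = B ^\<^sub>m k" unfolding QP by (rule left_mult_one_mat[OF Bk])
  also have "mat_trace (B ^\<^sub>m k) = (\<Sum>i<n. (B $$ (i, i)) ^ k)"
    using upper_triangular_pow[OF c(1) B, of k] Bk c(1) by (simp add: mat_trace_def)
  also have "\<dots> = (\<Sum>i<n. (es ! i) ^ k)"
    using c(1) d by (intro sum.cong refl) (auto simp: diag_mat_def)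
  also have "\<dots> = (\<Sum>e\<leftarrow>es. e ^ k)"
    using es(2) by (simp add: sum_list_sum_nth lessThan_atLeast0)
  finally show ?thesis .
qed

lemma sum_gram_ev_pow:
  "of_real (\<Sum>j\<in>{1..N}. (gram_ev n N g j) ^ k) = mat_trace (gram_mat n N g ^\<^sub>m k)"
proof -
  have "mat_trace (gram_mat n N g ^\<^sub>m k) = (\<Sum>e\<leftarrow>map complex_of_real (gram_evals n N g). e ^ k)"
    by (rule mat_trace_pow[OF gram_mat_carrier]) (simp_all add: char_poly_gram_mat comp_def)
  also have "\<dots> = of_real (\<Sum>i<N. (gram_evals n N g ! i) ^ k)"
    by (simp add: sum_list_sum_nth lessThan_atLeast0)
  also have "(\<Sum>i<N. (gram_evals n N g ! i) ^ k) = (\<Sum>j\<in>{1..N}. (gram_ev n N g j) ^ k)"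
    by (simp add: gram_ev_def sum.atLeast1_atMost_eq One_nat_def)
  finally show ?thesis by simp
qed

lemma gram_ev_nonneg: "j \<in> {1..N} \<Longrightarrow> 0 \<le> gram_ev n N g j"
  using gram_evals_nonneg[OF gram_ev_in_set] .

lemma gram_ev_mono: "i \<le> j \<Longrightarrow> i \<in> {1..N} \<Longrightarrow> j \<in> {1..N} \<Longrightarrow> gram_ev n N g i \<le> gram_ev n N g j"
  unfolding gram_ev_def by (rule sorted_nth_mono[OF sorted_gram_evals]) auto

text \<open>The p-norms of a vector converge to its maximum: the sum of p-th powers lies between
  \<open>x j ^ p\<close> and \<open>j * x j ^ p\<close>, and the p-th root of \<open>j\<close> tends
  to 1.\<close>

lemma LIMSEQ_root_power_sum:
  fixes x :: "nat \<Rightarrow> real"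
  assumes "1 \<le> j" "\<And>i. i \<in> {1..j} \<Longrightarrow> 0 \<le> x i" "\<And>i. i \<in> {1..j} \<Longrightarrow> x i \<le> x j"
  shows "(\<lambda>k. root (Suc k) (\<Sum>i\<in>{1..j}. x i ^ Suc k)) \<longlonglongrightarrow> x j"
proof (rule tendsto_sandwich)
  have j: "j \<in> {1..j}" using assms(1) by simp
  have xj: "0 \<le> x j" using assms(2)[OF j] .
  have "x j \<le> root (Suc k) (\<Sum>i\<in>{1..j}. x i ^ Suc k)" for k
  proof -
    have "x j ^ Suc k \<le> (\<Sum>i\<in>{1..j}. x i ^ Suc k)"
      using assms(2) by (intro member_le_sum[OF j] zero_le_power) auto
    then have "root (Suc k) (x j ^ Suc k) \<le> root (Suc k) (\<Sum>i\<in>{1..j}. x i ^ Suc k)" by simp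
    then show ?thesis using xj by (simp only: real_root_power_cancel zero_less_Suc)
  qed
  then show "\<forall>\<^sub>F k in sequentially. x j \<le> root (Suc k) (\<Sum>i\<in>{1..j}. x i ^ Suc k)" by simp
  have "root (Suc k) (\<Sum>i\<in>{1..j}. x i ^ Suc k) \<le> root (Suc k) (real j) * x j" for k
  proof -
    have "(\<Sum>i\<in>{1..j}. x i ^ Suc k) \<le> (\<Sum>i\<in>{1..j}. x j ^ Suc k)"
      using assms by (intro sum_mono power_mono) auto
    then have "root (Suc k) (\<Sum>i\<in>{1..j}. x i ^ Suc k) \<le> root (Suc k) (real j * x j ^ Suc k)" by simp
    also have "\<dots> = root (Suc k) (real j) * x j"
      using xj by (simp only: real_root_mult real_root_power_cancel zero_less_Suc)
    finally show ?thesis .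
  qed
  then show "\<forall>\<^sub>F k in sequentially. root (Suc k) (\<Sum>i\<in>{1..j}. x i ^ Suc k) \<le> root (Suc k) (real j) * x j" by simp
  have "(\<lambda>k. root (Suc k) (real j)) \<longlonglongrightarrow> 1"
    using LIMSEQ_root_const[of "real j"] assms(1) by (intro LIMSEQ_Suc) auto
  then show "(\<lambda>k. root (Suc k) (real j) * x j) \<longlonglongrightarrow> x j"
    using tendsto_mult_right[of _ 1 _ "x j"] by fastforce
qed simp

text \<open>Power sums of the eigenvalues are traces, hence measurable; the largest eigenvalue is a limit of
  roots of power sums, and the others follow by deflation.\<close>

lemma gram_ev_measurable:
  fixes G :: "'w \<Rightarrow> nat \<times> nat \<Rightarrow> complex"
  assumes G: "\<And>i j. i \<in> {1..n} \<Longrightarrow> j \<in> {1..N} \<Longrightarrow> (\<lambda>\<omega>. G \<omega> (i, j)) \<in> borel_measurable M"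
    and j: "j \<in> {1..N}"
  shows "(\<lambda>\<omega>. gram_ev n N (G \<omega>) j) \<in> borel_measurable M"
proof -
  have gm: "(\<lambda>\<omega>. gram_mat n N (G \<omega>) $$ (i, l)) \<in> borel_measurable M" if "i < N" "l < N" for i l
  proof -
    have [measurable]: "(\<lambda>\<omega>. G \<omega> (p, Suc i)) \<in> borel_measurable M" "(\<lambda>\<omega>. G \<omega> (p, Suc l)) \<in> borel_measurable M"
      if "p \<in> {1..n}" for p using that \<open>i < N\<close> \<open>l < N\<close> by (auto intro: G)
    have [measurable]: "(\<lambda>\<omega>. cnj (G \<omega> (p, Suc i))) \<in> borel_measurable M" if "p \<in> {1..n}" for p
      using that by (intro borel_measurable_continuous_on[where f=cnj] continuous_intros) measurable
    have "(\<lambda>\<omega>. \<Sum>p\<in>{1..n}. cnj (G \<omega> (p, Suc i)) * G \<omega> (p, Suc l)) \<in> borel_measurable M"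
      by measurable
    then show ?thesis using that by (simp add: gram_mat_def gram_entry_def)
  qed
  have pm: "(\<lambda>\<omega>. (gram_mat n N (G \<omega>) ^\<^sub>m k) $$ (i, l)) \<in> borel_measurable M" if "i < N" "l < N" for i l k
    using that
  proof (induction k arbitrary: i l)
    case 0
    then show ?case by (simp add: gram_mat_def)
  next
    case (Suc k)
    have c: "gram_mat n N g ^\<^sub>m k \<in> carrier_mat N N" for g by (rule pow_carrier_mat) simp
    have "(gram_mat n N g ^\<^sub>m Suc k) $$ (i, l) = (\<Sum>p<N. (gram_mat n N g ^\<^sub>m k) $$ (i, p) * gram_mat n N g $$ (p, l))" for g
    proof -
      have "dim_row (gram_mat n N g) = N" "dim_col (gram_mat n N g) = N" by (simp_all add: gram_mat_def)
      then show ?thesis using Suc.prems c[of g] by (simp add: scalar_prod_def lessThan_atLeast0)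
    qed
    moreover have "(\<lambda>\<omega>. \<Sum>p<N. (gram_mat n N (G \<omega>) ^\<^sub>m k) $$ (i, p) * gram_mat n N (G \<omega>) $$ (p, l)) \<in> borel_measurable M"
      using Suc.prems by (intro borel_measurable_sum borel_measurable_times Suc.IH gm) auto
    ultimately show ?case by simp
  qed
  have S: "(\<lambda>\<omega>. \<Sum>i\<in>{1..N}. (gram_ev n N (G \<omega>) i) ^ k) \<in> borel_measurable M" for k
  proof -
    have d: "dim_row (gram_mat n N g ^\<^sub>m k) = N" for g
      by (rule carrier_matD(1)[OF pow_carrier_mat[OF gram_mat_carrier]])
    have "(\<lambda>\<omega>. mat_trace (gram_mat n N (G \<omega>) ^\<^sub>m k)) \<in> borel_measurable M"
      unfolding mat_trace_def d by (intro borel_measurable_sum pm; simp)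
    then have "(\<lambda>\<omega>. Re (mat_trace (gram_mat n N (G \<omega>) ^\<^sub>m k))) \<in> borel_measurable M"
      by (rule borel_measurable_continuous_on[where f=Re, rotated]) (intro continuous_intros)
    then show ?thesis by (simp add: sum_gram_ev_pow[symmetric] del: of_real_sum)
  qed
  show ?thesis using j
  proof (induction "N - j" arbitrary: j rule: less_induct)
    case less
    have lim: "(\<lambda>k. root (Suc k) (\<Sum>i\<in>{1..j}. gram_ev n N g i ^ Suc k)) \<longlonglongrightarrow> gram_ev n N g j" for g
      using less.prems by (intro LIMSEQ_root_power_sum gram_ev_nonneg gram_ev_mono) auto
    have eq: "(\<Sum>i\<in>{1..j}. gram_ev n N g i ^ k) = (\<Sum>i\<in>{1..N}. gram_ev n N g i ^ k) - (\<Sum>i\<in>{j<..N}. gram_ev n N g i ^ k)" for g k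
    proof -
      have J: "{1..N} = {1..j} \<union> {j<..N}" using less.prems by auto
      have "(\<Sum>i\<in>{1..j} \<union> {j<..N}. gram_ev n N g i ^ k) = (\<Sum>i\<in>{1..j}. gram_ev n N g i ^ k) + (\<Sum>i\<in>{j<..N}. gram_ev n N g i ^ k)"
        by (rule sum.union_disjoint) auto
      then show ?thesis unfolding J[symmetric] by simp
    qed
    have "(\<lambda>\<omega>. gram_ev n N (G \<omega>) i) \<in> borel_measurable M" if "i \<in> {j<..N}" for i
      using that less.prems by (intro less.hyps) auto
    then have P: "(\<lambda>\<omega>. \<Sum>i\<in>{1..j}. gram_ev n N (G \<omega>) i ^ k) \<in> borel_measurable M" for k
      unfolding eq by (intro borel_measurable_diff S borel_measurable_sum borel_measurable_power)
    have "(\<lambda>\<omega>. root (Suc k) (\<Sum>i\<in>{1..j}. gram_ev n N (G \<omega>) i ^ Suc k)) \<in> borel_measurable M" for k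
      by (rule borel_measurable_continuous_on[where f="root (Suc k)", OF _ P]) (intro continuous_intros)
    from borel_measurable_LIMSEQ_real[OF lim this] show ?case .
  qed
qed

definition append_row :: "nat \<Rightarrow> (nat \<times> nat \<Rightarrow> 'a) \<Rightarrow> (nat \<Rightarrow> 'a) \<Rightarrow> nat \<times> nat \<Rightarrow> 'a" where
  "append_row n g w = (\<lambda>(i, j). if i = Suc n then w j else g (i, j))"

definition laguerre_kernel :: "nat \<Rightarrow> real \<Rightarrow> (nat \<Rightarrow> real) \<Rightarrow> (nat \<Rightarrow> real) \<Rightarrow> ennreal" where
  "laguerre_kernel N t x y = indicator {y. interlaced 1 N x y} y *
     ennreal (vdm 1 N y / vdm 1 N x * (exp (- (\<Sum>j\<in>{1..N}. y j - x j) / t) / t ^ N))"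

lemma AE_cgauss_nonzero: "AE z in cgauss t. z \<noteq> 0"
  unfolding cgauss_def by (subst AE_density) (auto intro: AE_mp[OF AE_lborel_singleton[of 0]])

lemma cgauss_PiM_sets[measurable_cong]: "sets (PiM J (\<lambda>_. cgauss t)) = sets (PiM J (\<lambda>_. lborel))"
  by (rule sets_PiM_cong) auto

text \<open>The matrix \<open>g\<close> is fixed here and only the row is random, so the unitary map
  \<open>T\<close> is a constant of the integration. Distinct old eigenvalues are what provides
  it.\<close>

lemma nn_integral_append_row:
  fixes F :: "(nat \<Rightarrow> real) \<Rightarrow> ennreal"
  assumes t: "0 < t" and x: "strict_mono_on {1..N} (gram_ev n N g)"
    and F: "F \<in> borel_measurable (PiM {1..N} (\<lambda>_. lborel))"
  shows "(\<integral>\<^sup>+w. F (\<lambda>j\<in>{1..N}. gram_ev (Suc n) N (append_row n g w) j) \<partial>PiM {1..N} (\<lambda>_. cgauss t)) =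
    (\<integral>\<^sup>+y. laguerre_kernel N t (gram_ev n N g) y * F y \<partial>PiM {1..N} (\<lambda>_. lborel))"
proof (rule gram_rank_one_update[OF x])
  let ?J = "{1..N}" and ?x = "gram_ev n N g"
  define L where "L = PiM ?J (\<lambda>_. lborel :: complex measure)"
  define R where "R = PiM ?J (\<lambda>_. lborel :: real measure)"
  fix T :: "nat \<Rightarrow> nat \<Rightarrow> complex"
  assume T1: "\<And>i k. i \<in> ?J \<Longrightarrow> k \<in> ?J \<Longrightarrow> (\<Sum>j\<in>?J. T i j * cnj (T k j)) = of_bool (i = k)"
    and T2: "\<And>g' w y j. (\<And>i j. i \<in> {1..n} \<Longrightarrow> j \<in> ?J \<Longrightarrow> g' (i, j) = g (i, j)) \<Longrightarrow>
       (\<And>j. j \<in> ?J \<Longrightarrow> g' (Suc n, j) = w j) \<Longrightarrow> interlaced 1 N ?x y \<Longrightarrow>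
       (\<And>i. i \<in> ?J \<Longrightarrow> (cmod (\<Sum>j\<in>?J. T i j * w j))\<^sup>2 = residue_weight ?J ?x y i) \<Longrightarrow>
       j \<in> ?J \<Longrightarrow> gram_ev (Suc n) N g' j = y j"
  define ev where "ev w = (\<lambda>j\<in>?J. gram_ev (Suc n) N (append_row n g w) j)" for w
  \<comment> \<open>The inverse of \<open>T\<close>: the row is rewritten as \<open>S c\<close>,
    where \<open>c\<close> are its coordinates in the eigenbasis.\<close>
  define S where "S c = (\<lambda>i\<in>?J. \<Sum>j\<in>?J. cnj (T j i) * c j)" for c
  note T3 = orthonormal_rows_imp_columns[of N T, OF T1]
  have TS: "(\<Sum>j\<in>?J. T i j * S c j) = c i" if i: "i \<in> ?J" for c i
  proof -
    have "(\<Sum>j\<in>?J. T i j * S c j) = (\<Sum>j\<in>?J. \<Sum>k\<in>?J. c k * (T i j * cnj (T k j)))"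
      by (simp add: S_def sum_distrib_left mult_ac)
    also have "\<dots> = (\<Sum>k\<in>?J. c k * (\<Sum>j\<in>?J. T i j * cnj (T k j)))"
      by (subst sum.swap) (simp add: sum_distrib_left)
    also have "\<dots> = (\<Sum>k\<in>?J. c k * of_bool (i = k))"
      by (intro sum.cong refl) (simp only: T1[OF i])
    also have "\<dots> = c i" using i by (simp add: of_bool_def if_distrib cong: if_cong)
    finally show ?thesis .
  qed
  have evS: "ev (S c) = restrict y ?J" if "interlaced 1 N ?x y" "\<And>i. i \<in> ?J \<Longrightarrow> (cmod (c i))\<^sup>2 = residue_weight ?J ?x y i" for c y
    unfolding ev_def
  proof (rule restrict_ext)
    fix j assume j: "j \<in> ?J"
    show "gram_ev (Suc n) N (append_row n g (S c)) j = y j"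
      by (rule T2[of _ "S c" y]) (use that j TS[of _ c] in \<open>auto simp: append_row_def\<close>)
  qed
  have evm: "ev \<in> L \<rightarrow>\<^sub>M R"
    unfolding R_def ev_def
  proof (rule measurable_restrict, simp, rule gram_ev_measurable)
    fix i j assume "i \<in> {1..Suc n}" "j \<in> ?J"
    then show "(\<lambda>w. append_row n g w (i, j)) \<in> borel_measurable L"
      using measurable_component_singleton[of j ?J "\<lambda>_. lborel :: complex measure"]
      by (cases "i = Suc n") (auto simp: append_row_def L_def)
  qed auto
  have cm: "(\<lambda>c. c j) \<in> borel_measurable L" if "j \<in> ?J" for j
    using measurable_component_singleton[OF that, of "\<lambda>_. lborel :: complex measure"] by (simp add: L_def)
  have Sm: "S \<in> L \<rightarrow>\<^sub>M L"
    unfolding S_def by (subst (2) L_def, rule measurable_restrict, simp,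
      intro borel_measurable_sum borel_measurable_times borel_measurable_const cm)
  have F': "F \<in> borel_measurable R" using F by (simp add: R_def)
  \<comment> \<open>By \<open>evS\<close> the new eigenvalues depend on the coordinates through
    their squared moduli only; \<open>H\<close> evaluates at the representative with nonnegative
    real coordinates.\<close>
  define H where "H u = F (ev (S (\<lambda>i\<in>?J. complex_of_real (sqrt (u i)))))" for u
  have sqm: "(\<lambda>u. \<lambda>i\<in>?J. complex_of_real (sqrt (u i))) \<in> R \<rightarrow>\<^sub>M L"
    unfolding L_def R_def by (rule measurable_restrict) measurable
  have Hm: "H \<in> borel_measurable R"
    unfolding H_def using measurable_compose[OF sqm measurable_compose[OF Sm measurable_compose[OF evm F']]] .
  have "(\<integral>\<^sup>+w. F (ev w) \<partial>PiM ?J (\<lambda>_. cgauss t)) = (\<integral>\<^sup>+c. F (ev (S c)) \<partial>PiM ?J (\<lambda>_. cgauss t))"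
    unfolding S_def
  proof (rule nn_integral_PiM_cgauss_unitary[OF t _ _, symmetric])
    show "(\<lambda>w. F (ev w)) \<in> borel_measurable (PiM ?J (\<lambda>_. lborel))"
      using measurable_compose[OF evm F'] by (simp add: L_def)
    show "(\<Sum>j\<in>?J. cnj (T j i) * cnj (cnj (T j k))) = of_bool (i = k)" if "i \<in> ?J" "k \<in> ?J" for i k
      using T3[OF _ _ that] by simp
    show "(\<Sum>j\<in>?J. cnj (cnj (T i j)) * cnj (T k j)) = of_bool (i = k)" if "i \<in> ?J" "k \<in> ?J" for i k
      using T1[OF that] by simp
  qed simp
  also have "\<dots> = (\<integral>\<^sup>+c. H (\<lambda>i\<in>?J. (cmod (c i))\<^sup>2) \<partial>PiM ?J (\<lambda>_. cgauss t))"
  proof (rule nn_integral_cong_AE)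
    \<comment> \<open>The realisation by an interlacing \<open>y\<close> needs all weights positive,
      so rows with a vanishing coordinate are discarded.\<close>
    have "AE c in PiM ?J (\<lambda>_. cgauss t). \<forall>i\<in>?J. c i \<noteq> 0"
      by (intro AE_finite_allI AE_PiM_component prob_space_cgauss t AE_cgauss_nonzero) auto
    then show "AE c in PiM ?J (\<lambda>_. cgauss t). F (ev (S c)) = H (\<lambda>i\<in>?J. (cmod (c i))\<^sup>2)"
    proof (rule AE_mp, intro AE_I2 impI)
      fix c :: "nat \<Rightarrow> complex" assume c: "\<forall>i\<in>?J. c i \<noteq> 0"
      obtain y where y: "interlaced 1 N ?x y" "\<And>i. i \<in> ?J \<Longrightarrow> residue_weight ?J ?x y i = (cmod (c i))\<^sup>2"
        by (rule residue_weight_surj[OF x, of "\<lambda>i. (cmod (c i))\<^sup>2"]) (use c in auto)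
      have "ev (S c) = restrict y ?J" by (rule evS[OF y(1)]) (simp add: y(2))
      moreover have "ev (S (\<lambda>i\<in>?J. complex_of_real (sqrt ((\<lambda>i\<in>?J. (cmod (c i))\<^sup>2) i)))) = restrict y ?J"
        by (rule evS[OF y(1)]) (simp add: y(2))
      ultimately show "F (ev (S c)) = H (\<lambda>i\<in>?J. (cmod (c i))\<^sup>2)" unfolding H_def by simp
    qed
  qed
  also have "\<dots> = (\<integral>\<^sup>+u. (\<Prod>i\<in>?J. ennreal (exp (- u i / t) / t) * indicator {0<..} (u i)) * H u \<partial>R)"
    unfolding R_def by (rule nn_integral_PiM_cgauss_cmod_square[OF t]) (use Hm in \<open>simp_all add: R_def\<close>)
  also have "\<dots> = (\<integral>\<^sup>+u. indicator {u. \<forall>i\<in>?J. 0 < u i} u * (ennreal (exp (- (\<Sum>i\<in>?J. u i) / t) / t ^ N) * H u) \<partial>R)"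
  proof (rule nn_integral_cong)
    fix u :: "nat \<Rightarrow> real"
    have 1: "(\<Prod>i\<in>?J. ennreal (exp (- u i / t) / t)) = ennreal (exp (- (\<Sum>i\<in>?J. u i) / t) / t ^ N)"
      using t by (simp add: prod_ennreal prod_dividef exp_sum[symmetric] sum_negf sum_divide_distrib)
    have 2: "(\<Prod>i\<in>?J. indicator {0<..} (u i)) = (indicator {u. \<forall>i\<in>?J. 0 < u i} u :: ennreal)"
    proof (cases "\<forall>i\<in>?J. 0 < u i")
      case False
      then obtain i where "i \<in> ?J" "\<not> 0 < u i" by blast
      then have "(\<Prod>i\<in>?J. indicator {0<..} (u i)) = (0::ennreal)"
        by (intro prod_zero bexI[of _ i]) (auto simp: indicator_def)
      then show ?thesis using False by simp
    qed (simp add: indicator_def)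
    show "(\<Prod>i\<in>?J. ennreal (exp (- u i / t) / t) * indicator {0<..} (u i)) * H u =
      indicator {u. \<forall>i\<in>?J. 0 < u i} u * (ennreal (exp (- (\<Sum>i\<in>?J. u i) / t) / t ^ N) * H u)"
      unfolding prod.distrib 1 2 by (simp add: mult_ac)
  qed
  also have "\<dots> = (\<integral>\<^sup>+y. indicator {y. interlaced 1 N ?x y} y * (ennreal (vdm 1 N y / vdm 1 N ?x) *
      (ennreal (exp (- (\<Sum>i\<in>?J. (\<lambda>i\<in>?J. residue_weight ?J ?x y i) i) / t) / t ^ N) *
        H (\<lambda>i\<in>?J. residue_weight ?J ?x y i))) \<partial>R)"
    unfolding R_def
  proof (rule nn_integral_residue_weight[OF x])
    have "(\<lambda>u. ennreal (exp (- (\<Sum>i\<in>?J. u i) / t) / t ^ N)) \<in> borel_measurable (PiM ?J (\<lambda>_. lborel))"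
      by measurable
    then show "(\<lambda>u. ennreal (exp (- (\<Sum>i\<in>?J. u i) / t) / t ^ N) * H u) \<in> borel_measurable (PiM ?J (\<lambda>_. lborel))"
      using Hm by (simp add: R_def)
  qed simp
  also have "\<dots> = (\<integral>\<^sup>+y. laguerre_kernel N t ?x y * F y \<partial>R)"
  proof (rule nn_integral_cong)
    fix y assume "y \<in> space R"
    then have ye: "restrict y ?J = y" by (simp add: R_def space_PiM PiE_def extensional_restrict)
    show "indicator {y. interlaced 1 N ?x y} y * (ennreal (vdm 1 N y / vdm 1 N ?x) *
      (ennreal (exp (- (\<Sum>i\<in>?J. (\<lambda>i\<in>?J. residue_weight ?J ?x y i) i) / t) / t ^ N) *
        H (\<lambda>i\<in>?J. residue_weight ?J ?x y i))) = laguerre_kernel N t ?x y * F y"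
    proof (cases "interlaced 1 N ?x y")
      case True
      have "(\<Sum>i\<in>?J. (\<lambda>i\<in>?J. residue_weight ?J ?x y i) i) = (\<Sum>i\<in>?J. residue_weight ?J ?x y i)"
        by (intro sum.cong) auto
      also have "\<dots> = (\<Sum>i\<in>?J. y i - ?x i)"
        by (rule sum_residue_weight) (auto intro: strict_mono_on_imp_inj_on[OF x])
      finally have s: "(\<Sum>i\<in>?J. (\<lambda>i\<in>?J. residue_weight ?J ?x y i) i) = (\<Sum>i\<in>?J. y i - ?x i)" .
      have "ev (S (\<lambda>i\<in>?J. complex_of_real (sqrt ((\<lambda>i\<in>?J. residue_weight ?J ?x y i) i)))) = restrict y ?J"
      proof (rule evS[OF True])
        fix i assume i: "i \<in> ?J"
        then show "(cmod ((\<lambda>i\<in>?J. complex_of_real (sqrt ((\<lambda>i\<in>?J. residue_weight ?J ?x y i) i))) i))\<^sup>2 = residue_weight ?J ?x y i"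
          using residue_weight_interlaced_pos[OF True i] by simp
      qed
      then have h: "H (\<lambda>i\<in>?J. residue_weight ?J ?x y i) = F y" unfolding H_def ye by simp
      have "0 \<le> vdm 1 N y / vdm 1 N ?x"
        using vdm_pos[OF interlaced_strict_mono(1)[OF True]] vdm_pos[OF x] by simp
      moreover have "0 \<le> exp (- (\<Sum>j\<in>?J. y j - ?x j) / t) / t ^ N" using t by simp
      ultimately have "ennreal (vdm 1 N y / vdm 1 N ?x * (exp (- (\<Sum>j\<in>?J. y j - ?x j) / t) / t ^ N)) =
        ennreal (vdm 1 N y / vdm 1 N ?x) * ennreal (exp (- (\<Sum>j\<in>?J. y j - ?x j) / t) / t ^ N)"
        by (rule ennreal_mult)
      then show ?thesis
        unfolding s h laguerre_kernel_def by (simp only: mult.assoc)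
    qed (simp add: laguerre_kernel_def)
  qed
  finally show "(\<integral>\<^sup>+w. F (\<lambda>j\<in>?J. gram_ev (Suc n) N (append_row n g w) j) \<partial>PiM ?J (\<lambda>_. cgauss t)) =
    (\<integral>\<^sup>+y. laguerre_kernel N t ?x y * F y \<partial>PiM ?J (\<lambda>_. lborel))"
    by (simp only: ev_def R_def)
qed

section \<open>Simplicity of the spectrum\<close>

lemma lborel_complex_eq_pair:
  "(lborel :: complex measure) = distr (lborel \<Otimes>\<^sub>M lborel) borel (\<lambda>(a, b). Complex a b)"
proof (rule lborel_eqI)
  have [measurable]: "(\<lambda>(a, b). Complex a b) \<in> borel_measurable (lborel \<Otimes>\<^sub>M lborel)"
    unfolding Complex_eq by measurable
  fix l u :: complex assume lu: "\<And>b. b \<in> Basis \<Longrightarrow> l \<bullet> b \<le> u \<bullet> b"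
  have le: "Re l \<le> Re u" "Im l \<le> Im u"
    using lu[of 1] lu[of \<i>] by (auto simp: Basis_complex_def)
  have "(\<lambda>(a, b). Complex a b) -` box l u = {Re l<..<Re u} \<times> {Im l<..<Im u}"
    by (auto simp: box_def Basis_complex_def)
  then have "emeasure (distr (lborel \<Otimes>\<^sub>M lborel) borel (\<lambda>(a, b). Complex a b)) (box l u) =
      emeasure (lborel \<Otimes>\<^sub>M lborel) ({Re l<..<Re u} \<times> {Im l<..<Im u})"
    by (subst emeasure_distr) (auto simp: space_pair_measure)
  also have "\<dots> = ennreal (Re u - Re l) * ennreal (Im u - Im l)"
    using le by (subst lborel.emeasure_pair_measure_Times) auto
  also have "\<dots> = (\<Prod>b\<in>Basis. (u - l) \<bullet> b)"
    using le by (simp add: Basis_complex_def ennreal_mult)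
  finally show "emeasure (distr (lborel \<Otimes>\<^sub>M lborel) borel (\<lambda>(a, b). Complex a b)) (box l u) = (\<Prod>b\<in>Basis. (u - l) \<bullet> b)" .
qed simp

text \<open>The discriminant involves conjugates of the entries and is not a complex polynomial in
  them. Along a line with real parameter \<open>s\<close>, however, conjugates are polynomial in
  \<open>s\<close> as well.\<close>

definition polynomial_on_lines :: "(('i \<Rightarrow> complex) \<Rightarrow> complex) \<Rightarrow> bool" where
  "polynomial_on_lines f \<longleftrightarrow>
     (\<forall>x q d. \<exists>Q. \<forall>s::real. f (x(q := x q + of_real s * d)) = poly Q (of_real s))"

lemma AE_poly_real_nonzero:
  fixes Q :: "complex poly" and h :: "real \<Rightarrow> complex"
  assumes "\<And>s. h s = poly Q (of_real (s - c))" "h s0 \<noteq> 0"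
  shows "AE s in lborel. h s \<noteq> 0"
proof -
  have Q: "Q \<noteq> 0" using assms by auto
  have "{s. h s = 0} \<subseteq> (\<lambda>z. Re z + c) ` {z. poly Q z = 0}"
  proof
    fix s assume "s \<in> {s. h s = 0}"
    then have "poly Q (of_real (s - c)) = 0" by (simp add: assms(1))
    then show "s \<in> (\<lambda>z. Re z + c) ` {z. poly Q z = 0}"
      by (intro image_eqI[of _ _ "of_real (s - c)"]) auto
  qed
  then have "finite {s. h s = 0}"
    using poly_roots_finite[OF Q] by (meson finite_imageI finite_subset)
  then have "{s. h s = 0} \<in> null_sets lborel" by (rule finite_imp_null_set_lborel)
  then show ?thesis by (rule AE_I') auto
qed

text \<open>The real part is varied first, on the horizontal line through \<open>z0\<close>, then
  the imaginary part above almost every point of that line. On each line a nonzero polynomial has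
  finitely many roots.\<close>

lemma AE_complex_polynomial_nonzero:
  fixes h :: "complex \<Rightarrow> complex"
  assumes h: "Measurable.pred borel (\<lambda>z. h z \<noteq> 0)"
    and pol: "\<And>z d. \<exists>Q. \<forall>s::real. h (z + of_real s * d) = poly Q (of_real s)" and z0: "h z0 \<noteq> 0"
  shows "AE z in cgauss t. h z \<noteq> 0"
proof -
  have [measurable]: "(\<lambda>z. Complex (fst z) (snd z)) \<in> borel_measurable (lborel \<Otimes>\<^sub>M lborel)"
    unfolding Complex_eq by measurable
  have 1: "AE a in lborel. h (Complex a (Im z0)) \<noteq> 0"
  proof -
    obtain Q where Q: "\<forall>s::real. h (z0 + of_real s * 1) = poly Q (of_real s)" using pol by blast
    have "z0 + of_real (a - Re z0) * 1 = Complex a (Im z0)" for a by (simp add: complex_eq_iff)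
    then show ?thesis
      using Q z0 by (intro AE_poly_real_nonzero[where Q=Q and c="Re z0" and ?s0.0="Re z0"]) (metis complex_surj)+
  qed
  have 2: "AE b in lborel. h (Complex a b) \<noteq> 0" if "h (Complex a (Im z0)) \<noteq> 0" for a
  proof -
    obtain Q where Q: "\<forall>s::real. h (Complex a (Im z0) + of_real s * \<i>) = poly Q (of_real s)" using pol by blast
    have "Complex a (Im z0) + of_real (b - Im z0) * \<i> = Complex a b" for b by (simp add: complex_eq_iff)
    then show ?thesis
      using Q that by (intro AE_poly_real_nonzero[where Q=Q and c="Im z0" and ?s0.0="Im z0"]) (metis)+
  qed
  have "AE a in lborel. AE b in lborel. h (Complex a b) \<noteq> 0"
    using 1 2 by (auto elim: AE_mp)
  then have "AE z in lborel \<Otimes>\<^sub>M lborel. h (Complex (fst z) (snd z)) \<noteq> 0"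
    using measurable_compose[OF _ h, of "\<lambda>z. Complex (fst z) (snd z)" "lborel \<Otimes>\<^sub>M lborel"]
    by (intro lborel_pair.AE_pair_measure) (simp_all add: pred_def)
  then have "AE z in lborel. h z \<noteq> 0"
    using h by (subst lborel_complex_eq_pair) (subst AE_distr_iff, simp_all add: case_prod_beta pred_def)
  then show ?thesis unfolding cgauss_def by (subst AE_density) auto
qed

text \<open>Induction on the coordinates: with coordinate \<open>i\<close> frozen at
  \<open>x0 i\<close> the function is nonzero for almost all values of the others, and from there it
  stays nonzero for almost all values of coordinate \<open>i\<close>.\<close>

lemma AE_PiM_cgauss_polynomial_nonzero:
  fixes f :: "('i \<Rightarrow> complex) \<Rightarrow> complex"
  assumes t: "0 < t" and "finite I" "Measurable.pred (PiM I (\<lambda>_. cgauss t)) (\<lambda>x. f x \<noteq> 0)" "polynomial_on_lines f"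
    and "x0 \<in> extensional I" "f x0 \<noteq> 0"
  shows "AE x in PiM I (\<lambda>_. cgauss t). f x \<noteq> 0"
  using assms(2-)
proof (induction I arbitrary: f x0 rule: finite_induct)
  case empty
  then have "x0 = (\<lambda>_. undefined)" by auto
  with empty.prems(4) show ?case by (intro AE_I2) (auto simp: space_PiM)
next
  case (insert i I)
  interpret prob_space "cgauss t" by (rule prob_space_cgauss[OF t])
  interpret product_sigma_finite "\<lambda>_. cgauss t" by standard
  have fm: "Measurable.pred (PiM (insert i I) (\<lambda>_. cgauss t)) (\<lambda>x. f x \<noteq> 0)" by fact
  note pl = insert.prems(2)[unfolded polynomial_on_lines_def, rule_format]
  have upd: "Measurable.pred (PiM I (\<lambda>_. cgauss t)) (\<lambda>x. f (x(i := z)) \<noteq> 0)" for z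
    by (rule measurable_compose[OF _ fm], rule measurable_fun_upd[where J=I]) auto
  have upd2: "Measurable.pred (cgauss t) (\<lambda>z. f (x(i := z)) \<noteq> 0)" if "x \<in> space (PiM I (\<lambda>_. cgauss t))" for x
    by (rule measurable_compose[OF _ fm], rule measurable_fun_upd[where J=I]) (use that in auto)
  have aeI: "AE x in PiM I (\<lambda>_. cgauss t). f (x(i := x0 i)) \<noteq> 0"
  proof (rule insert.IH[of "\<lambda>x. f (x(i := x0 i))" "restrict x0 I"])
    show "polynomial_on_lines (\<lambda>x. f (x(i := x0 i)))"
      unfolding polynomial_on_lines_def
    proof (intro allI)
      fix x :: "'i \<Rightarrow> complex" and q d
      show "\<exists>Q. \<forall>s::real. f ((x(q := x q + of_real s * d))(i := x0 i)) = poly Q (of_real s)"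
      proof (cases "q = i")
        case True
        then show ?thesis by (intro exI[of _ "[:f (x(i := x0 i)):]"]) simp
      next
        case False
        then have "(x(q := x q + of_real s * d))(i := x0 i) = (x(i := x0 i))(q := (x(i := x0 i)) q + of_real s * d)" for s
          by (auto simp: fun_eq_iff)
        then show ?thesis using pl[of "x(i := x0 i)" q d] by simp
      qed
    qed
    have "(restrict x0 I)(i := x0 i) = x0"
      using insert.prems(3) by (auto simp: fun_eq_iff extensional_def)
    then show "f ((restrict x0 I)(i := x0 i)) \<noteq> 0" using insert.prems(4) by simp
    show "restrict x0 I \<in> extensional I" by (rule restrict_extensional)
  qed (rule upd)
  have H: "AE z in cgauss t. f (x(i := z)) \<noteq> 0"
    if "f (x(i := x0 i)) \<noteq> 0" "x \<in> space (PiM I (\<lambda>_. cgauss t))" for x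
  proof (rule AE_complex_polynomial_nonzero[where ?z0.0 = "x0 i"])
    show "Measurable.pred borel (\<lambda>z. f (x(i := z)) \<noteq> 0)"
      using upd2[OF that(2)] by (simp add: pred_def)
    show "\<exists>Q. \<forall>s::real. f (x(i := z + of_real s * d)) = poly Q (of_real s)" for z d
      using pl[of "x(i := z)" i d] by simp
  qed fact
  have "AE x in PiM I (\<lambda>_. cgauss t). (\<integral>\<^sup>+z. indicator {x. f x = 0} (x(i := z)) \<partial>cgauss t) = 0"
  proof (rule AE_mp[OF aeI], intro AE_I2 impI)
    fix x assume x: "x \<in> space (PiM I (\<lambda>_. cgauss t))" "f (x(i := x0 i)) \<noteq> 0"
    have "(\<integral>\<^sup>+z. indicator {x. f x = 0} (x(i := z)) \<partial>cgauss t) = (\<integral>\<^sup>+z. 0 \<partial>cgauss t)"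
      by (rule nn_integral_cong_AE, rule AE_mp[OF H[OF x(2,1)]]) auto
    then show "(\<integral>\<^sup>+z. indicator {x. f x = 0} (x(i := z)) \<partial>cgauss t) = 0" by simp
  qed
  then have "(\<integral>\<^sup>+x. (\<integral>\<^sup>+z. indicator {x. f x = 0} (x(i := z)) \<partial>cgauss t) \<partial>PiM I (\<lambda>_. cgauss t)) = (\<integral>\<^sup>+x. 0 \<partial>PiM I (\<lambda>_. cgauss t))"
    by (rule nn_integral_cong_AE)
  moreover have im: "(\<lambda>x. indicator {x. f x = 0} x :: ennreal) \<in> borel_measurable (PiM (insert i I) (\<lambda>_. cgauss t))"
  proof -
    have "Measurable.pred (PiM (insert i I) (\<lambda>_. cgauss t)) (\<lambda>x. \<not> f x \<noteq> 0)"
      using fm by (rule pred_intros_logic(2))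
    then have "{x \<in> space (PiM (insert i I) (\<lambda>_. cgauss t)). f x = 0} \<in> sets (PiM (insert i I) (\<lambda>_. cgauss t))"
      by (simp add: pred_def)
    then have "(\<lambda>x. indicator {x \<in> space (PiM (insert i I) (\<lambda>_. cgauss t)). f x = 0} x :: ennreal) \<in> borel_measurable (PiM (insert i I) (\<lambda>_. cgauss t))"
      by (rule borel_measurable_indicator)
    then show ?thesis by (rule measurable_cong[THEN iffD1, rotated]) (auto simp: indicator_def)
  qed
  ultimately have "(\<integral>\<^sup>+x. indicator {x. f x = 0} x \<partial>PiM (insert i I) (\<lambda>_. cgauss t)) = (0::ennreal)"
    using product_nn_integral_insert[OF insert.hyps im] by simp
  then have "AE x in PiM (insert i I) (\<lambda>_. cgauss t). indicator {x. f x = 0} x = (0::ennreal)"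
    using nn_integral_0_iff_AE[OF im] by simp
  then show ?case by eventually_elim (auto simp: indicator_def split: if_splits)
qed

text \<open>A vanishing resultant means a nonconstant common factor of \<open>p\<close> and its
  derivative, which over the complex numbers has a root, that is, a multiple root of
  \<open>p\<close>.\<close>

lemma resultant_pderiv_eq_0_iff:
  fixes p :: "complex poly"
  assumes "p \<noteq> 0"
  shows "resultant p (pderiv p) = 0 \<longleftrightarrow> \<not> rsquarefree p"
proof -
  have g: "gcd p (pderiv p) \<noteq> 0" using assms by simp
  have "resultant p (pderiv p) = 0 \<longleftrightarrow> degree (gcd p (pderiv p)) \<noteq> 0" by (rule resultant_0_gcd)
  also have "\<dots> \<longleftrightarrow> (\<exists>a. poly (gcd p (pderiv p)) a = 0)"
  proof
    assume "degree (gcd p (pderiv p)) \<noteq> 0"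
    then show "\<exists>a. poly (gcd p (pderiv p)) a = 0"
      by (intro fundamental_theorem_of_algebra) (simp add: constant_degree)
  next
    assume "\<exists>a. poly (gcd p (pderiv p)) a = 0"
    then show "degree (gcd p (pderiv p)) \<noteq> 0" using g by (metis degree_eq_zeroE mult_zero_right pCons_0_0 poly_const_conv)
  qed
  also have "\<dots> \<longleftrightarrow> (\<exists>a. poly p a = 0 \<and> poly (pderiv p) a = 0)"
    by (simp add: poly_eq_0_iff_dvd)
  finally show ?thesis by (simp add: rsquarefree_roots)
qed

lemma map_poly_poly_pderiv:
  fixes p :: "complex poly poly"
  shows "map_poly (\<lambda>p. poly p s) (pderiv p) = pderiv (map_poly (\<lambda>p. poly p s) p)"
  by (rule poly_eqI) (simp add: coeff_map_poly coeff_pderiv)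

text \<open>The first factor detects multiple eigenvalues, the second the eigenvalue 0. They are
  multiplied so that a single nonvanishing argument excludes both.\<close>

definition gram_disc :: "nat \<Rightarrow> nat \<Rightarrow> (nat \<times> nat \<Rightarrow> complex) \<Rightarrow> complex" where
  "gram_disc n N g = resultant (char_poly (gram_mat n N g)) (pderiv (char_poly (gram_mat n N g))) *
     poly (char_poly (gram_mat n N g)) 0"

lemma gram_disc_nonzero_iff:
  "gram_disc n N g \<noteq> 0 \<longleftrightarrow> strict_mono_on {1..N} (gram_ev n N g) \<and> (\<forall>j\<in>{1..N}. 0 < gram_ev n N g j)"
proof -
  let ?p = "char_poly (gram_mat n N g)" and ?L = "gram_evals n N g"
  have p0: "?p \<noteq> 0" using gram_mat_monic[of n N g] by auto
  have "rsquarefree ?p \<longleftrightarrow> (\<forall>a. count (proots ?p) a \<le> 1)"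
    using p0 by (auto simp: rsquarefree_def le_Suc_eq One_nat_def)
  also have "\<dots> \<longleftrightarrow> distinct (map complex_of_real ?L)"
  proof -
    have "(\<forall>a. count (mset xs) a \<le> 1) \<longleftrightarrow> distinct xs" for xs :: "complex list"
      unfolding distinct_count_atmost_1
    proof (intro iffI allI)
      fix a assume *: "\<forall>a. count (mset xs) a \<le> 1"
      show "count (mset xs) a = (if a \<in> set xs then 1 else 0)"
      proof (cases "a \<in> set xs")
        case True
        then have "count (mset xs) a \<noteq> 0" by (simp add: count_eq_zero_iff)
        then have "count (mset xs) a = 1" using spec[OF *, of a] by linarith
        then show ?thesis using True by simp
      qed (simp add: count_eq_zero_iff)
    qed simp
    then show ?thesis unfolding proots_gram_mat mset_map[symmetric] .
  qed
  also have "\<dots> \<longleftrightarrow> distinct ?L" by (simp add: distinct_map inj_on_def)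
  also have "\<dots> \<longleftrightarrow> sorted_wrt (<) ?L" using sorted_gram_evals[of n N g] by (simp add: strict_sorted_iff)
  also have "\<dots> \<longleftrightarrow> strict_mono_on {1..N} (gram_ev n N g)" (is "?A \<longleftrightarrow> ?B")
  proof
    assume ?A
    show ?B
    proof (rule strict_mono_onI)
      fix i j assume "i \<in> {1..N}" "j \<in> {1..N}" "i < j"
      then show "gram_ev n N g i < gram_ev n N g j"
        unfolding gram_ev_def by (intro sorted_wrt_nth_less[OF \<open>?A\<close>]) auto
    qed
  next
    assume ?B
    show ?A
      unfolding sorted_wrt_iff_nth_less
    proof (intro allI impI)
      fix i j assume "i < j" "j < length ?L"
      then show "?L ! i < ?L ! j"
        using strict_mono_onD[OF \<open>?B\<close>, of "Suc i" "Suc j"] by (simp add: gram_ev_def)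
    qed
  qed
  finally have 1: "resultant ?p (pderiv ?p) \<noteq> 0 \<longleftrightarrow> strict_mono_on {1..N} (gram_ev n N g)"
    by (simp add: resultant_pderiv_eq_0_iff[OF p0])
  have "poly ?p 0 \<noteq> 0 \<longleftrightarrow> 0 \<notin> set ?L"
    unfolding char_poly_gram_mat by (auto simp: poly_prod_list prod_list_zero_iff)
  also have "\<dots> \<longleftrightarrow> (\<forall>l\<in>set ?L. 0 < l)"
  proof
    assume *: "0 \<notin> set ?L"
    show "\<forall>l\<in>set ?L. 0 < l"
    proof
      fix l assume l: "l \<in> set ?L"
      then have "l \<noteq> 0" using * by auto
      then show "0 < l" using gram_evals_nonneg[OF l] by simp
    qed
  qed auto
  also have "\<dots> \<longleftrightarrow> (\<forall>j\<in>{1..N}. 0 < gram_ev n N g j)"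
  proof
    assume *: "\<forall>j\<in>{1..N}. 0 < gram_ev n N g j"
    show "\<forall>l\<in>set ?L. 0 < l"
    proof
      fix l assume "l \<in> set ?L"
      then obtain i where "i < N" "l = ?L ! i" by (auto simp: in_set_conv_nth)
      then show "0 < l" using bspec[OF *, of "Suc i"] by (simp add: gram_ev_def)
    qed
  qed (use gram_ev_in_set in blast)
  finally show ?thesis using 1 by (simp add: gram_disc_def)
qed

text \<open>Along a line the Gram matrix is the evaluation at \<open>s\<close> of a matrix
  \<open>A\<close> with polynomial entries, and both factors of the discriminant commute with this
  evaluation.\<close>

lemma polynomial_on_lines_gram_disc: "polynomial_on_lines (gram_disc n N)"
  unfolding polynomial_on_lines_def
proof (intro allI)
  fix g :: "nat \<times> nat \<Rightarrow> complex" and q d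
  define E where "E p = [:g p, if p = q then d else 0:]" for p
  define C where "C p = [:cnj (g p), if p = q then cnj d else 0:]" for p
  define A where "A = Matrix.mat N N (\<lambda>(j, k). \<Sum>i\<in>{1..n}. C (i, Suc j) * E (i, Suc k))"
  have A: "A \<in> carrier_mat N N" by (simp add: A_def)
  show "\<exists>Q. \<forall>s::real. gram_disc n N (g(q := g q + of_real s * d)) = poly Q (of_real s)"
  proof (intro exI allI)
    fix s :: real
    let ?s = "complex_of_real s" and ?g = "g(q := g q + of_real s * d)"
    have EC: "poly (E p) ?s = ?g p" "poly (C p) ?s = cnj (?g p)" for p
      by (simp_all add: E_def C_def)
    have "gram_mat n N ?g = map_mat (\<lambda>p. poly p ?s) A"
      by (rule eq_matI) (simp_all add: gram_mat_def gram_entry_def A_def poly_sum EC del: fun_upd_apply)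
    then have cp: "char_poly (gram_mat n N ?g) = map_poly (\<lambda>p. poly p ?s) (char_poly A)"
      by (simp add: poly_hom.char_poly_hom[OF A])
    \<comment> \<open>Resultants commute with evaluation when no degree drops; characteristic
      polynomials are monic, so none does.\<close>
    have d1: "degree (map_poly (\<lambda>p. poly p ?s) (char_poly A)) = degree (char_poly A)"
      using degree_monic_char_poly[OF A] gram_mat_degree[of n N ?g] by (simp add: cp)
    have d2: "degree (map_poly (\<lambda>p. poly p ?s) (pderiv (char_poly A))) = degree (pderiv (char_poly A))"
      by (simp add: map_poly_poly_pderiv degree_pderiv d1)
    have "resultant (char_poly (gram_mat n N ?g)) (pderiv (char_poly (gram_mat n N ?g))) =
        poly (resultant (char_poly A) (pderiv (char_poly A))) ?s"
      unfolding cp map_poly_poly_pderiv[symmetric] by (rule poly_hom.resultant_map_poly[OF d1 d2])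
    moreover have "poly (char_poly (gram_mat n N ?g)) 0 = poly (coeff (char_poly A) 0) ?s"
      unfolding cp by (simp add: poly_0_coeff_0 coeff_map_poly)
    ultimately show "gram_disc n N ?g = poly (resultant (char_poly A) (pderiv (char_poly A)) * coeff (char_poly A) 0) ?s"
      by (simp add: gram_disc_def)
  qed
qed

text \<open>A witness at which \<open>gram_disc\<close> does not vanish: entries
  \<open>sqrt j\<close> on the diagonal give the eigenvalues 1 to \<open>N\<close>. The condition
  \<open>N \<le> n\<close> leaves room for the full diagonal.\<close>

lemma gram_ev_diagonal:
  assumes "N \<le> n" "j \<in> {1..N}"
  shows "gram_ev n N (\<lambda>p\<in>{1..n} \<times> {1..N}. if fst p = snd p then of_real (sqrt (fst p)) else 0) j = real j"
proof (rule gram_ev_unique[where y = real, OF _ _ assms(2)])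
  show "strict_mono_on {1..N} real" by (auto simp: strict_mono_on_def)
  let ?g = "\<lambda>p\<in>{1..n} \<times> {1..N}. if fst p = snd p then complex_of_real (sqrt (fst p)) else 0"
  have G: "gram_entry n ?g j k = of_bool (j = k) * of_nat j" if jk: "j \<in> {1..N}" "k \<in> {1..N}" for j k
  proof -
    have "gram_entry n ?g j k = (\<Sum>i\<in>{j}. cnj (?g (i, j)) * ?g (i, k))"
      unfolding gram_entry_def using jk assms(1) by (intro sum.mono_neutral_right) auto
    also have "\<dots> = of_bool (j = k) * of_nat j"
    proof -
      have g: "?g (j, j) = of_real (sqrt j)" "?g (j, k) = (if j = k then of_real (sqrt j) else 0)"
        using jk assms(1) by auto
      have "complex_of_real (sqrt j) * of_real (sqrt j) = of_real (sqrt j * sqrt j)"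
        by (rule of_real_mult[symmetric])
      also have "\<dots> = of_nat j" by simp
      finally have sq: "complex_of_real (sqrt j) * of_real (sqrt j) = of_nat j" .
      have "(\<Sum>i\<in>{j}. cnj (?g (i, j)) * ?g (i, k)) = cnj (?g (j, j)) * ?g (j, k)"
        by (subst sum.insert) (simp_all only: finite.emptyI empty_iff not_False_eq_True sum.empty add_0_right)
      also have "\<dots> = of_bool (j = k) * of_nat j"
        unfolding g by (cases "j = k") (use sq in simp_all)
      finally show ?thesis .
    qed
    finally show ?thesis .
  qed
  fix l assume l: "l \<in> {1..N}"
  show "poly (char_poly (gram_mat n N ?g)) (of_real (real l)) = 0"
  proof (rule gram_mat_rootI[where e = "\<lambda>j. of_bool (j = l)" and ?j0.0 = l])
    fix j assume j: "j \<in> {1..N}"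
    have "(\<Sum>k\<in>{1..N}. gram_entry n ?g j k * of_bool (k = l)) = (\<Sum>k\<in>{1..N}. if k = l then gram_entry n ?g j k else 0)"
      by (intro sum.cong) auto
    also have "\<dots> = gram_entry n ?g j l" using l by simp
    finally have e: "(\<Sum>k\<in>{1..N}. gram_entry n ?g j k * of_bool (k = l)) = gram_entry n ?g j l" .
    show "(\<Sum>k\<in>{1..N}. gram_entry n ?g j k * of_bool (k = l)) = of_real (real l) * of_bool (j = l)"
      unfolding e G[OF j l] by (cases "j = l") simp_all
  qed (use l in auto)
qed

lemma AE_gram_ev_simple:
  assumes t: "0 < t" and n: "N \<le> n"
  shows "AE g in PiM ({1..n} \<times> {1..N}) (\<lambda>_. cgauss t).
    strict_mono_on {1..N} (gram_ev n N g) \<and> (\<forall>j\<in>{1..N}. 0 < gram_ev n N g j)"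
proof -
  let ?I = "{1..n} \<times> {1..N}"
  have "AE g in PiM ?I (\<lambda>_. cgauss t). gram_disc n N g \<noteq> 0"
  proof (rule AE_PiM_cgauss_polynomial_nonzero[OF t])
    show "polynomial_on_lines (gram_disc n N)" by (rule polynomial_on_lines_gram_disc)
    let ?g = "\<lambda>p\<in>?I. if fst p = snd p then complex_of_real (sqrt (fst p)) else 0"
    show "?g \<in> extensional ?I" by simp
    have D: "gram_ev n N ?g j = real j" if "1 \<le> j" "j \<le> N" for j
      by (rule gram_ev_diagonal[OF n]) (use that in simp)
    have "strict_mono_on {1..N} (gram_ev n N ?g)"
      by (rule strict_mono_onI) (simp only: D atLeastAtMost_iff of_nat_less_iff)
    moreover have "\<forall>j\<in>{1..N}. 0 < gram_ev n N ?g j"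
    proof
      fix j assume j: "j \<in> {1..N}"
      then have "0 < real j" by simp
      then show "0 < gram_ev n N ?g j" by (simp only: gram_ev_diagonal[OF n j])
    qed
    ultimately show "gram_disc n N ?g \<noteq> 0"
      unfolding gram_disc_nonzero_iff ..
    have [measurable]: "(\<lambda>g. gram_ev n N g j) \<in> borel_measurable (PiM ?I (\<lambda>_. cgauss t))" if "j \<in> {1..N}" for j
    proof (rule gram_ev_measurable[OF _ that])
      fix i j assume "i \<in> {1..n}" "j \<in> {1..N}"
      then show "(\<lambda>g. g (i, j)) \<in> borel_measurable (PiM ?I (\<lambda>_. cgauss t))"
        using measurable_component_singleton[of "(i, j)" ?I "\<lambda>_. cgauss t"] by simp
    qed
    have "strict_mono_on {1..N} x \<longleftrightarrow> (\<forall>i\<in>{1..N}. \<forall>j\<in>{1..N}. i < j \<longrightarrow> x i < x j)" for x :: "nat \<Rightarrow> real"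
      by (auto simp: strict_mono_on_def)
    then show "Measurable.pred (PiM ?I (\<lambda>_. cgauss t)) (\<lambda>g. gram_disc n N g \<noteq> 0)"
      unfolding gram_disc_nonzero_iff by simp measurable
  qed simp
  then show ?thesis unfolding gram_disc_nonzero_iff .
qed

section \<open>The joint law of the levels\<close>

lemma gram_ev_cong:
  assumes "\<And>i j. i \<in> {1..n} \<Longrightarrow> j \<in> {1..N} \<Longrightarrow> g (i, j) = g' (i, j)"
  shows "gram_ev n N g = gram_ev n N g'"
proof -
  have "gram_mat n N g = gram_mat n N g'"
    by (rule eq_matI) (auto simp: gram_mat_def gram_entry_def assms intro!: sum.cong)
  then show ?thesis by (simp add: gram_ev_def[abs_def] gram_evals_def)
qed

section \<open>One-time laws of real and complex Brownian motion\<close>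

lemma standard_brownian_motion_density:
  assumes "prob_space M" "standard_brownian_motion M b" "0 < t"
  shows "b t \<in> borel_measurable M" "distr M borel (b t) = density lborel (\<lambda>x. ennreal (normal_density 0 (sqrt t) x))"
proof -
  note b = assms(2)[unfolded standard_brownian_motion_def]
  have m[measurable]: "b t \<in> borel_measurable M" "b 0 \<in> borel_measurable M" using b assms(3) by auto
  then show "b t \<in> borel_measurable M" by simp
  have "distributed M lborel (\<lambda>\<omega>. b t \<omega> - b 0 \<omega>) (normal_density 0 (sqrt (t - 0)))"
    using b assms(3) by blast
  then have "distr M lborel (\<lambda>\<omega>. b t \<omega> - b 0 \<omega>) = density lborel (\<lambda>x. ennreal (normal_density 0 (sqrt t) x))"
    by (simp add: distributed_def)
  \<comment> \<open>The density is given for the increment from time 0; the starting value is 0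
    almost surely only.\<close>
  moreover have "distr M borel (b t) = distr M lborel (\<lambda>\<omega>. b t \<omega> - b 0 \<omega>)"
  proof (rule distr_cong_AE)
    have "AE \<omega> in M. b 0 \<omega> = 0" using b by blast
    then show "AE \<omega> in M. b t \<omega> = b t \<omega> - b 0 \<omega>" by eventually_elim simp
  qed simp_all
  ultimately show "distr M borel (b t) = density lborel (\<lambda>x. ennreal (normal_density 0 (sqrt t) x))" by simp
qed

lemma path_of_at: "0 \<le> t \<Longrightarrow> path_of b \<omega> t = b t \<omega>"
  by (simp add: path_of_def)

lemma complex_brownian_motion_cgauss:
  assumes "prob_space M" "complex_brownian_motion M B" "0 < t"
  shows "B t \<in> borel_measurable M" "distr M borel (B t) = cgauss t"
proof -
  interpret prob_space M by fact
  obtain b b' where b: "standard_brownian_motion M b" "standard_brownian_motion M b'"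
    and ind: "indep_var path_space (path_of b) path_space (path_of b')"
    and B: "\<And>\<omega>. \<omega> \<in> space M \<Longrightarrow> B t \<omega> = of_real (1 / sqrt 2 * b t \<omega>) + \<i> * of_real (1 / sqrt 2 * b' t \<omega>)"
    using assms(2,3) unfolding complex_brownian_motion_def by (metis less_imp_le)
  note d = standard_brownian_motion_density[OF assms(1) b(1) assms(3)]
    standard_brownian_motion_density[OF assms(1) b(2) assms(3)]
  note [measurable] = d(1,3)
  have B': "B t \<omega> = Complex (b t \<omega> / sqrt 2) (b' t \<omega> / sqrt 2)" if "\<omega> \<in> space M" for \<omega>
    using B[OF that] by (simp add: complex_eq_iff)
  have "(\<lambda>\<omega>. Complex (b t \<omega> / sqrt 2) (b' t \<omega> / sqrt 2)) \<in> borel_measurable M"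
    unfolding Complex_eq by measurable
  then show Bm[measurable]: "B t \<in> borel_measurable M"
    by (rule measurable_cong[THEN iffD2, rotated]) (rule B')
  have ev: "(\<lambda>p. p t) \<in> path_space \<rightarrow>\<^sub>M (borel :: real measure)"
    using assms(3) by (intro measurable_component_singleton) auto
  have "indep_var borel (\<lambda>\<omega>. b t \<omega>) borel (\<lambda>\<omega>. b' t \<omega>)"
    using indep_var_compose[OF ind ev ev] assms(3) by (simp add: comp_def path_of_at)
  then have pair: "distr M (borel \<Otimes>\<^sub>M borel) (\<lambda>\<omega>. (b t \<omega>, b' t \<omega>)) = distr M borel (b t) \<Otimes>\<^sub>M distr M borel (b' t)"
    unfolding indep_var_distribution_eq by simp
  let ?n = "\<lambda>x. ennreal (normal_density 0 (sqrt t) x)"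
  have sf: "sigma_finite_measure (density lborel ?n)"
    using prob_space_imp_sigma_finite[OF prob_space_normal_density[of "sqrt t" 0]] assms(3) by simp
  show "distr M borel (B t) = cgauss t"
  proof (rule measure_eqI)
    fix A assume "A \<in> sets (distr M borel (B t))"
    then have A[measurable]: "A \<in> sets borel" by simp
    define f where "f z = (indicator A z :: ennreal)" for z
    have f[measurable]: "f \<in> borel_measurable borel" unfolding f_def by measurable
    have Cm[measurable]: "(\<lambda>z. Complex (fst z) (snd z)) \<in> borel_measurable (borel \<Otimes>\<^sub>M borel)"
      unfolding Complex_eq by measurable
    have Cm'[measurable]: "(\<lambda>z. Complex (g z) (h z)) \<in> borel_measurable K"
      if [measurable]: "g \<in> borel_measurable K" "h \<in> borel_measurable K" for g h and K :: "'z measure"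
      unfolding Complex_eq by measurable
    have "emeasure (distr M borel (B t)) A = (\<integral>\<^sup>+z. f z \<partial>distr M borel (B t))"
      by (simp add: f_def)
    also have "\<dots> = (\<integral>\<^sup>+\<omega>. f (Complex (b t \<omega> / sqrt 2) (b' t \<omega> / sqrt 2)) \<partial>M)"
      by (subst nn_integral_distr) (auto simp: B' intro!: nn_integral_cong)
    also have "\<dots> = (\<integral>\<^sup>+z. f (Complex (fst z / sqrt 2) (snd z / sqrt 2)) \<partial>distr M (borel \<Otimes>\<^sub>M borel) (\<lambda>\<omega>. (b t \<omega>, b' t \<omega>)))"
      by (subst nn_integral_distr) auto
    also have "\<dots> = (\<integral>\<^sup>+z. f (Complex (fst z / sqrt 2) (snd z / sqrt 2)) \<partial>density (lborel \<Otimes>\<^sub>M lborel) (\<lambda>(x, y). ?n x * ?n y))"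
      unfolding pair d(2,4) by (subst pair_measure_density) (auto intro: sf sigma_finite_lborel)
    also have "\<dots> = (\<integral>\<^sup>+z. ?n (fst z) * ?n (snd z) * f (Complex (fst z / sqrt 2) (snd z / sqrt 2)) \<partial>(lborel \<Otimes>\<^sub>M lborel))"
      by (subst nn_integral_density) (auto simp: case_prod_beta)
    also have "\<dots> = (\<integral>\<^sup>+x. \<integral>\<^sup>+y. ?n x * ?n y * f (Complex (x / sqrt 2) (y / sqrt 2)) \<partial>lborel \<partial>lborel)"
      by (subst lborel.nn_integral_fst[symmetric]) auto
    \<comment> \<open>Both coordinates are rescaled by \<open>sqrt 2\<close>. The two factors
      \<open>sqrt 2\<close> turn the normalisation \<open>2 * pi * t\<close> of the pair of normal
      densities into \<open>pi * t\<close>.\<close>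
    also have "\<dots> = (\<integral>\<^sup>+x. ennreal (sqrt 2) * (\<integral>\<^sup>+y. ?n x * ?n (sqrt 2 * y) * f (Complex (x / sqrt 2) y) \<partial>lborel) \<partial>lborel)"
      by (intro nn_integral_cong, subst nn_integral_real_affine[where c="sqrt 2" and t=0]) auto
    also have "\<dots> = ennreal (sqrt 2) * (\<integral>\<^sup>+x. ennreal (sqrt 2) * (\<integral>\<^sup>+y. ?n (sqrt 2 * x) * ?n (sqrt 2 * y) * f (Complex x y) \<partial>lborel) \<partial>lborel)"
      by (subst nn_integral_real_affine[where c="sqrt 2" and t=0]) auto
    also have "\<dots> = (\<integral>\<^sup>+x. \<integral>\<^sup>+y. ennreal (sqrt 2) * (ennreal (sqrt 2) * (?n (sqrt 2 * x) * ?n (sqrt 2 * y) * f (Complex x y))) \<partial>lborel \<partial>lborel)"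
      by (subst nn_integral_cmult[symmetric], measurable) (intro nn_integral_cong, subst nn_integral_cmult[symmetric], auto simp: nn_integral_cmult)
    also have "\<dots> = (\<integral>\<^sup>+x. \<integral>\<^sup>+y. ennreal (cgauss_density t (Complex x y)) * f (Complex x y) \<partial>lborel \<partial>lborel)"
    proof (intro nn_integral_cong)
      fix x y :: real
      have n: "normal_density 0 (sqrt t) (sqrt 2 * x) = exp (- x\<^sup>2 / t) / sqrt (2 * pi * t)" for x
        using assms(3) by (simp add: normal_density_def power_mult_distrib)
      have "sqrt 2 * (sqrt 2 * (normal_density 0 (sqrt t) (sqrt 2 * x) * normal_density 0 (sqrt t) (sqrt 2 * y))) =
          (sqrt 2 * sqrt 2) * (exp (- x\<^sup>2 / t) * exp (- y\<^sup>2 / t)) / (sqrt (2 * pi * t) * sqrt (2 * pi * t))"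
        unfolding n by simp
      also have "\<dots> = exp (- x\<^sup>2 / t + - y\<^sup>2 / t) / (pi * t)"
        using assms(3) by (simp add: exp_add[symmetric])
      also have "- x\<^sup>2 / t + - y\<^sup>2 / t = - (cmod (Complex x y))\<^sup>2 / t"
        by (simp add: cmod_power2 diff_divide_distrib)
      finally have "ennreal (sqrt 2) * (ennreal (sqrt 2) * (?n (sqrt 2 * x) * ?n (sqrt 2 * y))) = ennreal (cgauss_density t (Complex x y))"
        by (simp add: cgauss_density_def ennreal_mult[symmetric])
      then show "ennreal (sqrt 2) * (ennreal (sqrt 2) * (?n (sqrt 2 * x) * ?n (sqrt 2 * y) * f (Complex x y))) =
          ennreal (cgauss_density t (Complex x y)) * f (Complex x y)"
        by (metis (no_types, lifting) mult.assoc)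
    qed
    also have "\<dots> = (\<integral>\<^sup>+z. ennreal (cgauss_density t (Complex (fst z) (snd z))) * f (Complex (fst z) (snd z)) \<partial>(lborel \<Otimes>\<^sub>M lborel))"
      by (subst lborel.nn_integral_fst[symmetric]) auto
    also have "\<dots> = (\<integral>\<^sup>+z. ennreal (cgauss_density t z) * f z \<partial>distr (lborel \<Otimes>\<^sub>M lborel) borel (\<lambda>(a, b). Complex a b))"
      by (subst nn_integral_distr) (auto simp: case_prod_beta)
    also have "\<dots> = (\<integral>\<^sup>+z. ennreal (cgauss_density t z) * f z \<partial>lborel)"
      by (simp only: lborel_complex_eq_pair[symmetric])
    also have "\<dots> = emeasure (cgauss t) A"
      unfolding cgauss_def f_def by (subst emeasure_density) auto
    finally show "emeasure (distr M borel (B t)) A = emeasure (cgauss t) A" .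
  qed simp
qed

text \<open>Passes between a single level of the two-dimensional array and a vector, which is what
  the transition kernel acts on.\<close>

lemma nn_integral_PiM_column:
  fixes F :: "(nat \<times> nat \<Rightarrow> real) \<Rightarrow> ennreal"
  assumes J: "finite J" and F: "F \<in> borel_measurable (PiM (J \<times> {l}) (\<lambda>_. lborel))"
  shows "(\<integral>\<^sup>+x. F x \<partial>PiM (J \<times> {l}) (\<lambda>_. lborel)) = (\<integral>\<^sup>+y. F (\<lambda>p\<in>J \<times> {l}. y (fst p)) \<partial>PiM J (\<lambda>_. lborel))"
proof -
  interpret P: product_sigma_finite "\<lambda>_::nat \<times> nat. lborel :: real measure" by standard
  interpret Q: product_sigma_finite "\<lambda>_::nat. lborel :: real measure" by standard
  let ?h = "\<lambda>y. \<lambda>p\<in>J \<times> {l}. (y (fst p) :: real)"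
  have h: "?h \<in> PiM J (\<lambda>_. lborel) \<rightarrow>\<^sub>M PiM (J \<times> {l}) (\<lambda>_. lborel)"
    by (intro measurable_restrict measurable_component_singleton) auto
  have "distr (PiM J (\<lambda>_. lborel)) (PiM (J \<times> {l}) (\<lambda>_. lborel)) ?h = PiM (J \<times> {l}) (\<lambda>_. lborel)"
  proof (rule P.PiM_eqI)
    fix A assume A: "\<And>i. i \<in> J \<times> {l} \<Longrightarrow> A i \<in> sets (lborel :: real measure)"
    have "?h -` (Pi\<^sub>E (J \<times> {l}) A) \<inter> space (PiM J (\<lambda>_. lborel)) = Pi\<^sub>E J (\<lambda>j. A (j, l))"
      by (auto simp: space_PiM PiE_iff)
    moreover have "Pi\<^sub>E (J \<times> {l}) A \<in> sets (PiM (J \<times> {l}) (\<lambda>_. lborel))"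
      using A J by (intro sets_PiM_I_finite) auto
    ultimately have "emeasure (distr (PiM J (\<lambda>_. lborel)) (PiM (J \<times> {l}) (\<lambda>_. lborel)) ?h) (Pi\<^sub>E (J \<times> {l}) A) =
        emeasure (PiM J (\<lambda>_. lborel)) (Pi\<^sub>E J (\<lambda>j. A (j, l)))"
      using h by (simp add: emeasure_distr)
    also have "\<dots> = (\<Prod>j\<in>J. emeasure lborel (A (j, l)))"
      using A J by (intro Q.emeasure_PiM) auto
    also have "\<dots> = (\<Prod>p\<in>J \<times> {l}. emeasure lborel (A p))"
      by (rule prod.reindex_bij_witness[of _ fst "\<lambda>j. (j, l)"]) auto
    finally show "emeasure (distr (PiM J (\<lambda>_. lborel)) (PiM (J \<times> {l}) (\<lambda>_. lborel)) ?h) (Pi\<^sub>E (J \<times> {l}) A) =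
        (\<Prod>p\<in>J \<times> {l}. emeasure lborel (A p))" .
  qed (use J in auto)
  then show ?thesis
    using nn_integral_distr[OF h, of F] F by simp
qed

text \<open>The time is fixed, so all that remains of the Brownian motions is an i.i.d. array of
  complex Gaussians.\<close>

locale gaussian_entries = prob_space M for M :: "'w measure" +
  fixes G :: "'w \<Rightarrow> nat \<times> nat \<Rightarrow> complex" and t :: real and N :: nat
  assumes t: "0 < t" and N: "1 \<le> N"
    and G_rv: "\<And>p. p \<in> {1..} \<times> {1..} \<Longrightarrow> (\<lambda>\<omega>. G \<omega> p) \<in> borel_measurable M"
    and G_distr: "\<And>p. p \<in> {1..} \<times> {1..} \<Longrightarrow> distr M borel (\<lambda>\<omega>. G \<omega> p) = cgauss t"
    and G_indep: "indep_vars (\<lambda>_. borel) (\<lambda>p \<omega>. G \<omega> p) ({1..} \<times> {1..})"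
begin

abbreviation J :: "nat set" where "J \<equiv> {1..N}"

definition X :: "nat \<times> nat \<Rightarrow> 'w \<Rightarrow> real" where
  "X p \<omega> = gram_ev (N + snd p) N (G \<omega>) (fst p)"

lemma X_measurable: "j \<in> J \<Longrightarrow> X (j, a) \<in> borel_measurable M"
  unfolding X_def[abs_def] by simp (rule gram_ev_measurable, auto intro: G_rv)

lemma distr_entries:
  assumes "I \<subseteq> {1..} \<times> {1..}" "I \<noteq> {}"
  shows "distr M (PiM I (\<lambda>_. borel)) (\<lambda>\<omega>. \<lambda>p\<in>I. G \<omega> p) = PiM I (\<lambda>_. cgauss t)"
proof -
  have "indep_vars (\<lambda>_. borel) (\<lambda>p \<omega>. G \<omega> p) I" by (rule indep_vars_subset[OF G_indep assms(1)])
  then have "distr M (PiM I (\<lambda>_. borel)) (\<lambda>\<omega>. \<lambda>p\<in>I. G \<omega> p) = PiM I (\<lambda>p. distr M borel (\<lambda>\<omega>. G \<omega> p))"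
    by (subst (asm) indep_vars_iff_distr_eq_PiM') (use assms G_rv in auto)
  also have "\<dots> = PiM I (\<lambda>_. cgauss t)"
    using assms(1) by (intro PiM_cong refl G_distr) auto
  finally show ?thesis .
qed

lemma entries_measurable:
  "I \<subseteq> {1..} \<times> {1..} \<Longrightarrow> (\<lambda>\<omega>. \<lambda>p\<in>I. G \<omega> p) \<in> M \<rightarrow>\<^sub>M PiM I (\<lambda>_. borel)"
  by (intro measurable_restrict G_rv) auto

lemma AE_X_weyl_pos: "AE \<omega> in M. strict_mono_on J (\<lambda>j. X (j, a) \<omega>) \<and> (\<forall>j\<in>J. 0 < X (j, a) \<omega>)"
proof -
  let ?n = "N + a" and ?I = "{1..N + a} \<times> J"
  let ?P = "\<lambda>g. strict_mono_on J (gram_ev ?n N g) \<and> (\<forall>j\<in>J. 0 < gram_ev ?n N g j)"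
  have I: "?I \<subseteq> {1..} \<times> {1..}" "?I \<noteq> {}" using N by auto
  have m[measurable]: "(\<lambda>g. gram_ev ?n N g j) \<in> borel_measurable (PiM ?I (\<lambda>_. borel))" if "j \<in> J" for j
    by (rule gram_ev_measurable[OF _ that]) (auto intro: measurable_component_singleton)
  have "strict_mono_on J x \<longleftrightarrow> (\<forall>i\<in>J. \<forall>j\<in>J. i < j \<longrightarrow> x i < x j)" for x :: "nat \<Rightarrow> real"
    by (auto simp: strict_mono_on_def)
  then have "Measurable.pred (PiM ?I (\<lambda>_. borel)) ?P" by simp measurable
  then have S: "{g \<in> space (PiM ?I (\<lambda>_. borel)). ?P g} \<in> sets (PiM ?I (\<lambda>_. borel))" by (simp add: pred_def)
  have "AE g in distr M (PiM ?I (\<lambda>_. borel)) (\<lambda>\<omega>. \<lambda>p\<in>?I. G \<omega> p). ?P g"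
    unfolding distr_entries[OF I] by (rule AE_gram_ev_simple[OF t]) simp
  then have "AE \<omega> in M. ?P (\<lambda>p\<in>?I. G \<omega> p)"
    by (simp only: AE_distr_iff[OF entries_measurable[OF I(1)] S])
  moreover have "gram_ev ?n N (\<lambda>p\<in>?I. G \<omega> p) = gram_ev ?n N (G \<omega>)" for \<omega>
    by (rule gram_ev_cong) simp
  ultimately show ?thesis by (simp add: X_def)
qed

text \<open>The new row is independent of the first \<open>n\<close> rows. Since \<open>f\<close>
  may depend on all these rows, it may depend on all earlier levels, while the kernel sees the
  current eigenvalues only; this is the Markov property of the levels.\<close>

lemma nn_integral_step:
  fixes f :: "(nat \<times> nat \<Rightarrow> complex) \<Rightarrow> (nat \<Rightarrow> real) \<Rightarrow> ennreal"
  assumes n: "N \<le> n"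
    and f: "(\<lambda>(g, y). f g y) \<in> borel_measurable (PiM ({1..n} \<times> J) (\<lambda>_. borel) \<Otimes>\<^sub>M PiM J (\<lambda>_. lborel))"
  shows "(\<integral>\<^sup>+\<omega>. f (\<lambda>p\<in>{1..n} \<times> J. G \<omega> p) (\<lambda>j\<in>J. gram_ev (Suc n) N (G \<omega>) j) \<partial>M) =
    (\<integral>\<^sup>+\<omega>. (\<integral>\<^sup>+y. laguerre_kernel N t (gram_ev n N (G \<omega>)) y * f (\<lambda>p\<in>{1..n} \<times> J. G \<omega> p) y \<partial>PiM J (\<lambda>_. lborel)) \<partial>M)"
proof -
  let ?I = "{1..n} \<times> J" and ?R = "{Suc n} \<times> J"
  let ?g = "\<lambda>\<omega>. \<lambda>p\<in>?I. G \<omega> p" and ?r = "\<lambda>\<omega>. \<lambda>p\<in>?R. G \<omega> p" and ?w = "\<lambda>r. \<lambda>j\<in>J. r (Suc n, j)"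
  let ?B = "PiM ?I (\<lambda>_. borel :: complex measure)" and ?BR = "PiM ?R (\<lambda>_. borel :: complex measure)"
  let ?BJ = "PiM J (\<lambda>_. borel :: complex measure)"
  have I: "?I \<subseteq> {1..} \<times> {1..}" "?I \<noteq> {}" and R: "?R \<subseteq> {1..} \<times> {1..}" "?R \<noteq> {}" using N n by auto
  have rm: "?w \<in> ?BR \<rightarrow>\<^sub>M ?BJ"
    by (intro measurable_restrict measurable_component_singleton) auto
  have "indep_var ?B ?g ?BR ?r"
    by (rule indep_var_restrict[OF G_indep]) (use I R in auto)
  then have pair: "distr M (?B \<Otimes>\<^sub>M ?BR) (\<lambda>\<omega>. (?g \<omega>, ?r \<omega>)) = distr M ?B ?g \<Otimes>\<^sub>M distr M ?BR ?r"
    and gm: "?g \<in> M \<rightarrow>\<^sub>M ?B" and wm: "?r \<in> M \<rightarrow>\<^sub>M ?BR"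
    unfolding indep_var_distribution_eq by auto
  note dr = distr_entries[OF R]
  have sBJ: "sets (PiM J (\<lambda>_. cgauss t)) = sets ?BJ" by (rule sets_PiM_cong) auto
  have sBR: "sets (PiM ?R (\<lambda>_. cgauss t)) = sets ?BR" by (rule sets_PiM_cong) auto
  have wc: "?w \<in> PiM ?R (\<lambda>_. cgauss t) \<rightarrow>\<^sub>M PiM J (\<lambda>_. cgauss t)"
    using rm by (simp add: measurable_cong_sets[OF sBR sBJ])
  \<comment> \<open>Entries of the new row are indexed by pairs \<open>(Suc n, j)\<close>; this
    reindexes them by \<open>j\<close> alone.\<close>
  have dw: "distr (PiM ?R (\<lambda>_. cgauss t)) (PiM J (\<lambda>_. cgauss t)) ?w = PiM J (\<lambda>_. cgauss t)"
    by (rule distr_PiM_reindex) (auto intro: prob_space_cgauss t inj_onI)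
  define ev where "ev g w = (\<lambda>j\<in>J. gram_ev (Suc n) N (append_row n g w) j)" for g w
  have evm: "(\<lambda>(g, w). ev g w) \<in> ?B \<Otimes>\<^sub>M ?BJ \<rightarrow>\<^sub>M PiM J (\<lambda>_. lborel)"
    unfolding ev_def case_prod_beta
  proof (rule measurable_restrict, simp, rule gram_ev_measurable)
    fix i j assume ij: "i \<in> {1..Suc n}" "j \<in> J"
    show "(\<lambda>z. append_row n (fst z) (snd z) (i, j)) \<in> borel_measurable (?B \<Otimes>\<^sub>M ?BJ)"
    proof (cases "i = Suc n")
      case True
      then show ?thesis
        using measurable_compose[OF measurable_snd measurable_component_singleton[OF ij(2), of "\<lambda>_. borel"]]
        by (simp add: append_row_def)
    next
      case False
      then have "(i, j) \<in> ?I" using ij by auto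
      then show ?thesis
        using False measurable_compose[OF measurable_fst measurable_component_singleton[of "(i, j)" ?I "\<lambda>_. borel"]]
        by (simp add: append_row_def)
    qed
  qed auto
  have evX: "(\<lambda>j\<in>J. gram_ev (Suc n) N (G \<omega>) j) = ev (?g \<omega>) (?w (?r \<omega>))" for \<omega>
  proof -
    have "gram_ev (Suc n) N (append_row n (?g \<omega>) (?w (?r \<omega>))) = gram_ev (Suc n) N (G \<omega>)"
      by (rule gram_ev_cong) (auto simp: append_row_def)
    then show ?thesis by (simp add: ev_def)
  qed
  have fm: "(\<lambda>(g, w). f g (ev g w)) \<in> borel_measurable (?B \<Otimes>\<^sub>M ?BJ)"
    using measurable_compose[OF measurable_Pair[OF measurable_fst evm[unfolded case_prod_beta]] f]
    by (simp add: case_prod_beta)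
  have fm': "(\<lambda>(g, r). f g (ev g (?w r))) \<in> borel_measurable (?B \<Otimes>\<^sub>M ?BR)"
    using measurable_compose[OF measurable_Pair[OF measurable_fst measurable_compose[OF measurable_snd rm]] fm]
    by (simp add: case_prod_beta)
  have sf: "sigma_finite_measure (PiM J (\<lambda>_. cgauss t))" "sigma_finite_measure (PiM ?R (\<lambda>_. cgauss t))"
    by (rule prob_space_imp_sigma_finite, rule prob_space_PiM, rule prob_space_cgauss[OF t])+
  have "(\<integral>\<^sup>+\<omega>. f (?g \<omega>) (\<lambda>j\<in>J. gram_ev (Suc n) N (G \<omega>) j) \<partial>M) = (\<integral>\<^sup>+z. (case z of (g, r) \<Rightarrow> f g (ev g (?w r))) \<partial>distr M (?B \<Otimes>\<^sub>M ?BR) (\<lambda>\<omega>. (?g \<omega>, ?r \<omega>)))"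
    unfolding evX using gm wm fm' by (subst nn_integral_distr) auto
  also have "\<dots> = (\<integral>\<^sup>+g. (\<integral>\<^sup>+r. f g (ev g (?w r)) \<partial>PiM ?R (\<lambda>_. cgauss t)) \<partial>distr M ?B ?g)"
    unfolding pair dr
    by (subst sigma_finite_measure.nn_integral_fst[OF sf(2), symmetric])
      (use fm' in \<open>simp_all add: measurable_cong_sets[OF sets_pair_measure_cong[OF sets_distr sBR] refl]\<close>)
  also have "\<dots> = (\<integral>\<^sup>+g. (\<integral>\<^sup>+w. f g (ev g w) \<partial>PiM J (\<lambda>_. cgauss t)) \<partial>distr M ?B ?g)"
  proof (rule nn_integral_cong)
    fix g assume "g \<in> space (distr M ?B ?g)"
    then have g: "g \<in> space ?B" by simp
    have "(\<lambda>w. f g (ev g w)) \<in> borel_measurable ?BJ"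
      using measurable_Pair1'[OF g, THEN measurable_compose, OF fm] by simp
    then have "(\<lambda>w. f g (ev g w)) \<in> borel_measurable (PiM J (\<lambda>_. cgauss t))"
      by (simp add: measurable_cong_sets[OF sBJ refl])
    then show "(\<integral>\<^sup>+r. f g (ev g (?w r)) \<partial>PiM ?R (\<lambda>_. cgauss t)) = (\<integral>\<^sup>+w. f g (ev g w) \<partial>PiM J (\<lambda>_. cgauss t))"
      using nn_integral_distr[OF wc, of "\<lambda>w. f g (ev g w)"] unfolding dw by simp
  qed
  also have "\<dots> = (\<integral>\<^sup>+\<omega>. (\<integral>\<^sup>+w. f (?g \<omega>) (ev (?g \<omega>) w) \<partial>PiM J (\<lambda>_. cgauss t)) \<partial>M)"
  proof -
    have "(\<lambda>g. \<integral>\<^sup>+w. f g (ev g w) \<partial>PiM J (\<lambda>_. cgauss t)) \<in> borel_measurable ?B"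
      by (rule sigma_finite_measure.borel_measurable_nn_integral[OF sf(1)])
        (use fm in \<open>simp add: measurable_cong_sets[OF sets_pair_measure_cong[OF refl sBJ] refl]\<close>)
    then show ?thesis using gm by (subst nn_integral_distr) simp_all
  qed
  also have "\<dots> = (\<integral>\<^sup>+\<omega>. (\<integral>\<^sup>+y. laguerre_kernel N t (gram_ev n N (G \<omega>)) y * f (?g \<omega>) y \<partial>PiM J (\<lambda>_. lborel)) \<partial>M)"
  proof (rule nn_integral_cong_AE)
    \<comment> \<open>The matrix with \<open>n\<close> rows belongs to level \<open>n - N\<close>,
      whose spectrum is almost surely simple, as the kernel formula requires.\<close>
    have "AE \<omega> in M. strict_mono_on J (gram_ev n N (G \<omega>))"
      using AE_X_weyl_pos[of "n - N"] n by (simp add: X_def)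
    then show "AE \<omega> in M. (\<integral>\<^sup>+w. f (?g \<omega>) (ev (?g \<omega>) w) \<partial>PiM J (\<lambda>_. cgauss t)) =
        (\<integral>\<^sup>+y. laguerre_kernel N t (gram_ev n N (G \<omega>)) y * f (?g \<omega>) y \<partial>PiM J (\<lambda>_. lborel))"
    proof (rule AE_mp, intro AE_I2 impI)
      fix \<omega> assume \<omega>: "\<omega> \<in> space M" and s: "strict_mono_on J (gram_ev n N (G \<omega>))"
      have e: "gram_ev n N (G \<omega>) = gram_ev n N (?g \<omega>)" by (rule gram_ev_cong) simp
      have "f (?g \<omega>) \<in> borel_measurable (PiM J (\<lambda>_. lborel))"
        using measurable_Pair1'[OF measurable_space[OF gm \<omega>], THEN measurable_compose, OF f] by simp
      then show "(\<integral>\<^sup>+w. f (?g \<omega>) (ev (?g \<omega>) w) \<partial>PiM J (\<lambda>_. cgauss t)) =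
        (\<integral>\<^sup>+y. laguerre_kernel N t (gram_ev n N (G \<omega>)) y * f (?g \<omega>) y \<partial>PiM J (\<lambda>_. lborel))"
        unfolding ev_def e by (rule nn_integral_append_row[OF t s[unfolded e]])
    qed
  qed
  finally show ?thesis .
qed

section \<open>The Markov chain of eigenvalue levels\<close>

definition path_density :: "nat \<Rightarrow> (nat \<times> nat \<Rightarrow> real) \<Rightarrow> ennreal" where
  "path_density n c = (\<Prod>l<n. laguerre_kernel N t (\<lambda>j. c (j, l)) (\<lambda>j. c (j, Suc l)))"

text \<open>Level 0 is read off \<open>\<omega>\<close>, since its law is not computed; levels 1 to
  \<open>n\<close> are the integration variables.\<close>

definition config :: "nat \<Rightarrow> 'w \<Rightarrow> (nat \<times> nat \<Rightarrow> real) \<Rightarrow> nat \<times> nat \<Rightarrow> real" where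
  "config n \<omega> x = (\<lambda>p\<in>J \<times> {..n}. if snd p = 0 then X p \<omega> else x p)"

lemma laguerre_kernel_cong:
  assumes "\<And>j. j \<in> J \<Longrightarrow> x j = x' j" "\<And>j. j \<in> J \<Longrightarrow> y j = y' j"
  shows "laguerre_kernel N t x y = laguerre_kernel N t x' y'"
proof -
  have "x i < y i \<and> (i < N \<longrightarrow> y i < x (Suc i)) \<longleftrightarrow> x' i < y' i \<and> (i < N \<longrightarrow> y' i < x' (Suc i))"
    if "i \<in> J" for i
    using assms(1)[of i] assms(2)[of i] assms(1)[of "Suc i"] that by auto
  then have i: "interlaced 1 N x y \<longleftrightarrow> interlaced 1 N x' y'"
    unfolding interlaced_def by (intro ball_cong) auto
  have v: "vdm 1 N z = vdm 1 N z'" if "\<And>j. j \<in> J \<Longrightarrow> z j = z' j" for z z'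
    unfolding vdm_def by (intro prod.cong refl arg_cong2[where f="(-)"] that) auto
  have s: "(\<Sum>j\<in>J. y j - x j) = (\<Sum>j\<in>J. y' j - x' j)"
    by (intro sum.cong refl arg_cong2[where f="(-)"] assms)
  have vx: "vdm 1 N x = vdm 1 N x'" by (rule v) (rule assms(1))
  have vy: "vdm 1 N y = vdm 1 N y'" by (rule v) (rule assms(2))
  show ?thesis
    unfolding laguerre_kernel_def indicator_def mem_Collect_eq i s vx vy ..
qed

lemma laguerre_kernel_measurable:
  assumes "\<And>j. j \<in> J \<Longrightarrow> (\<lambda>z. x z j) \<in> borel_measurable K" "\<And>j. j \<in> J \<Longrightarrow> (\<lambda>z. y z j) \<in> borel_measurable K"
  shows "(\<lambda>z. laguerre_kernel N t (x z) (y z)) \<in> borel_measurable K"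
proof -
  have "interlaced 1 N x y \<longleftrightarrow> (\<forall>i\<in>J. x i < y i) \<and> (\<forall>i\<in>{1..<N}. y i < x (Suc i))" for x y
    by (auto simp: interlaced_def)
  moreover have "Measurable.pred K (\<lambda>z. (\<forall>i\<in>J. x z i < y z i) \<and> (\<forall>i\<in>{1..<N}. y z i < x z (Suc i)))"
    by (intro pred_intros_logic pred_intros_finite borel_measurable_pred_less assms finite_atLeastAtMost finite_atLeastLessThan) simp_all
  ultimately have i: "Measurable.pred K (\<lambda>z. interlaced 1 N (x z) (y z))" by simp
  have v: "(\<lambda>z. vdm 1 N (u z)) \<in> borel_measurable K" if "\<And>j. j \<in> J \<Longrightarrow> (\<lambda>z. u z j) \<in> borel_measurable K" for u
    unfolding vdm_def by (intro borel_measurable_prod borel_measurable_diff that) auto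
  note [measurable] = i v[of x, OF assms(1)] v[of y, OF assms(2)]
  have [measurable]: "(\<lambda>z. \<Sum>j\<in>J. y z j - x z j) \<in> borel_measurable K"
    by (intro borel_measurable_sum borel_measurable_diff assms)
  show ?thesis unfolding laguerre_kernel_def by measurable
qed

lemma path_density_measurable:
  assumes "\<And>p. p \<in> J \<times> {..n} \<Longrightarrow> (\<lambda>z. c z p) \<in> borel_measurable K"
  shows "(\<lambda>z. path_density n (c z)) \<in> borel_measurable K"
  unfolding path_density_def
  by (intro borel_measurable_prod_ennreal laguerre_kernel_measurable assms) auto

lemma config_measurable:
  assumes \<omega>: "\<And>p. p \<in> J \<times> {0} \<Longrightarrow> (\<lambda>z. X p (w z)) \<in> borel_measurable K"
    and x: "\<And>p. p \<in> J \<times> {1..n} \<Longrightarrow> (\<lambda>z. x z p) \<in> borel_measurable K"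
  shows "(\<lambda>z. config n (w z) (x z)) \<in> K \<rightarrow>\<^sub>M PiM (J \<times> {..n}) (\<lambda>_. borel)"
  unfolding config_def
proof (rule measurable_restrict)
  fix p assume p: "p \<in> J \<times> {..n}"
  show "(\<lambda>z. if snd p = 0 then X p (w z) else x z p) \<in> borel_measurable K"
  proof (cases "snd p = 0")
    case True
    then show ?thesis using \<omega>[of p] p by (cases p) auto
  next
    case False
    then show ?thesis using x[of p] p by (cases p) auto
  qed
qed

lemma nn_integral_levels:
  fixes f :: "(nat \<times> nat \<Rightarrow> real) \<Rightarrow> ennreal"
  assumes "f \<in> borel_measurable (PiM (J \<times> {..n}) (\<lambda>_. borel))"
  shows "(\<integral>\<^sup>+\<omega>. f (\<lambda>p\<in>J \<times> {..n}. X p \<omega>) \<partial>M) =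
    (\<integral>\<^sup>+\<omega>. (\<integral>\<^sup>+x. path_density n (config n \<omega> x) * f (config n \<omega> x) \<partial>PiM (J \<times> {1..n}) (\<lambda>_. lborel)) \<partial>M)"
  using assms
proof (induction n arbitrary: f)
  case 0
  interpret product_sigma_finite "\<lambda>_::nat \<times> nat. lborel :: real measure" by standard
  have e: "J \<times> {1..0::nat} = {}" by simp
  have "config 0 \<omega> x = (\<lambda>p\<in>J \<times> {..0}. X p \<omega>)" for \<omega> x
    by (auto simp: config_def fun_eq_iff)
  then show ?case unfolding e by (subst nn_integral_empty) (simp_all add: path_density_def)
next
  case (Suc n)
  interpret product_sigma_finite "\<lambda>_::nat \<times> nat. lborel :: real measure" by standard
  let ?L = "PiM J (\<lambda>_. lborel :: real measure)" and ?C = "PiM (J \<times> {..n}) (\<lambda>_. borel :: real measure)"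
  let ?D = "PiM (J \<times> {1..n}) (\<lambda>_. lborel :: real measure)"
  define ext where "ext c y = (\<lambda>p\<in>J \<times> {..Suc n}. if snd p = Suc n then y (fst p) else c p)"
    for c :: "nat \<times> nat \<Rightarrow> real" and y :: "nat \<Rightarrow> real"
  have extm: "(\<lambda>z. ext (c z) (y z)) \<in> K \<rightarrow>\<^sub>M PiM (J \<times> {..Suc n}) (\<lambda>_. borel)"
    if c: "\<And>p. p \<in> J \<times> {..n} \<Longrightarrow> (\<lambda>z. c z p) \<in> borel_measurable K"
      and y: "\<And>j. j \<in> J \<Longrightarrow> (\<lambda>z. y z j) \<in> borel_measurable K" for c y and K :: "'z measure"
    unfolding ext_def
  proof (rule measurable_restrict)
    fix p assume p: "p \<in> J \<times> {..Suc n}"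
    show "(\<lambda>z. if snd p = Suc n then y z (fst p) else c z p) \<in> borel_measurable K"
    proof (cases "snd p = Suc n")
      case True
      then show ?thesis using y[of "fst p"] p by (cases p) auto
    next
      case False
      then show ?thesis using c[of p] p by (cases p) auto
    qed
  qed
  note fext = measurable_compose[OF extm Suc.prems]
  have Cm: "(\<lambda>c. c p) \<in> borel_measurable ?C" if "p \<in> J \<times> {..n}" for p
    using measurable_component_singleton[OF that, of "\<lambda>_. borel"] .
  have Lm: "(\<lambda>c. c j) \<in> borel_measurable ?L" if "j \<in> J" for j
    using measurable_component_singleton[OF that, of "\<lambda>_. lborel"] by simp
  have Dm: "(\<lambda>c. c p) \<in> borel_measurable ?D" if "p \<in> J \<times> {1..n}" for p
    using measurable_component_singleton[OF that, of "\<lambda>_. lborel"] by simp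
  \<comment> \<open>Integrating the last level against its kernel leaves a function of the first
    \<open>n + 1\<close> levels, to which the induction hypothesis applies.\<close>
  define H where "H c y = laguerre_kernel N t (\<lambda>j. c (j, n)) y * f (ext c y)" for c y
  have Hm: "(\<lambda>(c, y). H c y) \<in> borel_measurable (?C \<Otimes>\<^sub>M ?L)"
    unfolding H_def case_prod_beta
    by (intro borel_measurable_times_ennreal laguerre_kernel_measurable fext
      measurable_compose[OF measurable_fst Cm] measurable_compose[OF measurable_snd Lm]) auto
  let ?lev = "\<lambda>g. \<lambda>p\<in>J \<times> {..n}. gram_ev (N + snd p) N g (fst p)"
  have lev: "?lev (\<lambda>p\<in>{1..N + n} \<times> J. G \<omega> p) = (\<lambda>p\<in>J \<times> {..n}. X p \<omega>)" for \<omega>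
  proof (rule restrict_ext)
    fix p assume p: "p \<in> J \<times> {..n}"
    have "gram_ev (N + snd p) N (\<lambda>p\<in>{1..N + n} \<times> J. G \<omega> p) = gram_ev (N + snd p) N (G \<omega>)"
      using p by (intro gram_ev_cong) auto
    then show "gram_ev (N + snd p) N (\<lambda>p\<in>{1..N + n} \<times> J. G \<omega> p) (fst p) = X p \<omega>" by (simp add: X_def)
  qed
  have Xext: "(\<lambda>p\<in>J \<times> {..Suc n}. X p \<omega>) = ext (?lev (\<lambda>p\<in>{1..N + n} \<times> J. G \<omega> p)) (\<lambda>j\<in>J. gram_ev (Suc (N + n)) N (G \<omega>) j)" for \<omega>
    unfolding lev by (auto simp: ext_def fun_eq_iff X_def le_Suc_eq)
  have "(\<integral>\<^sup>+\<omega>. f (\<lambda>p\<in>J \<times> {..Suc n}. X p \<omega>) \<partial>M) =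
      (\<integral>\<^sup>+\<omega>. (\<integral>\<^sup>+y. laguerre_kernel N t (gram_ev (N + n) N (G \<omega>)) y * f (ext (?lev (\<lambda>p\<in>{1..N + n} \<times> J. G \<omega> p)) y) \<partial>?L) \<partial>M)"
    unfolding Xext
  proof (rule nn_integral_step[where f = "\<lambda>g y. f (ext (?lev g) y)"])
    show "(\<lambda>(g, y). f (ext (?lev g) y)) \<in> borel_measurable (PiM ({1..N + n} \<times> J) (\<lambda>_. borel) \<Otimes>\<^sub>M ?L)"
      unfolding case_prod_beta
    proof (rule fext)
      fix p assume p: "p \<in> J \<times> {..n}"
      then have "(\<lambda>z. gram_ev (N + snd p) N (fst z) (fst p)) \<in> borel_measurable (PiM ({1..N + n} \<times> J) (\<lambda>_. borel) \<Otimes>\<^sub>M ?L)"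
        by (intro gram_ev_measurable measurable_compose[OF measurable_fst measurable_component_singleton]) auto
      then show "(\<lambda>z. ?lev (fst z) p) \<in> borel_measurable (PiM ({1..N + n} \<times> J) (\<lambda>_. borel) \<Otimes>\<^sub>M ?L)"
        using p by simp
    qed (rule measurable_compose[OF measurable_snd Lm])
  qed simp
  also have "\<dots> = (\<integral>\<^sup>+\<omega>. (\<lambda>c. \<integral>\<^sup>+y. H c y \<partial>?L) (\<lambda>p\<in>J \<times> {..n}. X p \<omega>) \<partial>M)"
    unfolding lev H_def
    by (intro nn_integral_cong arg_cong2[where f=times] laguerre_kernel_cong refl) (auto simp: X_def)
  also have "\<dots> = (\<integral>\<^sup>+\<omega>. (\<integral>\<^sup>+x. path_density n (config n \<omega> x) * (\<integral>\<^sup>+y. H (config n \<omega> x) y \<partial>?L) \<partial>?D) \<partial>M)"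
  proof (rule Suc.IH)
    show "(\<lambda>c. \<integral>\<^sup>+y. H c y \<partial>?L) \<in> borel_measurable ?C"
      by (rule sigma_finite_measure.borel_measurable_nn_integral[OF product_sigma_finite.sigma_finite])
        (use Hm in \<open>simp_all add: product_sigma_finite_def sigma_finite_lborel\<close>)
  qed
  also have "\<dots> = (\<integral>\<^sup>+\<omega>. (\<integral>\<^sup>+x. path_density (Suc n) (config (Suc n) \<omega> x) * f (config (Suc n) \<omega> x) \<partial>PiM (J \<times> {1..Suc n}) (\<lambda>_. lborel)) \<partial>M)"
  proof (rule nn_integral_cong)
    fix \<omega> assume \<omega>: "\<omega> \<in> space M"
    have U: "J \<times> {1..Suc n} = J \<times> {1..n} \<union> J \<times> {Suc n}" by (auto simp: One_nat_def)
    let ?\<Phi> = "\<lambda>x. path_density (Suc n) (config (Suc n) \<omega> x) * f (config (Suc n) \<omega> x)"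
    have cm: "config (Suc n) \<omega> \<in> PiM (J \<times> {1..Suc n}) (\<lambda>_. lborel) \<rightarrow>\<^sub>M PiM (J \<times> {..Suc n}) (\<lambda>_. borel)"
    proof (rule config_measurable)
      fix p assume "p \<in> J \<times> {1..Suc n}"
      from measurable_component_singleton[OF this, of "\<lambda>_. lborel"]
      show "(\<lambda>z. z p) \<in> borel_measurable (PiM (J \<times> {1..Suc n}) (\<lambda>_. lborel))" by simp
    qed simp
    have \<Phi>m: "?\<Phi> \<in> borel_measurable (PiM (J \<times> {1..Suc n}) (\<lambda>_. lborel))"
      by (intro borel_measurable_times_ennreal path_density_measurable measurable_compose[OF cm Suc.prems]
        measurable_compose[OF cm measurable_component_singleton])
    have "(\<integral>\<^sup>+x. ?\<Phi> x \<partial>PiM (J \<times> {1..Suc n}) (\<lambda>_. lborel)) =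
        (\<integral>\<^sup>+x. (\<integral>\<^sup>+z. ?\<Phi> (merge (J \<times> {1..n}) (J \<times> {Suc n}) (x, z)) \<partial>PiM (J \<times> {Suc n}) (\<lambda>_. lborel)) \<partial>?D)"
      unfolding U by (rule product_nn_integral_fold) (use \<Phi>m[unfolded U] in auto)
    also have "\<dots> = (\<integral>\<^sup>+x. path_density n (config n \<omega> x) * (\<integral>\<^sup>+y. H (config n \<omega> x) y \<partial>?L) \<partial>?D)"
    proof (rule nn_integral_cong)
      fix x assume x: "x \<in> space ?D"
      let ?m = "\<lambda>z. merge (J \<times> {1..n}) (J \<times> {Suc n}) (x, z)"
      have mm: "?m \<in> PiM (J \<times> {Suc n}) (\<lambda>_. lborel) \<rightarrow>\<^sub>M PiM (J \<times> {1..n} \<union> J \<times> {Suc n}) (\<lambda>_. lborel)"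
        by (rule measurable_compose[OF _ measurable_merge]) (use x in measurable)
      have ce: "config (Suc n) \<omega> (?m (\<lambda>p\<in>J \<times> {Suc n}. y (fst p))) = ext (config n \<omega> x) y" for y
        by (auto simp: config_def ext_def fun_eq_iff merge_def le_Suc_eq One_nat_def)
      have pd: "path_density (Suc n) (ext c y) = path_density n c * laguerre_kernel N t (\<lambda>j. c (j, n)) y" for c y
        unfolding path_density_def prod.lessThan_Suc
        by (intro arg_cong2[where f=times] prod.cong refl laguerre_kernel_cong) (auto simp: ext_def)
      have "(\<integral>\<^sup>+z. ?\<Phi> (?m z) \<partial>PiM (J \<times> {Suc n}) (\<lambda>_. lborel)) = (\<integral>\<^sup>+y. ?\<Phi> (?m (\<lambda>p\<in>J \<times> {Suc n}. y (fst p))) \<partial>?L)"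
        by (rule nn_integral_PiM_column) (use measurable_compose[OF mm \<Phi>m[unfolded U]] in auto)
      also have "\<dots> = (\<integral>\<^sup>+y. path_density n (config n \<omega> x) * H (config n \<omega> x) y \<partial>?L)"
        unfolding ce pd H_def by (simp add: mult.assoc)
      also have "\<dots> = path_density n (config n \<omega> x) * (\<integral>\<^sup>+y. H (config n \<omega> x) y \<partial>?L)"
      proof (rule nn_integral_cmult)
        have "config n \<omega> x \<in> space ?C" by (auto simp: config_def space_PiM)
        from measurable_Pair1'[OF this, THEN measurable_compose, OF Hm]
        show "H (config n \<omega> x) \<in> borel_measurable ?L" by simp
      qed
      finally show "(\<integral>\<^sup>+z. ?\<Phi> (?m z) \<partial>PiM (J \<times> {Suc n}) (\<lambda>_. lborel)) =
        path_density n (config n \<omega> x) * (\<integral>\<^sup>+y. H (config n \<omega> x) y \<partial>?L)" .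
    qed
    finally show "(\<integral>\<^sup>+x. path_density n (config n \<omega> x) * (\<integral>\<^sup>+y. H (config n \<omega> x) y \<partial>?L) \<partial>?D) =
      (\<integral>\<^sup>+x. ?\<Phi> x \<partial>PiM (J \<times> {1..Suc n}) (\<lambda>_. lborel))" ..
  qed
  finally show ?case .
qed

end

section \<open>The Gibbs property\<close>

lemma pred_borel_le:
  fixes f g :: "'a \<Rightarrow> real"
  assumes "f \<in> borel_measurable K" "g \<in> borel_measurable K"
  shows "Measurable.pred K (\<lambda>z. f z \<le> g z)"
  unfolding pred_def by (rule borel_measurable_le[OF assms])

text \<open>With the other coordinates fixed, equality confines coordinate \<open>p\<close> to a
  single point.\<close>

lemma AE_PiM_lborel_neq:
  fixes c :: "('i \<Rightarrow> real) \<Rightarrow> real"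
  assumes C: "finite C" "p \<in> C" and c: "c \<in> borel_measurable (PiM C (\<lambda>_. lborel))"
    and indep: "\<And>x y. c (x(p := y)) = c x"
  shows "AE x in PiM C (\<lambda>_. lborel). x p \<noteq> c x"
proof -
  interpret product_sigma_finite "\<lambda>_. lborel :: real measure" by standard
  let ?P = "PiM C (\<lambda>_. lborel :: real measure)"
  have pm: "(\<lambda>x. x p) \<in> borel_measurable ?P"
    using measurable_component_singleton[OF C(2), of "\<lambda>_. lborel"] by simp
  have [measurable]: "Measurable.pred ?P (\<lambda>x. x p = c x)"
  proof -
    have "Measurable.pred ?P (\<lambda>x. x p \<le> c x \<and> c x \<le> x p)"
      using pm c by (intro pred_intros_logic pred_borel_le)
    then show ?thesis by (simp only: order_eq_iff)
  qed
  have m: "(\<lambda>x. indicator {x. x p = c x} x :: ennreal) \<in> borel_measurable ?P" by measurable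
  have C': "C = insert p (C - {p})" using C by auto
  have "(\<integral>\<^sup>+x. indicator {x. x p = c x} x \<partial>?P) =
      (\<integral>\<^sup>+x. (\<integral>\<^sup>+y. indicator {x. x p = c x} (x(p := y)) \<partial>lborel) \<partial>PiM (C - {p}) (\<lambda>_. lborel))"
    by (subst C', rule product_nn_integral_insert) (use C m in \<open>simp_all add: insert_absorb\<close>)
  also have "\<dots> = (\<integral>\<^sup>+x. (\<integral>\<^sup>+y. indicator {c x} y \<partial>lborel) \<partial>PiM (C - {p}) (\<lambda>_. lborel))"
    by (intro nn_integral_cong) (auto simp: indep indicator_def)
  also have "\<dots> = 0" by simp
  finally have "AE x in ?P. indicator {x. x p = c x} x = (0::ennreal)"
    using nn_integral_0_iff_AE[OF m] by simp
  then show ?thesis by eventually_elim (auto simp: indicator_def split: if_splits)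
qed

section \<open>Gibbs sets, their masses, and ties\<close>

definition patch :: "nat \<Rightarrow> nat \<Rightarrow> nat \<Rightarrow> (nat \<times> nat \<Rightarrow> real) \<Rightarrow> (nat \<times> nat \<Rightarrow> real) \<Rightarrow> nat \<times> nat \<Rightarrow> real" where
  "patch k a b x w p = (if p \<in> block k a b then w p else x p)"

text \<open>The common form of \<open>I_free\<close> (where \<open>k = N\<close>) and \<open>I_bdry\<close> (where \<open>k < N\<close>); the boundary data are
  read off from a configuration \<open>x\<close> outside the block.\<close>

definition gibbs_set :: "nat \<Rightarrow> nat \<Rightarrow> nat \<Rightarrow> nat \<Rightarrow> (nat \<times> nat \<Rightarrow> real) \<Rightarrow> (nat \<times> nat \<Rightarrow> real) set" where
  "gibbs_set N k a b x = {w \<in> space (tuple_lebesgue k a b).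
     (\<forall>l\<in>{a<..<b}. weyl k (\<lambda>j. w (j, l))) \<and>
     (\<forall>l\<in>{a..<b}. interlace (min (Suc k) N) (\<lambda>j. patch k a b x w (j, l)) (\<lambda>j. patch k a b x w (j, Suc l)))}"

lemma interlace_cong:
  assumes "\<And>j. j \<in> {1..m} \<Longrightarrow> x j = x' j" "\<And>j. j \<in> {1..m} \<Longrightarrow> y j = y' j"
  shows "interlace m x y \<longleftrightarrow> interlace m x' y'"
proof -
  have "(\<forall>i\<in>{1..m}. x i \<le> y i) \<longleftrightarrow> (\<forall>i\<in>{1..m}. x' i \<le> y' i)"
    using assms by auto
  moreover have "(\<forall>i\<in>{1..<m}. y i \<le> x (Suc i)) \<longleftrightarrow> (\<forall>i\<in>{1..<m}. y' i \<le> x' (Suc i))"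
    by (rule ball_cong) (auto simp: assms)
  ultimately show ?thesis unfolding interlace_def by blast
qed

lemma I_bdry_eq_gibbs_set:
  assumes "k < N" "a < b"
  shows "I_bdry k a b (\<lambda>j. x (j, a)) (\<lambda>j. x (j, b)) (\<lambda>l. x (Suc k, l)) = gibbs_set N k a b x"
proof -
  let ?v = "\<lambda>w l. (level a b (\<lambda>j. x (j, a)) (\<lambda>j. x (j, b)) w l)(Suc k := x (Suc k, l))"
  have v: "?v w l j = patch k a b x w (j, l)" if "l \<in> {a..b}" "j \<in> {1..Suc k}" for w l j
    using that by (auto simp: level_def patch_def block_def One_nat_def)
  have "interlace (Suc k) (?v w l) (?v w (Suc l)) \<longleftrightarrow>
      interlace (min (Suc k) N) (\<lambda>j. patch k a b x w (j, l)) (\<lambda>j. patch k a b x w (j, Suc l))"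
    if "l \<in> {a..<b}" for w l
  proof -
    have m: "min (Suc k) N = Suc k" using assms by simp
    show ?thesis unfolding m by (rule interlace_cong; rule v) (use that in auto)
  qed
  then show ?thesis unfolding I_bdry_def gibbs_set_def by auto
qed

lemma I_free_eq_gibbs_set:
  assumes "a < b"
  shows "I_free N a b (\<lambda>j. x (j, a)) (\<lambda>j. x (j, b)) = gibbs_set N N a b x"
proof -
  let ?v = "\<lambda>w l. level a b (\<lambda>j. x (j, a)) (\<lambda>j. x (j, b)) w l"
  have v: "?v w l j = patch N a b x w (j, l)" if "l \<in> {a..b}" "j \<in> {1..N}" for w l j
    using that by (auto simp: level_def patch_def block_def One_nat_def)
  have "interlace N (?v w l) (?v w (Suc l)) \<longleftrightarrow>
      interlace (min (Suc N) N) (\<lambda>j. patch N a b x w (j, l)) (\<lambda>j. patch N a b x w (j, Suc l))"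
    if "l \<in> {a..<b}" for w l
  proof -
    have m: "min (Suc N) N = N" by simp
    show ?thesis unfolding m by (rule interlace_cong; rule v) (use that in auto)
  qed
  then show ?thesis unfolding I_free_def gibbs_set_def by auto
qed

text \<open>The source of the fact that the conditional probabilities are functions of the
  configuration outside the block.\<close>

lemma gibbs_set_cong:
  assumes "k \<le> N" "\<And>p. p \<in> {1..N} \<times> {a..b} - block k a b \<Longrightarrow> x p = x' p"
  shows "gibbs_set N k a b x = gibbs_set N k a b x'"
proof -
  have v: "patch k a b x w (j, l) = patch k a b x' w (j, l)" if "l \<in> {a..b}" "j \<in> {1..min (Suc k) N}" for w l j
    using that assms by (auto simp: patch_def)
  have "interlace (min (Suc k) N) (\<lambda>j. patch k a b x w (j, l)) (\<lambda>j. patch k a b x w (j, Suc l)) \<longleftrightarrow>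
      interlace (min (Suc k) N) (\<lambda>j. patch k a b x' w (j, l)) (\<lambda>j. patch k a b x' w (j, Suc l))"
    if "l \<in> {a..<b}" for w l
    by (rule interlace_cong; rule v) (use that in auto)
  then show ?thesis unfolding gibbs_set_def by auto
qed

lemma finite_block[simp]: "finite (block k a b)"
  by (simp add: block_def)

lemma gibbs_set_measurable:
  assumes k: "k \<le> N"
    and x: "\<And>p. p \<in> {1..N} \<times> {a..b} - block k a b \<Longrightarrow> (\<lambda>z. x z p) \<in> borel_measurable K"
    and w: "w \<in> K \<rightarrow>\<^sub>M tuple_lebesgue k a b"
  shows "Measurable.pred K (\<lambda>z. w z \<in> gibbs_set N k a b (x z))"
proof -
  have wp: "(\<lambda>z. w z p) \<in> borel_measurable K" if "p \<in> block k a b" for p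
    using measurable_compose[OF w[unfolded tuple_lebesgue_def] measurable_component_singleton[OF that]] by simp
  have pp: "(\<lambda>z. patch k a b (x z) (w z) p) \<in> borel_measurable K" if "p \<in> {1..N} \<times> {a..b}" for p
    using that wp[of p] x[of p] by (cases "p \<in> block k a b") (auto simp: patch_def)
  have e: "weyl k y \<longleftrightarrow> (\<forall>i\<in>{1..k}. \<forall>j\<in>{1..k}. i < j \<longrightarrow> y i < y j)" for y
    by (auto simp: weyl_def strict_mono_on_def)
  have 1: "Measurable.pred K (\<lambda>z. \<forall>l\<in>{a<..<b}. weyl k (\<lambda>j. w z (j, l)))"
    unfolding e
    by (intro pred_intros_finite pred_intros_imp' borel_measurable_pred_less wp) (auto simp: block_def)
  have 2: "Measurable.pred K (\<lambda>z. \<forall>l\<in>{a..<b}. interlace (min (Suc k) N) (\<lambda>j. patch k a b (x z) (w z) (j, l)) (\<lambda>j. patch k a b (x z) (w z) (j, Suc l)))"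
    unfolding interlace_def
    by (intro pred_intros_finite pred_intros_logic pred_borel_le pp) auto
  have "Measurable.pred K (\<lambda>z. (\<forall>l\<in>{a<..<b}. weyl k (\<lambda>j. w z (j, l))) \<and>
      (\<forall>l\<in>{a..<b}. interlace (min (Suc k) N) (\<lambda>j. patch k a b (x z) (w z) (j, l)) (\<lambda>j. patch k a b (x z) (w z) (j, Suc l))))"
    using 1 2 by (rule pred_intros_logic)
  moreover have eq: "w z \<in> gibbs_set N k a b (x z) \<longleftrightarrow> (\<forall>l\<in>{a<..<b}. weyl k (\<lambda>j. w z (j, l))) \<and>
      (\<forall>l\<in>{a..<b}. interlace (min (Suc k) N) (\<lambda>j. patch k a b (x z) (w z) (j, l)) (\<lambda>j. patch k a b (x z) (w z) (j, Suc l)))"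
    if "z \<in> space K" for z
    using measurable_space[OF w that] by (simp add: gibbs_set_def)
  ultimately show ?thesis by (subst measurable_cong[OF eq])
qed

lemma sigma_finite_tuple_lebesgue: "sigma_finite_measure (tuple_lebesgue k a b)"
  unfolding tuple_lebesgue_def
  by (rule product_sigma_finite.sigma_finite) (simp_all add: product_sigma_finite_def sigma_finite_lborel)

lemma gibbs_set_sets: "k \<le> N \<Longrightarrow> gibbs_set N k a b x \<in> sets (tuple_lebesgue k a b)"
proof -
  assume k: "k \<le> N"
  have "Measurable.pred (tuple_lebesgue k a b) (\<lambda>w. w \<in> gibbs_set N k a b x)"
    by (rule gibbs_set_measurable[OF k]) simp_all
  then show ?thesis by (simp add: pred_def) (simp add: gibbs_set_def Int_def cong: conj_cong)
qed

text \<open>Interlacing makes each particle nondecreasing in the level, so \<open>w (j, l)\<close>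
  lies between the boundary values \<open>x (j, a)\<close> and \<open>x (j, b)\<close>: a bounded
  box.\<close>

lemma gibbs_set_finite:
  assumes k: "k \<le> N" shows "emeasure (tuple_lebesgue k a b) (gibbs_set N k a b x) < \<infinity>"
proof -
  interpret product_sigma_finite "\<lambda>_. lborel :: real measure" by standard
  let ?A = "\<lambda>(j, l :: nat). {x (j, a)..x (j, b)}"
  have sub: "gibbs_set N k a b x \<subseteq> Pi\<^sub>E (block k a b) ?A"
  proof
    fix w assume w: "w \<in> gibbs_set N k a b x"
    have step: "patch k a b x w (j, l) \<le> patch k a b x w (j, Suc l)" if "j \<in> {1..k}" "a \<le> l" "l < b" for j l
    proof -
      have "interlace (min (Suc k) N) (\<lambda>j. patch k a b x w (j, l)) (\<lambda>j. patch k a b x w (j, Suc l))"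
        using w that by (auto simp: gibbs_set_def)
      moreover have "j \<in> {1..min (Suc k) N}" using that k by auto
      ultimately show ?thesis unfolding interlace_def by blast
    qed
    have mono: "a + d \<le> b \<Longrightarrow> l \<le> a + d \<Longrightarrow> a \<le> l \<Longrightarrow> patch k a b x w (j, l) \<le> patch k a b x w (j, a + d)"
      if "j \<in> {1..k}" for j l d
    proof (induction d)
      case (Suc d)
      show ?case
      proof (cases "l = a + Suc d")
        case False
        then have "patch k a b x w (j, l) \<le> patch k a b x w (j, a + d)" using Suc by auto
        also have "\<dots> \<le> patch k a b x w (j, Suc (a + d))" using Suc that by (intro step) auto
        finally show ?thesis by simp
      qed simp
    qed auto
    have "w (j, l) \<in> {x (j, a)..x (j, b)}" if "(j, l) \<in> block k a b" for j l
    proof -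
      have jl: "j \<in> {1..k}" "a < l" "l < b" using that by (auto simp: block_def)
      have e: "patch k a b x w (j, l) = w (j, l)" "patch k a b x w (j, a) = x (j, a)" "patch k a b x w (j, b) = x (j, b)"
        using that by (auto simp: patch_def block_def)
      show ?thesis
        using mono[OF jl(1), of "l - a" a] mono[OF jl(1), of "b - a" l] jl by (simp add: e)
    qed
    moreover have "w \<in> extensional (block k a b)"
      using w by (auto simp: gibbs_set_def tuple_lebesgue_def space_PiM PiE_def)
    ultimately show "w \<in> Pi\<^sub>E (block k a b) ?A" by (auto simp: PiE_iff)
  qed
  have "emeasure (tuple_lebesgue k a b) (gibbs_set N k a b x) \<le> emeasure (tuple_lebesgue k a b) (Pi\<^sub>E (block k a b) ?A)"
    unfolding tuple_lebesgue_def
    by (rule emeasure_mono[OF sub]) (intro sets_PiM_I_finite, auto)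
  also have "\<dots> = (\<Prod>p\<in>block k a b. emeasure lborel (?A p))"
    unfolding tuple_lebesgue_def by (rule emeasure_PiM) auto
  also have "\<dots> < \<infinity>"
    by (auto simp: less_top[symmetric] ennreal_prod_eq_top case_prod_beta emeasure_lborel_Icc_eq)
  finally show ?thesis .
qed

text \<open>With \<open>E = UNIV\<close> this is the normalising constant \<open>Z_free\<close> or
  \<open>Z_bdry\<close>.\<close>

definition gibbs_mass :: "nat \<Rightarrow> nat \<Rightarrow> nat \<Rightarrow> nat \<Rightarrow> (nat \<times> nat \<Rightarrow> real) set \<Rightarrow> (nat \<times> nat \<Rightarrow> real) \<Rightarrow> ennreal" where
  "gibbs_mass N k a b E x = emeasure (tuple_lebesgue k a b) (gibbs_set N k a b x \<inter> E)"

lemma gibbs_mass_nn_integral: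
  assumes "k \<le> N" "E \<in> sets (tuple_lebesgue k a b)"
  shows "gibbs_mass N k a b E x = (\<integral>\<^sup>+w. indicator (gibbs_set N k a b x) w * indicator E w \<partial>tuple_lebesgue k a b)"
  unfolding gibbs_mass_def indicator_inter_arith[symmetric]
  using gibbs_set_sets[OF assms(1)] assms(2) by (intro nn_integral_indicator[symmetric]) auto

lemma gibbs_mass_measurable:
  assumes k: "k \<le> N" and E[measurable]: "E \<in> sets (tuple_lebesgue k a b)"
    and x: "\<And>p. p \<in> {1..N} \<times> {a..b} - block k a b \<Longrightarrow> (\<lambda>z. x z p) \<in> borel_measurable K"
  shows "(\<lambda>z. gibbs_mass N k a b E (x z)) \<in> borel_measurable K"
  unfolding gibbs_mass_nn_integral[OF k E]
proof (rule sigma_finite_measure.borel_measurable_nn_integral[OF sigma_finite_tuple_lebesgue])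
  have [measurable]: "Measurable.pred (K \<Otimes>\<^sub>M tuple_lebesgue k a b) (\<lambda>z. snd z \<in> gibbs_set N k a b (x (fst z)))"
    by (rule gibbs_set_measurable[OF k]) (auto intro: measurable_compose[OF measurable_fst x])
  have m1: "(\<lambda>z. indicator {z. snd z \<in> gibbs_set N k a b (x (fst z))} z :: ennreal) \<in> borel_measurable (K \<Otimes>\<^sub>M tuple_lebesgue k a b)"
    by measurable
  have m2: "(\<lambda>z. indicator E (snd z) :: ennreal) \<in> borel_measurable (K \<Otimes>\<^sub>M tuple_lebesgue k a b)"
    by measurable
  show "(\<lambda>(z, w). indicator (gibbs_set N k a b (x z)) w * indicator E w) \<in> borel_measurable (K \<Otimes>\<^sub>M tuple_lebesgue k a b)"
    using borel_measurable_times_ennreal[OF m1 m2] by (simp add: indicator_def case_prod_beta)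
qed

lemma gibbs_mass_le: "k \<le> N \<Longrightarrow> gibbs_mass N k a b E x \<le> gibbs_mass N k a b UNIV x"
  unfolding gibbs_mass_def by (rule emeasure_mono) (auto intro: gibbs_set_sets)

lemma gibbs_mass_cong:
  assumes "k \<le> N" "\<And>p. p \<in> {1..N} \<times> {a..b} - block k a b \<Longrightarrow> x p = x' p"
  shows "gibbs_mass N k a b E x = gibbs_mass N k a b E x'"
  unfolding gibbs_mass_def by (subst gibbs_set_cong[OF assms]) auto

lemma gibbs_mass_divide_self:
  assumes "k \<le> N" "gibbs_mass N k a b UNIV x \<noteq> 0"
  shows "gibbs_mass N k a b UNIV x / gibbs_mass N k a b UNIV x = 1"
  using assms gibbs_set_finite[OF assms(1), of a b x]
  by (intro ennreal_divide_self) (simp_all add: gibbs_mass_def zero_less_iff_neq_zero)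

text \<open>If the normalising mass vanishes, so does the numerator by monotonicity. Hence the
  identity can be used before positivity is known.\<close>

lemma gibbs_mass_divide:
  assumes "k \<le> N"
  shows "gibbs_mass N k a b E x / gibbs_mass N k a b UNIV x * gibbs_mass N k a b UNIV x = gibbs_mass N k a b E x"
proof (cases "gibbs_mass N k a b UNIV x = 0")
  case True
  then show ?thesis using gibbs_mass_le[OF assms, of a b E x] by simp
next
  case False
  then have "gibbs_mass N k a b UNIV x / gibbs_mass N k a b UNIV x = 1"
    by (rule gibbs_mass_divide_self[OF assms])
  then show ?thesis by (metis ennreal_times_divide mult.commute mult.right_neutral)
qed

text \<open>The strict inequalities with a level outside \<open>{a..<b}\<close> or an index above
  \<open>k\<close>. None of them involves an entry of the block.\<close>

definition outside_interlaced :: "nat \<Rightarrow> nat \<Rightarrow> nat \<Rightarrow> nat \<Rightarrow> nat \<Rightarrow> (nat \<times> nat \<Rightarrow> real) \<Rightarrow> bool" where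
  "outside_interlaced N k a b n c \<longleftrightarrow> (\<forall>l<n. \<forall>i\<in>{1..N}. \<not> (l \<in> {a..<b} \<and> i \<le> k) \<longrightarrow>
     c (i, l) < c (i, Suc l) \<and> (i < N \<longrightarrow> c (i, Suc l) < c (Suc i, l)))"

text \<open>Separates the constraints on a path into a part that does not see the block and the
  Gibbs set. The assumptions \<open>D\<close> exclude ties, off which the weak inequalities of
  \<open>gibbs_set\<close> are strict.\<close>

lemma all_interlaced_iff:
  assumes k: "k \<le> N" and ab: "b \<le> n"
    and D: "\<And>i l. l < n \<Longrightarrow> i \<in> {1..N} \<Longrightarrow> c (i, l) \<noteq> c (i, Suc l)"
      "\<And>i l. l < n \<Longrightarrow> i \<in> {1..N} \<Longrightarrow> i < N \<Longrightarrow> c (i, Suc l) \<noteq> c (Suc i, l)"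
  shows "(\<forall>l<n. interlaced 1 N (\<lambda>j. c (j, l)) (\<lambda>j. c (j, Suc l))) \<longleftrightarrow>
    outside_interlaced N k a b n c \<and> restrict c (block k a b) \<in> gibbs_set N k a b c"
    (is "?L \<longleftrightarrow> ?O \<and> ?R")
proof -
  have p: "patch k a b c (restrict c (block k a b)) = c" by (auto simp: patch_def fun_eq_iff)
  show ?thesis
  proof (intro iffI conjI)
    assume L: ?L
    then have L': "c (i, l) < c (i, Suc l)" "i < N \<Longrightarrow> c (i, Suc l) < c (Suc i, l)" if "l < n" "i \<in> {1..N}" for l i
      using that by (auto simp: interlaced_def)
    show ?O unfolding outside_interlaced_def using L' by blast
    have "weyl k (\<lambda>j. restrict c (block k a b) (j, l))" if l: "l \<in> {a<..<b}" for l
      unfolding weyl_def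
    proof (rule strict_mono_onI)
      fix i j assume ij: "i \<in> {1..k}" "j \<in> {1..k}" "i < j"
      have sm: "strict_mono_on {1..N} (\<lambda>j. c (j, l))"
        by (rule interlaced_strict_mono(2)[of 1 N _ "\<lambda>j. c (j, Suc l)"]) (use L l ab in auto)
      then have "c (i, l) < c (j, l)" using strict_mono_onD[OF sm, of i j] ij k by simp
      then show "restrict c (block k a b) (i, l) < restrict c (block k a b) (j, l)"
        using ij l by (simp add: block_def)
    qed
    moreover have "interlace (min (Suc k) N) (\<lambda>j. c (j, l)) (\<lambda>j. c (j, Suc l))" if l: "l \<in> {a..<b}" for l
      unfolding interlace_def
    proof (intro conjI ballI)
      fix i assume "i \<in> {1..min (Suc k) N}"
      then show "c (i, l) \<le> c (i, Suc l)" using L'(1)[of l i] l ab by auto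
    next
      fix i assume "i \<in> {1..<min (Suc k) N}"
      then show "c (i, Suc l) \<le> c (Suc i, l)" using L'(2)[of l i] l ab by auto
    qed
    ultimately show ?R unfolding gibbs_set_def mem_Collect_eq p by (simp add: tuple_lebesgue_def space_PiM)
  next
    assume "?O \<and> ?R"
    then have O: ?O and R: ?R by auto
    have R': "interlace (min (Suc k) N) (\<lambda>j. c (j, l)) (\<lambda>j. c (j, Suc l))" if "l \<in> {a..<b}" for l
      using R that unfolding gibbs_set_def mem_Collect_eq p by blast
    have "c (i, l) < c (i, Suc l) \<and> (i < N \<longrightarrow> c (i, Suc l) < c (Suc i, l))" if l: "l < n" and i: "i \<in> {1..N}" for l i
    proof (cases "l \<in> {a..<b} \<and> i \<le> k")
      case True
      note r = R'[of l, unfolded interlace_def]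
      have "c (i, l) \<le> c (i, Suc l)" using r True i by auto
      moreover have "c (i, Suc l) \<le> c (Suc i, l)" if "i < N" using r True i that by auto
      ultimately show ?thesis using D[OF l i] by (auto simp: less_le)
    next
      case False
      then show ?thesis using O l i unfolding outside_interlaced_def by blast
    qed
    then show ?L unfolding interlaced_def by blast
  qed
qed

context gaussian_entries
begin

definition endpoint_density :: "nat \<Rightarrow> (nat \<times> nat \<Rightarrow> real) \<Rightarrow> ennreal" where
  "endpoint_density n c = ennreal (vdm 1 N (\<lambda>j. c (j, n)) / vdm 1 N (\<lambda>j. c (j, 0)) *
     (exp (- (\<Sum>j\<in>J. c (j, n) - c (j, 0)) / t) / t ^ (N * n)))"

text \<open>The transition densities telescope, so given its endpoints the path is uniformly distributed.\<close>

lemma path_density_telescope: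
  assumes "strict_mono_on J (\<lambda>j. c (j, 0))"
  shows "path_density n c =
    (if \<forall>l<n. interlaced 1 N (\<lambda>j. c (j, l)) (\<lambda>j. c (j, Suc l)) then endpoint_density n c else 0)"
proof (induction n)
  case 0
  have "0 < vdm 1 N (\<lambda>j. c (j, 0))" by (rule vdm_pos[OF assms])
  then show ?case by (simp add: path_density_def endpoint_density_def)
next
  case (Suc n)
  have e: "path_density (Suc n) c = path_density n c * laguerre_kernel N t (\<lambda>j. c (j, n)) (\<lambda>j. c (j, Suc n))"
    by (simp add: path_density_def)
  show ?case
  proof (cases "\<forall>l<Suc n. interlaced 1 N (\<lambda>j. c (j, l)) (\<lambda>j. c (j, Suc l))")
    case True
    then have i: "interlaced 1 N (\<lambda>j. c (j, n)) (\<lambda>j. c (j, Suc n))" by blast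
    let ?v = "\<lambda>l. vdm 1 N (\<lambda>j. c (j, l))" and ?e = "\<lambda>m l. exp (- (\<Sum>j\<in>J. c (j, l) - c (j, m)) / t)"
    have v: "0 < ?v n" "0 < ?v (Suc n)" "0 < ?v 0"
      using vdm_pos[OF interlaced_strict_mono(2)[OF i]] vdm_pos[OF interlaced_strict_mono(1)[OF i]] vdm_pos[OF assms] by auto
    have ex: "?e 0 n * ?e n (Suc n) = ?e 0 (Suc n)"
      by (simp add: exp_add[symmetric] sum_subtractf diff_divide_distrib)
    have "path_density (Suc n) c = ennreal (?v n / ?v 0 * (?e 0 n / t ^ (N * n))) * ennreal (?v (Suc n) / ?v n * (?e n (Suc n) / t ^ N))"
      unfolding e Suc.IH using True i by (simp add: laguerre_kernel_def endpoint_density_def)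
    also have "\<dots> = ennreal ((?v n / ?v 0 * (?e 0 n / t ^ (N * n))) * (?v (Suc n) / ?v n * (?e n (Suc n) / t ^ N)))"
      using v t by (intro ennreal_mult[symmetric] mult_nonneg_nonneg divide_nonneg_nonneg) auto
    also have "(?v n / ?v 0 * (?e 0 n / t ^ (N * n))) * (?v (Suc n) / ?v n * (?e n (Suc n) / t ^ N)) =
        ?v (Suc n) / ?v 0 * ((?e 0 n * ?e n (Suc n)) / (t ^ (N * n) * t ^ N))"
      using v by simp
    also have "t ^ (N * n) * t ^ N = t ^ (N * Suc n)" by (simp add: power_add mult.commute)
    finally show ?thesis unfolding ex using True by (simp add: endpoint_density_def)
  next
    case False
    then have "path_density n c = 0 \<or> \<not> interlaced 1 N (\<lambda>j. c (j, n)) (\<lambda>j. c (j, Suc n))"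
      unfolding Suc.IH by (auto simp: less_Suc_eq)
    then have "path_density (Suc n) c = 0" unfolding e by (auto simp: laguerre_kernel_def)
    then show ?thesis by (simp only: if_not_P[OF False])
  qed
qed

text \<open>The entry at level \<open>Suc l\<close> is an integration variable of its own. The entry
  at level \<open>l\<close> is a different variable or, for \<open>l = 0\<close>, a constant
  determined by \<open>\<omega>\<close>.\<close>

lemma AE_config_distinct:
  assumes l: "l < n" and i: "i \<in> J" "i' \<in> J"
  shows "AE x in PiM (J \<times> {1..n}) (\<lambda>_. lborel). config n \<omega> x (i, Suc l) \<noteq> config n \<omega> x (i', l)"
proof -
  let ?P = "PiM (J \<times> {1..n}) (\<lambda>_. lborel :: real measure)"
  define c where "c x = (if l = 0 then X (i', 0) \<omega> else x (i', l))" for x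
  have c: "c \<in> borel_measurable ?P"
  proof (cases "l = 0")
    case False
    then have "(i', l) \<in> J \<times> {1..n}" using l i by (auto simp: One_nat_def)
    from measurable_component_singleton[OF this, of "\<lambda>_. lborel"] False
    show ?thesis by (simp add: c_def[abs_def])
  qed (simp add: c_def[abs_def])
  have "AE x in ?P. x (i, Suc l) \<noteq> c x"
    by (rule AE_PiM_lborel_neq[OF _ _ c]) (use l i in \<open>auto simp: c_def One_nat_def\<close>)
  then show ?thesis
    by (rule AE_mp) (rule AE_I2, use l i in \<open>auto simp: config_def c_def\<close>)
qed

lemma config_cong_outside:
  assumes "\<And>p. p \<in> J \<times> {1..n} - block k a b \<Longrightarrow> x p = x' p" "p \<notin> block k a b"
  shows "config n \<omega> x p = config n \<omega> x' p"
proof (cases "p \<in> J \<times> {..n}")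
  case True
  then show ?thesis using assms(1)[of p] assms(2) by (cases p) (auto simp: config_def One_nat_def Suc_le_eq)
qed (simp add: config_def)

text \<open>The entries of the block get the dummy value 0; it is harmless because only quantities
  that ignore the block are evaluated here.\<close>

definition rest_config :: "nat \<Rightarrow> nat \<Rightarrow> nat \<Rightarrow> nat \<Rightarrow> 'w \<Rightarrow> (nat \<times> nat \<Rightarrow> real) \<Rightarrow> nat \<times> nat \<Rightarrow> real" where
  "rest_config k a b n \<omega> r = config n \<omega> (merge (J \<times> {1..n} - block k a b) (block k a b) (r, \<lambda>_. 0))"

definition rest_density :: "nat \<Rightarrow> nat \<Rightarrow> nat \<Rightarrow> nat \<Rightarrow> 'w \<Rightarrow> (nat \<times> nat \<Rightarrow> real) \<Rightarrow> ennreal" where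
  "rest_density k a b n \<omega> r = indicator {c. outside_interlaced N k a b n c} (rest_config k a b n \<omega> r) *
     endpoint_density n (rest_config k a b n \<omega> r)"

lemma endpoint_density_cong:
  assumes "\<And>j. j \<in> J \<Longrightarrow> c (j, n) = c' (j, n)" "\<And>j. j \<in> J \<Longrightarrow> c (j, 0) = c' (j, 0)"
  shows "endpoint_density n c = endpoint_density n c'"
proof -
  have v: "vdm 1 N z = vdm 1 N z'" if "\<And>j. j \<in> J \<Longrightarrow> z j = z' j" for z z'
    unfolding vdm_def by (intro prod.cong refl arg_cong2[where f="(-)"] that) auto
  have s: "(\<Sum>j\<in>J. c (j, n) - c (j, 0)) = (\<Sum>j\<in>J. c' (j, n) - c' (j, 0))"
    by (intro sum.cong refl arg_cong2[where f="(-)"] assms)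
  have v0: "vdm 1 N (\<lambda>j. c (j, 0)) = vdm 1 N (\<lambda>j. c' (j, 0))" by (rule v) (rule assms(2))
  have vn: "vdm 1 N (\<lambda>j. c (j, n)) = vdm 1 N (\<lambda>j. c' (j, n))" by (rule v) (rule assms(1))
  show ?thesis unfolding endpoint_density_def s v0 vn ..
qed

lemma outside_interlaced_cong:
  assumes "k \<le> N" "\<And>p. p \<notin> block k a b \<Longrightarrow> c p = c' p"
  shows "outside_interlaced N k a b n c \<longleftrightarrow> outside_interlaced N k a b n c'"
proof -
  have "c (i, l) = c' (i, l)" "c (i, Suc l) = c' (i, Suc l)" "c (Suc i, l) = c' (Suc i, l)"
    if "\<not> (l \<in> {a..<b} \<and> i \<le> k)" for i l
    using that by (auto intro!: assms(2) simp: block_def)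
  then show ?thesis unfolding outside_interlaced_def by (intro all_cong ball_cong refl imp_cong) auto
qed

text \<open>For fixed surroundings the path density, off ties, is a constant times the indicator of
  the Gibbs set. Integrating out the block therefore leaves the Lebesgue mass of that set within
  \<open>E\<close>.\<close>

lemma nn_integral_block:
  assumes k: "1 \<le> k" "k \<le> N" and ab: "a < b" "b \<le> n"
    and \<psi>: "\<psi> \<in> borel_measurable (PiM (J \<times> {..n}) (\<lambda>_. borel))"
    and \<psi>_cong: "\<And>c c'. (\<And>p. p \<in> J \<times> {..n} - block k a b \<Longrightarrow> c p = c' p) \<Longrightarrow> \<psi> c = \<psi> c'"
    and E: "E \<in> sets (tuple_lebesgue k a b)"
  shows "(\<integral>\<^sup>+\<omega>. \<psi> (\<lambda>p\<in>J \<times> {..n}. X p \<omega>) * indicator E (restrict (\<lambda>p. X p \<omega>) (block k a b)) \<partial>M) =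
    (\<integral>\<^sup>+\<omega>. (\<integral>\<^sup>+r. rest_density k a b n \<omega> r * \<psi> (rest_config k a b n \<omega> r) *
      gibbs_mass N k a b E (rest_config k a b n \<omega> r) \<partial>PiM (J \<times> {1..n} - block k a b) (\<lambda>_. lborel)) \<partial>M)"
proof -
  interpret product_sigma_finite "\<lambda>_::nat \<times> nat. lborel :: real measure" by standard
  let ?K = "block k a b" and ?D = "J \<times> {1..n}" and ?C = "PiM (J \<times> {..n}) (\<lambda>_. borel :: real measure)"
  let ?R = "PiM (?D - ?K) (\<lambda>_. lborel :: real measure)"
  have KD: "?K \<subseteq> ?D" using k ab by (auto simp: block_def One_nat_def)
  have KC: "?K \<subseteq> J \<times> {..n}" using k ab by (auto simp: block_def)
  let ?f = "\<lambda>c. \<psi> c * indicator E (restrict c ?K)"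
  have rK: "(\<lambda>c. restrict c ?K) \<in> ?C \<rightarrow>\<^sub>M tuple_lebesgue k a b"
    unfolding tuple_lebesgue_def
    by (intro measurable_restrict, rule measurable_compose[OF measurable_component_singleton]) (use KC in auto)
  have f: "?f \<in> borel_measurable ?C"
    by (intro borel_measurable_times_ennreal \<psi> measurable_compose[OF rK] borel_measurable_indicator E)
  have rr: "restrict (\<lambda>p\<in>J \<times> {..n}. X p \<omega>) ?K = restrict (\<lambda>p. X p \<omega>) ?K" for \<omega>
    using KC by (auto simp: fun_eq_iff restrict_def)
  have cm: "config n \<omega> \<in> PiM ?D (\<lambda>_. lborel) \<rightarrow>\<^sub>M ?C" for \<omega>
  proof (rule config_measurable)
    fix p assume "p \<in> ?D"
    from measurable_component_singleton[OF this, of "\<lambda>_. lborel"]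
    show "(\<lambda>z. z p) \<in> borel_measurable (PiM ?D (\<lambda>_. lborel))" by simp
  qed simp
  have Cc: "(\<lambda>c. c p) \<in> borel_measurable ?C" if "p \<in> J \<times> {..n}" for p
    using measurable_component_singleton[OF that, of "\<lambda>_. borel"] .
  have om: "Measurable.pred ?C (\<lambda>c. outside_interlaced N k a b n c)"
  proof -
    have "outside_interlaced N k a b n c \<longleftrightarrow> (\<forall>l\<in>{..<n}. \<forall>i\<in>J. \<not> (l \<in> {a..<b} \<and> i \<le> k) \<longrightarrow>
       c (i, l) < c (i, Suc l) \<and> (i < N \<longrightarrow> c (i, Suc l) < c (Suc i, l)))" for c
      by (auto simp: outside_interlaced_def)
    moreover have "Measurable.pred ?C (\<lambda>c. \<forall>l\<in>{..<n}. \<forall>i\<in>J. \<not> (l \<in> {a..<b} \<and> i \<le> k) \<longrightarrow>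
       c (i, l) < c (i, Suc l) \<and> (i < N \<longrightarrow> c (i, Suc l) < c (Suc i, l)))"
      by (intro pred_intros_finite pred_intros_imp' pred_intros_conj1' pred_intros_logic(3) pred_intros_logic borel_measurable_pred_less Cc) auto
    ultimately show ?thesis by simp
  qed
  have em: "endpoint_density n \<in> borel_measurable ?C"
  proof -
    have v: "(\<lambda>c. vdm 1 N (\<lambda>j. c (j, l))) \<in> borel_measurable ?C" if "l \<le> n" for l
      unfolding vdm_def using that by (intro borel_measurable_prod borel_measurable_diff Cc) auto
    note [measurable] = v[OF order_refl] v[OF le0]
    have [measurable]: "(\<lambda>c. \<Sum>j\<in>J. c (j, n) - c (j, 0)) \<in> borel_measurable ?C"
      by (intro borel_measurable_sum borel_measurable_diff Cc) auto
    show ?thesis unfolding endpoint_density_def[abs_def] by measurable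
  qed
  have gm: "Measurable.pred ?C (\<lambda>c. restrict c ?K \<in> gibbs_set N k a b c)"
    by (rule gibbs_set_measurable[OF k(2) _ rK]) (use ab in \<open>auto intro!: Cc\<close>)
  define g where "g c = indicator {c. outside_interlaced N k a b n c} c * endpoint_density n c *
    indicator {c. restrict c ?K \<in> gibbs_set N k a b c} c * ?f c" for c
  have gmeas: "g \<in> borel_measurable ?C"
    unfolding g_def by (intro borel_measurable_times_ennreal f em borel_measurable_indicator')
      (use om gm in \<open>auto simp: pred_def Int_def conj_commute\<close>)
  have "(\<integral>\<^sup>+\<omega>. \<psi> (\<lambda>p\<in>J \<times> {..n}. X p \<omega>) * indicator E (restrict (\<lambda>p. X p \<omega>) ?K) \<partial>M) =
      (\<integral>\<^sup>+\<omega>. (\<integral>\<^sup>+x. path_density n (config n \<omega> x) * ?f (config n \<omega> x) \<partial>PiM ?D (\<lambda>_. lborel)) \<partial>M)"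
    using nn_integral_levels[OF f] unfolding rr .
  also have "\<dots> = (\<integral>\<^sup>+\<omega>. (\<integral>\<^sup>+r. rest_density k a b n \<omega> r * \<psi> (rest_config k a b n \<omega> r) *
      gibbs_mass N k a b E (rest_config k a b n \<omega> r) \<partial>?R) \<partial>M)"
  proof (rule nn_integral_cong_AE, rule AE_mp[OF AE_X_weyl_pos[of 0]], intro AE_I2 impI)
    fix \<omega> assume \<omega>: "\<omega> \<in> space M" and pos: "strict_mono_on J (\<lambda>j. X (j, 0) \<omega>) \<and> (\<forall>j\<in>J. 0 < X (j, 0) \<omega>)"
    have s0: "strict_mono_on J (\<lambda>j. config n \<omega> x (j, 0))" for x
      using pos by (simp add: config_def strict_mono_on_def)
    \<comment> \<open>Ties between adjacent levels form a null set for the integration variables, so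
      strict and weak interlacing may be exchanged.\<close>
    have dist: "AE x in PiM ?D (\<lambda>_. lborel). \<forall>l\<in>{..<n}. \<forall>i\<in>J. \<forall>i'\<in>J. config n \<omega> x (i, Suc l) \<noteq> config n \<omega> x (i', l)"
      by (intro AE_finite_allI AE_config_distinct) auto
    have "(\<integral>\<^sup>+x. path_density n (config n \<omega> x) * ?f (config n \<omega> x) \<partial>PiM ?D (\<lambda>_. lborel)) =
        (\<integral>\<^sup>+x. g (config n \<omega> x) \<partial>PiM ?D (\<lambda>_. lborel))"
    proof (rule nn_integral_cong_AE, rule AE_mp[OF dist], intro AE_I2 impI)
      fix x assume d: "\<forall>l\<in>{..<n}. \<forall>i\<in>J. \<forall>i'\<in>J. config n \<omega> x (i, Suc l) \<noteq> config n \<omega> x (i', l)"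
      have d': "config n \<omega> x (i, Suc l) \<noteq> config n \<omega> x (i', l)" if "l < n" "i \<in> J" "i' \<in> J" for i i' l
        using d that by blast
      have "(\<forall>l<n. interlaced 1 N (\<lambda>j. config n \<omega> x (j, l)) (\<lambda>j. config n \<omega> x (j, Suc l))) \<longleftrightarrow>
         outside_interlaced N k a b n (config n \<omega> x) \<and> restrict (config n \<omega> x) ?K \<in> gibbs_set N k a b (config n \<omega> x)"
      proof (rule all_interlaced_iff[OF k(2) ab(2)])
        fix i l assume il: "l < n" "i \<in> J"
        show "config n \<omega> x (i, l) \<noteq> config n \<omega> x (i, Suc l)" by (rule not_sym[OF d'[OF il il(2)]])
      next
        fix i l assume il: "l < n" "i \<in> J" "i < N"
        then have "Suc i \<in> J" by simp
        with il show "config n \<omega> x (i, Suc l) \<noteq> config n \<omega> x (Suc i, l)" by (intro d')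
      qed
      then show "path_density n (config n \<omega> x) * ?f (config n \<omega> x) = g (config n \<omega> x)"
        unfolding path_density_telescope[OF s0] g_def by (simp add: indicator_def)
    qed
    also have "\<dots> = (\<integral>\<^sup>+r. (\<integral>\<^sup>+w. g (config n \<omega> (merge (?D - ?K) ?K (r, w))) \<partial>PiM ?K (\<lambda>_. lborel)) \<partial>?R)"
    proof -
      have U: "(?D - ?K) \<union> ?K = ?D" using KD by blast
      have D: "(?D - ?K) \<inter> ?K = {}" "finite (?D - ?K)" "finite ?K" by auto
      have "(\<lambda>x. g (config n \<omega> x)) \<in> borel_measurable (PiM ?D (\<lambda>_. lborel))"
        by (rule measurable_compose[OF cm gmeas])
      then have "(\<lambda>x. g (config n \<omega> x)) \<in> borel_measurable (PiM ((?D - ?K) \<union> ?K) (\<lambda>_. lborel))"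
        unfolding U .
      from product_nn_integral_fold[OF D this] show ?thesis unfolding U .
    qed
    also have "\<dots> = (\<integral>\<^sup>+r. rest_density k a b n \<omega> r * \<psi> (rest_config k a b n \<omega> r) *
      gibbs_mass N k a b E (rest_config k a b n \<omega> r) \<partial>?R)"
    proof (rule nn_integral_cong)
      fix r
      let ?c = "rest_config k a b n \<omega> r"
      \<comment> \<open>Everything but the two indicators is evaluated at \<open>?c\<close> instead
        of \<open>?cw\<close>: these factors do not see the block and come out of the inner
        integral.\<close>
      have gw: "g (config n \<omega> (merge (?D - ?K) ?K (r, w))) =
          (rest_density k a b n \<omega> r * \<psi> ?c) * (indicator (gibbs_set N k a b ?c) w * indicator E w)"
        if w: "w \<in> space (PiM ?K (\<lambda>_. lborel))" for w
      proof -
        let ?cw = "config n \<omega> (merge (?D - ?K) ?K (r, w))"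
        have same: "?cw p = ?c p" if "p \<notin> ?K" for p
          unfolding rest_config_def by (rule config_cong_outside[OF _ that]) (simp add: merge_def)
        have wK: "restrict ?cw ?K = w"
        proof
          fix p show "restrict ?cw ?K p = w p"
          proof (cases "p \<in> ?K")
            case True
            then have "snd p \<noteq> 0" "p \<in> J \<times> {..n}" using KC by (auto simp: block_def)
            then show ?thesis using True by (simp add: config_def merge_def)
          next
            case False
            then show ?thesis using w by (cases p) (simp add: space_PiM PiE_def extensional_def)
          qed
        qed
        \<comment> \<open>The block lies strictly between \<open>a\<close> and \<open>b\<close>, so
          the levels 0 and \<open>n\<close>, on which the endpoint density depends, are
          untouched.\<close>
        have "(0::nat) \<notin> {a<..<b}" "n \<notin> {a<..<b}" using ab by auto
        then have "endpoint_density n ?cw = endpoint_density n ?c"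
          by (intro endpoint_density_cong same) (auto simp: block_def)
        moreover have "outside_interlaced N k a b n ?cw \<longleftrightarrow> outside_interlaced N k a b n ?c"
          by (rule outside_interlaced_cong[OF k(2)]) (rule same)
        moreover have "gibbs_set N k a b ?cw = gibbs_set N k a b ?c"
          by (rule gibbs_set_cong[OF k(2)]) (simp add: same)
        moreover have "\<psi> ?cw = \<psi> ?c" by (rule \<psi>_cong) (simp add: same)
        ultimately show ?thesis
          unfolding g_def rest_density_def wK by (simp add: indicator_def wK)
      qed
      have "(\<integral>\<^sup>+w. g (config n \<omega> (merge (?D - ?K) ?K (r, w))) \<partial>PiM ?K (\<lambda>_. lborel)) =
        (\<integral>\<^sup>+w. (rest_density k a b n \<omega> r * \<psi> ?c) * (indicator (gibbs_set N k a b ?c) w * indicator E w) \<partial>PiM ?K (\<lambda>_. lborel))"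
        by (rule nn_integral_cong) (rule gw)
      also have "\<dots> = (rest_density k a b n \<omega> r * \<psi> ?c) * (\<integral>\<^sup>+w. indicator (gibbs_set N k a b ?c) w * indicator E w \<partial>PiM ?K (\<lambda>_. lborel))"
        using gibbs_set_sets[OF k(2), of a b ?c] E
        by (intro nn_integral_cmult borel_measurable_times_ennreal borel_measurable_indicator) (auto simp: tuple_lebesgue_def)
      finally show "(\<integral>\<^sup>+w. g (config n \<omega> (merge (?D - ?K) ?K (r, w))) \<partial>PiM ?K (\<lambda>_. lborel)) =
          rest_density k a b n \<omega> r * \<psi> ?c * gibbs_mass N k a b E ?c"
        unfolding gibbs_mass_nn_integral[OF k(2) E] by (simp add: tuple_lebesgue_def)
    qed
    finally show "(\<integral>\<^sup>+x. path_density n (config n \<omega> x) * ?f (config n \<omega> x) \<partial>PiM ?D (\<lambda>_. lborel)) =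
      (\<integral>\<^sup>+r. rest_density k a b n \<omega> r * \<psi> (rest_config k a b n \<omega> r) *
      gibbs_mass N k a b E (rest_config k a b n \<omega> r) \<partial>?R)" .
  qed
  finally show ?thesis .
qed

end

section \<open>Conditional law of a block given its surroundings\<close>

lemma gibbs_mass_space: "gibbs_mass N k a b (space (tuple_lebesgue k a b)) x = gibbs_mass N k a b UNIV x"
  unfolding gibbs_mass_def by (rule arg_cong[where f="emeasure _"]) (auto simp: gibbs_set_def)

definition cond_mass :: "nat \<Rightarrow> nat \<Rightarrow> nat \<Rightarrow> nat \<Rightarrow> (nat \<times> nat \<Rightarrow> real) set \<Rightarrow> (nat \<times> nat \<Rightarrow> real) \<Rightarrow> ennreal" where
  "cond_mass N k a b E x = gibbs_mass N k a b E x / gibbs_mass N k a b UNIV x"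

lemma cond_mass_measurable:
  assumes "k \<le> N" "E \<in> sets (tuple_lebesgue k a b)"
    and "\<And>p. p \<in> {1..N} \<times> {a..b} - block k a b \<Longrightarrow> (\<lambda>z. x z p) \<in> borel_measurable K"
  shows "(\<lambda>z. cond_mass N k a b E (x z)) \<in> borel_measurable K"
  unfolding cond_mass_def gibbs_mass_space[symmetric]
  by (intro borel_measurable_divide_ennreal gibbs_mass_measurable assms sets.top)

lemma cond_mass_cong:
  assumes "k \<le> N" "\<And>p. p \<in> {1..N} \<times> {a..b} - block k a b \<Longrightarrow> x p = x' p"
  shows "cond_mass N k a b E x = cond_mass N k a b E x'"
  unfolding cond_mass_def by (intro arg_cong2[where f="(/)"] gibbs_mass_cong assms)

lemma cond_mass_le_1:
  assumes "k \<le> N" shows "cond_mass N k a b E x \<le> 1"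
proof (cases "gibbs_mass N k a b UNIV x = 0")
  case True
  then show ?thesis using gibbs_mass_le[OF assms, of a b E x] by (simp add: cond_mass_def)
next
  case False
  then have "gibbs_mass N k a b UNIV x / gibbs_mass N k a b UNIV x = 1"
    by (rule gibbs_mass_divide_self[OF assms])
  then show ?thesis
    unfolding cond_mass_def using divide_right_mono_ennreal[OF gibbs_mass_le[OF assms, of a b E x], of "gibbs_mass N k a b UNIV x"]
    by simp
qed

lemma measure_uniform_gibbs_set:
  assumes "k \<le> N" "E \<in> sets (tuple_lebesgue k a b)"
  shows "measure (uniform_measure (tuple_lebesgue k a b) (gibbs_set N k a b x)) E = enn2real (cond_mass N k a b E x)"
  using gibbs_set_sets[OF assms(1)] assms(2) by (simp add: measure_def cond_mass_def gibbs_mass_def)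

context gaussian_entries
begin

lemma restrict_X_space: "restrict (\<lambda>p. X p \<omega>) (block k a b) \<in> space (tuple_lebesgue k a b)"
  by (simp add: tuple_lebesgue_def space_PiM)

text \<open>The block formula is applied twice, to \<open>\<psi>\<close> with the event
  \<open>E\<close> and to \<open>\<psi>\<close> times the conditional mass with the whole space. The
  integrands agree, as the conditional mass times the normalising mass is the mass of
  \<open>E\<close>.\<close>

lemma nn_integral_block_cond:
  assumes k: "1 \<le> k" "k \<le> N" and ab: "a < b" "b \<le> n"
    and \<psi>: "\<psi> \<in> borel_measurable (PiM (J \<times> {..n}) (\<lambda>_. borel))"
    and \<psi>_cong: "\<And>c c'. (\<And>p. p \<in> J \<times> {..n} - block k a b \<Longrightarrow> c p = c' p) \<Longrightarrow> \<psi> c = \<psi> c'"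
    and E: "E \<in> sets (tuple_lebesgue k a b)"
  shows "(\<integral>\<^sup>+\<omega>. \<psi> (\<lambda>p\<in>J \<times> {..n}. X p \<omega>) * indicator E (restrict (\<lambda>p. X p \<omega>) (block k a b)) \<partial>M) =
    (\<integral>\<^sup>+\<omega>. \<psi> (\<lambda>p\<in>J \<times> {..n}. X p \<omega>) * cond_mass N k a b E (\<lambda>p. X p \<omega>) \<partial>M)"
proof -
  define \<phi> where "\<phi> c = \<psi> c * cond_mass N k a b E c" for c
  let ?S = "space (tuple_lebesgue k a b)"
  have sub: "p \<in> J \<times> {..n}" if "p \<in> J \<times> {a..b} - block k a b" for p using that ab by auto
  have \<phi>: "\<phi> \<in> borel_measurable (PiM (J \<times> {..n}) (\<lambda>_. borel))"
    unfolding \<phi>_def[abs_def]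
    by (intro borel_measurable_times_ennreal \<psi> cond_mass_measurable k E measurable_component_singleton sub)
  have \<phi>_cong: "\<phi> c = \<phi> c'" if "\<And>p. p \<in> J \<times> {..n} - block k a b \<Longrightarrow> c p = c' p" for c c'
    unfolding \<phi>_def by (intro arg_cong2[where f=times] \<psi>_cong cond_mass_cong that k) (use ab in auto)
  have e: "rest_density k a b n \<omega> r * \<phi> c * gibbs_mass N k a b ?S c =
      rest_density k a b n \<omega> r * \<psi> c * gibbs_mass N k a b E c" for \<omega> r c
    unfolding \<phi>_def cond_mass_def gibbs_mass_space
    using gibbs_mass_divide[OF k(2), of a b E c] by (simp only: mult.assoc)
  have "(\<integral>\<^sup>+\<omega>. \<psi> (\<lambda>p\<in>J \<times> {..n}. X p \<omega>) * cond_mass N k a b E (\<lambda>p. X p \<omega>) \<partial>M) =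
      (\<integral>\<^sup>+\<omega>. \<phi> (\<lambda>p\<in>J \<times> {..n}. X p \<omega>) * indicator ?S (restrict (\<lambda>p. X p \<omega>) (block k a b)) \<partial>M)"
  proof (rule nn_integral_cong)
    fix \<omega>
    have "cond_mass N k a b E (\<lambda>p. X p \<omega>) = cond_mass N k a b E (\<lambda>p\<in>J \<times> {..n}. X p \<omega>)"
      by (rule cond_mass_cong[OF k(2)]) (use sub in auto)
    then show "\<psi> (\<lambda>p\<in>J \<times> {..n}. X p \<omega>) * cond_mass N k a b E (\<lambda>p. X p \<omega>) =
      \<phi> (\<lambda>p\<in>J \<times> {..n}. X p \<omega>) * indicator ?S (restrict (\<lambda>p. X p \<omega>) (block k a b))"
      using restrict_X_space by (simp add: \<phi>_def)
  qed
  also have "\<dots> = (\<integral>\<^sup>+\<omega>. \<psi> (\<lambda>p\<in>J \<times> {..n}. X p \<omega>) * indicator E (restrict (\<lambda>p. X p \<omega>) (block k a b)) \<partial>M)"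
    by (subst nn_integral_block[OF k ab \<phi> _ sets.top], rule \<phi>_cong, simp,
        subst nn_integral_block[OF k ab \<psi> _ E], rule \<psi>_cong, simp, simp only: e)
  finally show ?thesis ..
qed

text \<open>The block formula is tested on the event that the normalising mass vanishes. Its
  integrand contains that mass as a factor, so the event has probability 0.\<close>

lemma AE_gibbs_mass_pos:
  assumes k: "1 \<le> k" "k \<le> N" and ab: "a < b"
  shows "AE \<omega> in M. 0 < gibbs_mass N k a b UNIV (\<lambda>p. X p \<omega>)"
proof -
  let ?S = "space (tuple_lebesgue k a b)" and ?r = "\<lambda>\<omega>. \<lambda>p\<in>J \<times> {..b}. X p \<omega>"
  define \<psi> :: "(nat \<times> nat \<Rightarrow> real) \<Rightarrow> ennreal" where "\<psi> c = indicator {0} (gibbs_mass N k a b ?S c)" for c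
  have \<psi>: "\<psi> \<in> borel_measurable (PiM (J \<times> {..b}) (\<lambda>_. borel))"
    unfolding \<psi>_def[abs_def]
    by (rule measurable_compose[OF gibbs_mass_measurable[OF k(2) sets.top]])
      (auto intro!: measurable_component_singleton borel_measurable_indicator)
  have \<psi>_cong: "\<psi> c = \<psi> c'" if "\<And>p. p \<in> J \<times> {..b} - block k a b \<Longrightarrow> c p = c' p" for c c'
    unfolding \<psi>_def by (intro arg_cong[where f="indicator _"] gibbs_mass_cong k that) auto
  have rm: "?r \<in> M \<rightarrow>\<^sub>M PiM (J \<times> {..b}) (\<lambda>_. borel)"
    by (rule measurable_restrict) (auto intro: X_measurable)
  have e: "rest_density k a b b \<omega> r * \<psi> c * gibbs_mass N k a b ?S c = 0" for \<omega> r c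
    by (simp add: \<psi>_def indicator_def)
  have "(\<integral>\<^sup>+\<omega>. \<psi> (?r \<omega>) \<partial>M) = (\<integral>\<^sup>+\<omega>. \<psi> (?r \<omega>) * indicator ?S (restrict (\<lambda>p. X p \<omega>) (block k a b)) \<partial>M)"
    using restrict_X_space by simp
  also have "\<dots> = 0"
    by (subst nn_integral_block[OF k ab order_refl \<psi> _ sets.top], rule \<psi>_cong, simp, simp add: e)
  finally have "AE \<omega> in M. \<psi> (?r \<omega>) = 0"
    using nn_integral_0_iff_AE[OF measurable_compose[OF rm \<psi>]] by simp
  then show ?thesis
  proof (rule AE_mp, intro AE_I2 impI)
    fix \<omega> assume "\<psi> (?r \<omega>) = 0"
    moreover have "gibbs_mass N k a b UNIV (?r \<omega>) = gibbs_mass N k a b UNIV (\<lambda>p. X p \<omega>)"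
      by (rule gibbs_mass_cong[OF k(2)]) auto
    ultimately show "0 < gibbs_mass N k a b UNIV (\<lambda>p. X p \<omega>)"
      by (auto simp: \<psi>_def gibbs_mass_space indicator_def zero_less_iff_neq_zero split: if_splits)
  qed
qed

lemma restrict_field_measurable: "C \<subseteq> J \<times> UNIV \<Longrightarrow> restrict_field X C \<in> M \<rightarrow>\<^sub>M PiM C (\<lambda>_. borel)"
  unfolding restrict_field_def[abs_def] by (rule measurable_restrict) (auto intro: X_measurable)

lemma restrict_field_measurable_tuple_lebesgue:
  "k \<le> N \<Longrightarrow> restrict_field X (block k a b) \<in> M \<rightarrow>\<^sub>M tuple_lebesgue k a b"
  unfolding tuple_lebesgue_def restrict_field_def[abs_def]
  by (rule measurable_restrict) (auto simp: block_def intro!: X_measurable)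

lemma cond_mass_X_measurable:
  assumes k: "k \<le> N" and E: "E \<in> sets (tuple_lebesgue k a b)"
  shows "(\<lambda>\<omega>. cond_mass N k a b E (\<lambda>p. X p \<omega>)) \<in> borel_measurable M"
  by (rule cond_mass_measurable[OF k E]) (auto intro: X_measurable)

text \<open>As functions of \<open>S\<close> both sides are measures on a product over infinitely
  many indices. It suffices to compare them on cylinder sets, where
  \<open>nn_integral_block_cond\<close> applies to a product of indicators.\<close>

lemma nn_integral_restrict_field:
  assumes k: "1 \<le> k" "k \<le> N" and ab: "a < b" and E: "E \<in> sets (tuple_lebesgue k a b)"
    and S: "S \<in> sets (PiM (J \<times> UNIV - block k a b) (\<lambda>_. borel))"
  shows "(\<integral>\<^sup>+\<omega>. indicator S (restrict_field X (J \<times> UNIV - block k a b) \<omega>) *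
      indicator E (restrict_field X (block k a b) \<omega>) \<partial>M) =
    (\<integral>\<^sup>+\<omega>. indicator S (restrict_field X (J \<times> UNIV - block k a b) \<omega>) *
      cond_mass N k a b E (\<lambda>p. X p \<omega>) \<partial>M)"
proof -
  let ?C = "J \<times> UNIV - block k a b"
  let ?\<Pi> = "PiM ?C (\<lambda>_. borel :: real measure)"
  let ?T = "restrict_field X ?C"
  let ?\<mu> = "\<lambda>f. distr (density M f) ?\<Pi> ?T"
  let ?e = "\<lambda>\<omega>. indicator E (restrict_field X (block k a b) \<omega>) :: ennreal"
  let ?c = "\<lambda>\<omega>. cond_mass N k a b E (\<lambda>p. X p \<omega>)"
  have T: "?T \<in> M \<rightarrow>\<^sub>M ?\<Pi>" by (rule restrict_field_measurable) auto
  have e: "?e \<in> borel_measurable M"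
    by (rule measurable_compose[OF restrict_field_measurable_tuple_lebesgue[OF k(2)] borel_measurable_indicator[OF E]])
  have c: "?c \<in> borel_measurable M" by (rule cond_mass_X_measurable[OF k(2) E])
  have em: "emeasure (?\<mu> f) A = (\<integral>\<^sup>+\<omega>. indicator A (?T \<omega>) * f \<omega> \<partial>M)"
    if f: "f \<in> borel_measurable M" and A: "A \<in> sets ?\<Pi>" for f A
  proof -
    have "emeasure (?\<mu> f) A = (\<integral>\<^sup>+\<omega>. f \<omega> * indicator (?T -` A \<inter> space M) \<omega> \<partial>M)"
      using T A f by (simp add: emeasure_distr emeasure_density measurable_sets[OF T A])
    also have "\<dots> = (\<integral>\<^sup>+\<omega>. indicator A (?T \<omega>) * f \<omega> \<partial>M)"
      by (rule nn_integral_cong) (auto simp: indicator_def)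
    finally show ?thesis .
  qed
  have "?\<mu> ?e = ?\<mu> ?c"
  proof (rule measure_eqI_PiM_infinite)
    fix A I assume I: "finite I" "I \<subseteq> ?C" and A: "\<And>p. p \<in> I \<Longrightarrow> A p \<in> sets (borel :: real measure)"
    let ?B = "prod_emb ?C (\<lambda>_. borel) I (Pi\<^sub>E I A)"
    have B: "?B \<in> sets ?\<Pi>" using I A by (intro sets_PiM_I) auto
    \<comment> \<open>High enough for the block and for the finitely many coordinates in
      \<open>I\<close> to lie at levels up to \<open>n\<close>.\<close>
    define n where "n = Max (insert b (snd ` I))"
    have bn: "b \<le> n" unfolding n_def using I by simp
    have In: "I \<subseteq> J \<times> {..n}"
    proof
      fix p assume p: "p \<in> I"
      then have "snd p \<le> n" unfolding n_def using I by simp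
      then show "p \<in> J \<times> {..n}" using p I(2) by (cases p) auto
    qed
    define \<psi> :: "(nat \<times> nat \<Rightarrow> real) \<Rightarrow> ennreal" where "\<psi> c = (\<Prod>p\<in>I. indicator (A p) (c p))" for c
    have \<psi>: "\<psi> \<in> borel_measurable (PiM (J \<times> {..n}) (\<lambda>_. borel))"
      unfolding \<psi>_def[abs_def]
      by (intro borel_measurable_prod_ennreal measurable_compose[OF measurable_component_singleton] borel_measurable_indicator A)
        (use In in auto)
    have \<psi>_cong: "\<psi> c = \<psi> c'" if "\<And>p. p \<in> J \<times> {..n} - block k a b \<Longrightarrow> c p = c' p" for c c'
      unfolding \<psi>_def by (rule prod.cong[OF refl], subst that) (use I In in auto)
    have iB: "indicator ?B (?T \<omega>) = \<psi> (\<lambda>p\<in>J \<times> {..n}. X p \<omega>)" for \<omega>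
    proof -
      have "?T \<omega> \<in> ?B \<longleftrightarrow> (\<forall>p\<in>I. X p \<omega> \<in> A p)"
        using I(2) by (auto simp: prod_emb_def restrict_field_def PiE_iff subset_eq)
      moreover have "(\<Prod>p\<in>I. indicator (A p) (X p \<omega>)) = (if \<forall>p\<in>I. X p \<omega> \<in> A p then 1 else 0 :: ennreal)"
        using I(1) by (auto simp: indicator_def)
      moreover have "\<psi> (\<lambda>p\<in>J \<times> {..n}. X p \<omega>) = (\<Prod>p\<in>I. indicator (A p) (X p \<omega>))"
        unfolding \<psi>_def by (rule prod.cong[OF refl]) (use In in auto)
      ultimately show ?thesis by (simp add: indicator_def)
    qed
    show "emeasure (?\<mu> ?e) ?B = emeasure (?\<mu> ?c) ?B"
      unfolding em[OF e B] em[OF c B] iB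
      unfolding restrict_field_def by (rule nn_integral_block_cond[OF k ab bn \<psi> _ E], rule \<psi>_cong, simp)
  next
    have "emeasure (?\<mu> ?e) (space ?\<Pi>) \<le> (\<integral>\<^sup>+\<omega>. 1 \<partial>M)"
      unfolding em[OF e sets.top] by (intro nn_integral_mono) (auto simp: indicator_def)
    then show "finite_measure (?\<mu> ?e)"
      by (intro finite_measureI) (auto simp: emeasure_space_1 top_unique)
  qed simp_all
  then show ?thesis unfolding em[OF e S, symmetric] em[OF c S, symmetric] by (rule arg_cong)
qed

text \<open>Conditional expectation is characterised by measurability in the outside configuration
  and by the integrals over the sets of that sigma-algebra; the latter are supplied by
  \<open>nn_integral_restrict_field\<close>.\<close>

lemma has_cond_law_gibbs_set:
  assumes k: "1 \<le> k" "k \<le> N" and ab: "a < b"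
  shows "has_cond_law M (sigma_field M X (J \<times> UNIV - block k a b)) (tuple_lebesgue k a b)
    (restrict_field X (block k a b)) (\<lambda>\<omega>. uniform_measure (tuple_lebesgue k a b) (gibbs_set N k a b (\<lambda>p. X p \<omega>)))"
  unfolding has_cond_law_def
proof (intro conjI ballI)
  let ?C = "J \<times> UNIV - block k a b"
  let ?\<Pi> = "PiM ?C (\<lambda>_. borel :: real measure)"
  let ?T = "restrict_field X ?C" and ?Y = "restrict_field X (block k a b)"
  let ?F = "sigma_field M X ?C"
  have T: "?T \<in> M \<rightarrow>\<^sub>M ?\<Pi>" by (rule restrict_field_measurable) auto
  have TF: "?T \<in> ?F \<rightarrow>\<^sub>M ?\<Pi>"
    unfolding sigma_field_def by (rule measurable_vimage_algebra1) (use measurable_space[OF T] in blast)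
  have setsF: "sets ?F = {?T -` A \<inter> space M | A. A \<in> sets ?\<Pi>}"
    unfolding sigma_field_def by (rule sets_vimage_algebra2) (use measurable_space[OF T] in blast)
  have sub: "subalgebra M ?F"
    unfolding subalgebra_def
  proof
    show "space ?F = space M" by (simp add: sigma_field_def)
    show "sets ?F \<subseteq> sets M" unfolding setsF using measurable_sets[OF T] by blast
  qed
  interpret sigma_finite_subalgebra M ?F
    by (rule finite_measure_subalgebra_is_sigma_finite) (unfold_locales, rule sub)
  show Y: "?Y \<in> M \<rightarrow>\<^sub>M tuple_lebesgue k a b" by (rule restrict_field_measurable_tuple_lebesgue[OF k(2)])
  fix E assume E: "E \<in> sets (tuple_lebesgue k a b)"
  define g where "g \<omega> = enn2real (cond_mass N k a b E (\<lambda>p. X p \<omega>))" for \<omega>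
  \<comment> \<open>The conditional mass is at most 1, hence finite, and nothing is lost in passing
    to real numbers.\<close>
  have ennreal_g: "ennreal (g \<omega>) = cond_mass N k a b E (\<lambda>p. X p \<omega>)" for \<omega>
    unfolding g_def using cond_mass_le_1[OF k(2), of a b E "\<lambda>p. X p \<omega>"]
    by (intro ennreal_enn2real) (auto intro: le_less_trans)
  have g0: "0 \<le> g \<omega>" for \<omega> by (simp add: g_def)
  have g1: "g \<omega> \<le> 1" for \<omega>
    using cond_mass_le_1[OF k(2), of a b E "\<lambda>p. X p \<omega>"] unfolding ennreal_g[symmetric] by simp
  have "(\<lambda>\<omega>. X p \<omega>) \<in> borel_measurable ?F" if "p \<in> ?C" for p
    using measurable_compose[OF TF measurable_component_singleton[OF that]] that by (simp add: restrict_field_def)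
  then have gF: "g \<in> borel_measurable ?F"
    unfolding g_def[abs_def] by (intro borel_measurable_enn2real cond_mass_measurable k E) auto
  then have gM: "g \<in> borel_measurable M" by (rule measurable_from_subalg[OF sub])
  let ?i = "indicator (?Y -` E \<inter> space M) :: 'w \<Rightarrow> real"
  have YE: "?Y -` E \<inter> space M \<in> sets M" by (rule measurable_sets[OF Y E])
  have "AE \<omega> in M. real_cond_exp M ?F ?i \<omega> = g \<omega>"
  proof (rule real_cond_exp_charact[OF _ _ _ gF])
    show "integrable M g"
      by (rule integrable_const_bound[of _ 1]) (use gM g0 g1 in auto)
    show "integrable M ?i" using YE by (simp add: integrable_indicator_iff less_top[symmetric])
    fix A assume "A \<in> sets ?F"
    then obtain S where S: "S \<in> sets ?\<Pi>" and A: "A = ?T -` S \<inter> space M" unfolding setsF by blast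
    have Am: "A \<in> sets M" unfolding A by (rule measurable_sets[OF T S])
    have "(\<integral>\<omega>\<in>A. ?i \<omega> \<partial>M) = enn2real (\<integral>\<^sup>+\<omega>. ennreal (indicator A \<omega> * ?i \<omega>) \<partial>M)"
      unfolding set_lebesgue_integral_def real_scaleR_def
      by (rule integral_eq_nn_integral) (use Am YE in \<open>auto intro!: borel_measurable_times borel_measurable_indicator\<close>)
    also have "(\<integral>\<^sup>+\<omega>. ennreal (indicator A \<omega> * ?i \<omega>) \<partial>M) = (\<integral>\<^sup>+\<omega>. indicator S (?T \<omega>) * indicator E (?Y \<omega>) \<partial>M)"
      by (rule nn_integral_cong) (auto simp: A indicator_def)
    also have "\<dots> = (\<integral>\<^sup>+\<omega>. indicator S (?T \<omega>) * cond_mass N k a b E (\<lambda>p. X p \<omega>) \<partial>M)"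
      by (rule nn_integral_restrict_field[OF k ab E S])
    also have "\<dots> = (\<integral>\<^sup>+\<omega>. ennreal (indicator A \<omega> * g \<omega>) \<partial>M)"
      by (rule nn_integral_cong) (auto simp: A indicator_def ennreal_g)
    also have "enn2real \<dots> = (\<integral>\<omega>\<in>A. g \<omega> \<partial>M)"
      unfolding set_lebesgue_integral_def real_scaleR_def
      by (rule integral_eq_nn_integral[symmetric]) (use Am gM g0 in \<open>auto intro!: borel_measurable_times borel_measurable_indicator\<close>)
    finally show "(\<integral>\<omega>\<in>A. ?i \<omega> \<partial>M) = (\<integral>\<omega>\<in>A. g \<omega> \<partial>M)" .
  qed
  then show "AE \<omega> in M. real_cond_exp M ?F ?i \<omega> =
      measure (uniform_measure (tuple_lebesgue k a b) (gibbs_set N k a b (\<lambda>p. X p \<omega>))) E"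
    unfolding measure_uniform_gibbs_set[OF k(2) E] g_def .
qed

lemma exponential_gibbs_X: "exponential_gibbs M N X"
  unfolding exponential_gibbs_def
proof (intro conjI allI impI ballI)
  show "X (j, a) \<in> borel_measurable M" if "j \<in> J" for j a using that by (rule X_measurable)
  show "AE \<omega> in M. weyl_pos N (\<lambda>j. X (j, a) \<omega>)" for a
    unfolding weyl_pos_def weyl_def by (rule AE_X_weyl_pos)
next
  fix k a b :: nat assume "1 \<le> k \<and> k < N \<and> a < b"
  then have k: "1 \<le> k" "k < N" "k \<le> N" and ab: "a < b" by auto
  show "AE \<omega> in M. 0 < Z_bdry k a b (\<lambda>j. X (j, a) \<omega>) (\<lambda>j. X (j, b) \<omega>) (\<lambda>l. X (Suc k, l) \<omega>)"
    unfolding Z_bdry_def I_bdry_eq_gibbs_set[OF k(2) ab, of "\<lambda>p. X p _"]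
    using AE_gibbs_mass_pos[OF k(1,3) ab] unfolding gibbs_mass_def by simp
  show "has_cond_law M (sigma_field M X (J \<times> UNIV - block k a b)) (tuple_lebesgue k a b) (restrict_field X (block k a b))
      (\<lambda>\<omega>. P_bdry k a b (\<lambda>j. X (j, a) \<omega>) (\<lambda>j. X (j, b) \<omega>) (\<lambda>l. X (Suc k, l) \<omega>))"
    unfolding P_bdry_def I_bdry_eq_gibbs_set[OF k(2) ab, of "\<lambda>p. X p _"]
    by (rule has_cond_law_gibbs_set[OF k(1,3) ab])
next
  fix a b :: nat assume ab: "a < b"
  show "AE \<omega> in M. 0 < Z_free N a b (\<lambda>j. X (j, a) \<omega>) (\<lambda>j. X (j, b) \<omega>)"
    unfolding Z_free_def I_free_eq_gibbs_set[OF ab, of N "\<lambda>p. X p _"]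
    using AE_gibbs_mass_pos[OF N order_refl ab] unfolding gibbs_mass_def by simp
  show "has_cond_law M (sigma_field M X (J \<times> UNIV - block N a b)) (tuple_lebesgue N a b) (restrict_field X (block N a b))
      (\<lambda>\<omega>. P_free N a b (\<lambda>j. X (j, a) \<omega>) (\<lambda>j. X (j, b) \<omega>))"
    unfolding P_free_def I_free_eq_gibbs_set[OF ab, of N "\<lambda>p. X p _"]
    by (rule has_cond_law_gibbs_set[OF N order_refl ab])
qed

end

theorem lemma5p2:
  fixes M :: "'w measure"
    and B :: "nat \<Rightarrow> nat \<Rightarrow> real \<Rightarrow> 'w \<Rightarrow> complex"
    and N :: nat and t0 :: real
  assumes "prob_space M"
    and "iid_complex_brownian_motions M B"
    and "1 \<le> N" and "0 < t0"
  shows "exponential_gibbs M N (laguerre_eigenvalue B N t0)"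
proof -
  interpret prob_space M by fact
  let ?G = "\<lambda>\<omega>. \<lambda>(i, j). B i j t0 \<omega>"
  have cbm: "complex_brownian_motion M (B (fst p) (snd p))" if "p \<in> {1..} \<times> {1..}" for p
    using assms(2) that by (auto simp: iid_complex_brownian_motions_def)
  have paths: "indep_vars (\<lambda>_. path_space) (\<lambda>(i, j). path_of (B i j)) ({1..} \<times> {1..})"
    using assms(2) by (simp add: iid_complex_brownian_motions_def)
  interpret gaussian_entries M ?G t0 N
  proof
    show "0 < t0" "1 \<le> N" by fact+
    show "(\<lambda>\<omega>. ?G \<omega> p) \<in> borel_measurable M" "distr M borel (\<lambda>\<omega>. ?G \<omega> p) = cgauss t0"
      if "p \<in> {1..} \<times> {1..}" for p
      using complex_brownian_motion_cgauss[OF assms(1) cbm[OF that] assms(4)] by (simp_all add: case_prod_beta)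
    \<comment> \<open>Evaluation at time \<open>t0\<close> is measurable on path space, so
      independence of the paths passes to the matrix entries.\<close>
    have "indep_vars (\<lambda>_. borel) (\<lambda>p \<omega>. (\<lambda>(i, j). path_of (B i j)) p \<omega> t0) ({1..} \<times> {1..})"
      by (rule indep_vars_compose2[OF paths]) (use assms(4) in \<open>auto intro: measurable_component_singleton\<close>)
    then show "indep_vars (\<lambda>_. borel) (\<lambda>p \<omega>. ?G \<omega> p) ({1..} \<times> {1..})"
      using assms(4) by (simp add: case_prod_beta path_of_at)
  qed
  have "laguerre_eigenvalue B N t0 = X"
  proof (intro ext)
    fix p \<omega>
    have "mat_adjoint (brownian_matrix B N a t0 \<omega>) * brownian_matrix B N a t0 \<omega> = gram_mat (N + a) N (?G \<omega>)" for a
      using adjoint_mult_eq_gram_mat[of "N + a" N "?G \<omega>"] by (simp add: brownian_matrix_def)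
    then show "laguerre_eigenvalue B N t0 p \<omega> = X p \<omega>"
      by (cases p) (simp add: laguerre_eigenvalue_def X_def gram_ev_def gram_evals_def)
  qed
  then show ?thesis using exponential_gibbs_X by simp
qed

end
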